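(* Let $\mathbb T$ be the regular tree in which every vertex has $q+1$ neighbours, $q\ge 2$, with root $e$, graph metric $d$ and $|x|=d(e,x)$. For $d\in\mathbb N_0$ let $P_d$ be the transition matrix with $p_d(x,y)=\frac{1}{(q+1)q^{d-1}}$ if $d(x,y)=d$ (for $d\ge1$) and $0$ otherwise, $P_0=I$. Let $P=\sum_{d=0}^\infty a_d P_d$ with $a_d\ge 0$, $\sum_d a_d=1$, $a_d>0$ for at least one odd and at least one even $d$, and with super-exponential moments: $\limsup_{d\to\infty}a_d^{1/d}=0$. Let $\rho$ be the spectral radius of $P$. Then the ratio limit theorem holds with ratio limit kernel $H(x,y)=\varphi(d(x,y))/\varphi(|y|)$, where $\varphi(n)=\bigl(1+\frac{q-1}{q+1}n\bigr)q^{-n/2}$; the ratio limit compactification of $(\mathbb T,P)$ coincides analytically with the $\rho$-Martin compactification of $(\mathbb T,P)$; geometrically both are the end compactification $\mathbb T\cup\partial\mathbb T$, and for every $x\in\mathbb T$ and every end $\xi\in\partial\mathbb T$, $$K(x,\xi|\rho)=H(x,\xi)=q^{-\mathrm{hor}(x,\xi)/2}.$$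
   Context: General setting: $X$ is a countable set with a fixed root $e$, $P=(p(x,y))_{x,y\in X}$ is a stochastic transition matrix, irreducible and aperiodic (for all $x,y$ there is $k$ with $p^{(n)}(x,y)>0$ for all $n\ge k$, where $p^{(n)}$ are the $n$-step transition probabilities). The spectral radius is $\rho=\limsup_n p^{(n)}(x,y)^{1/n}$ (independent of $x,y$), and $r=1/\rho$. A ratio limit theorem holds if $h(x,y)=\lim_{n\to\infty}p^{(n)}(x,y)/p^{(n)}(e,e)\in(0,\infty)$ exists for all $x,y$; the ratio limit kernel is $H(x,y)=h(x,y)/h(e,y)$. The ratio limit compactification is the (up to homeomorphism fixing $X$) unique compact Hausdorff space containing $X$ as a discrete, open, dense subset such that each $H(x,\cdot)$ extends continuously to it and, for distinct boundary points $\xi\ne\eta$, there is $x\in X$ with $H(x,\xi)\neq H(x,\eta)$ (extended kernels also denoted $H$). The Green function is $G(x,y|z)=\sum_{n\ge0}p^{(n)}(x,y)z^n$, $F(x,y|z)=G(x,y|z)/G(y,y|z)$ (finite at $z=r$), and the $\rho$-Martin kernel is $K(x,y|\rho)=F(x,y|r)/F(e,y|r)$; the $\rho$-Martin compactification is defined as the ratio limit compactification but with $K(\cdot,\cdot|\rho)$ in place of $H$ (extended kernel also denoted $K(x,\xi|\rho)$). Two compactifications of $X$ coincide geometrically if the identity of $X$ extends to a homeomorphism between them; the $\rho$-Martin and ratio limit compactifications coincide analytically if there is such a homeomorphism $\tau$ from the $\rho$-Martin compactification onto the ratio limit compactification with $K(x,\xi|\rho)=H(x,\tau(\xi))$ for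 all $x\in X$ and all boundary points $\xi$. Tree notions: a ray is a one-sided infinite path of distinct successively adjacent vertices; two rays are equivalent if they differ by finitely many initial vertices; an end is an equivalence class of rays, $\partial\mathbb T$ is the set of ends. For $x\in\mathbb T$ and $w\in\mathbb T\cup\partial\mathbb T$ let $\pi(x,w)$ be the unique geodesic (or ray) from $x$ to $w$. The end compactification $\mathbb T\cup\partial\mathbb T$ has $\mathbb T$ discrete and, as neighbourhood basis of $\xi\in\partial\mathbb T$, the sets $\{w: x\in\pi(e,w)\}$, $x\in\pi(e,\xi)$. The confluent $v\wedge w$ of distinct $v,w$ is the vertex of $\pi(e,v)\cap\pi(e,w)$ furthest from $e$. The horocycle index is $\mathrm{hor}(x,\xi)=d(x,x\wedge\xi)-|x\wedge\xi|=\lim_{y\to\xi}\bigl(d(x,y)-|y|\bigr)$. *)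

theory Defs
  imports "HOL-Analysis.Analysis"
begin

text \<open>Vertices: reduced words over the alphabet {0..q} (no two consecutive letters equal);
  root e = []. Two vertices are adjacent iff one is obtained from the other by appending
  one letter. Every vertex then has exactly q+1 neighbours.\<close>

definition tree_vertices :: "nat \<Rightarrow> nat list set" where
  "tree_vertices q = {xs. (\<forall>i<length xs. xs ! i \<le> q) \<and>
                          (\<forall>i. Suc i < length xs \<longrightarrow> xs ! Suc i \<noteq> xs ! i)}"

definition tree_edges :: "nat \<Rightarrow> (nat list \<times> nat list) set" where
  "tree_edges q = {(x, y). x \<in> tree_vertices q \<and> y \<in> tree_vertices q \<and>
                      ((\<exists>c. y = x @ [c]) \<or> (\<exists>c. x = y @ [c]))}"

definition tdist :: "nat \<Rightarrow> nat list \<Rightarrow> nat list \<Rightarrow> nat" where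
  "tdist q x y = (LEAST n. (x, y) \<in> (tree_edges q) ^^ n)"

text \<open>Ends: each end contains exactly one ray starting at the root e; we represent the end
  by the letter sequence of that ray. The n-th vertex of the ray is eray xi n.\<close>

definition tree_ends :: "nat \<Rightarrow> (nat \<Rightarrow> nat) set" where
  "tree_ends q = {xi. (\<forall>i. xi i \<le> q) \<and> (\<forall>i. xi (Suc i) \<noteq> xi i)}"

definition eray :: "(nat \<Rightarrow> nat) \<Rightarrow> nat \<Rightarrow> nat list" where
  "eray xi n = map xi [0..<n]"

definition hor :: "nat \<Rightarrow> nat list \<Rightarrow> (nat \<Rightarrow> nat) \<Rightarrow> real" where
  "hor q x xi = lim (\<lambda>n. real (tdist q x (eray xi n)) - real (tdist q [] (eray xi n)))"

text \<open>End compactification T \<union> \<partial>T: points Inl v (vertices) and Inr xi (ends).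
  cone x = {w : x \<in> \<pi>(e,w)}.\<close>

definition cone :: "nat \<Rightarrow> nat list \<Rightarrow> (nat list + (nat \<Rightarrow> nat)) set" where
  "cone q x = Inl ` {w \<in> tree_vertices q. \<exists>zs. w = x @ zs}
            \<union> Inr ` {xi \<in> tree_ends q. eray xi (length x) = x}"

definition end_top :: "nat \<Rightarrow> (nat list + (nat \<Rightarrow> nat)) topology" where
  "end_top q = topology_generated_by
     ({{Inl v} | v. v \<in> tree_vertices q} \<union> {cone q x | x. x \<in> tree_vertices q})"

definition pd :: "nat \<Rightarrow> nat \<Rightarrow> nat list \<Rightarrow> nat list \<Rightarrow> real" where
  "pd q d x y = (if d = 0 then (if x = y then 1 else 0)
                 else if tdist q x y = d then 1 / ((real q + 1) * real q ^ (d - 1)) else 0)"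

definition Ptrans :: "nat \<Rightarrow> (nat \<Rightarrow> real) \<Rightarrow> nat list \<Rightarrow> nat list \<Rightarrow> real" where
  "Ptrans q a x y = (\<Sum>d. a d * pd q d x y)"

fun pn :: "nat \<Rightarrow> (nat \<Rightarrow> real) \<Rightarrow> nat \<Rightarrow> nat list \<Rightarrow> nat list \<Rightarrow> real" where
  "pn q a 0 x y = (if x = y then 1 else 0)"
| "pn q a (Suc n) x y = (\<Sum>\<^sub>\<infinity>z\<in>tree_vertices q. Ptrans q a x z * pn q a n z y)"

definition spec_rad :: "nat \<Rightarrow> (nat \<Rightarrow> real) \<Rightarrow> real" where
  "spec_rad q a = real_of_ereal (limsup (\<lambda>n. ereal (root n (pn q a n [] []))))"

definition green :: "nat \<Rightarrow> (nat \<Rightarrow> real) \<Rightarrow> nat list \<Rightarrow> nat list \<Rightarrow> real \<Rightarrow> real" where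
  "green q a x y z = (\<Sum>n. pn q a n x y * z ^ n)"

definition Ffun :: "nat \<Rightarrow> (nat \<Rightarrow> real) \<Rightarrow> nat list \<Rightarrow> nat list \<Rightarrow> real" where
  "Ffun q a x y = green q a x y (1 / spec_rad q a) / green q a y y (1 / spec_rad q a)"

definition martinK :: "nat \<Rightarrow> (nat \<Rightarrow> real) \<Rightarrow> nat list \<Rightarrow> nat list \<Rightarrow> real" where
  "martinK q a x y = Ffun q a x y / Ffun q a [] y"

definition ratio_limit_holds :: "nat \<Rightarrow> (nat \<Rightarrow> real) \<Rightarrow> bool" where
  "ratio_limit_holds q a \<longleftrightarrow> (\<forall>x\<in>tree_vertices q. \<forall>y\<in>tree_vertices q.
      \<exists>h>0. (\<lambda>n. pn q a n x y / pn q a n [] []) \<longlonglongrightarrow> h)"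

definition hlim :: "nat \<Rightarrow> (nat \<Rightarrow> real) \<Rightarrow> nat list \<Rightarrow> nat list \<Rightarrow> real" where
  "hlim q a x y = lim (\<lambda>n. pn q a n x y / pn q a n [] [])"

definition Hker :: "nat \<Rightarrow> (nat \<Rightarrow> real) \<Rightarrow> nat list \<Rightarrow> nat list \<Rightarrow> real" where
  "Hker q a x y = hlim q a x y / hlim q a [] y"

definition phi :: "nat \<Rightarrow> nat \<Rightarrow> real" where
  "phi q n = (1 + (real q - 1) / (real q + 1) * real n) * real q powr (- real n / 2)"

text \<open>Top (with X embedded via Inl) is a compact Hausdorff space containing X as a discrete,
  open, dense subset, Kext x is a continuous extension of Kern x (for every x \<in> X), and the
  extended kernels separate boundary points. By the uniqueness in the definition, this says
  that Top (with extended kernel Kext) IS the compactification associated with Kern.\<close>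

definition kernel_compactification ::
  "'x set \<Rightarrow> ('x \<Rightarrow> 'x \<Rightarrow> real) \<Rightarrow> ('x + 'b) topology \<Rightarrow> ('x \<Rightarrow> ('x + 'b) \<Rightarrow> real) \<Rightarrow> bool" where
  "kernel_compactification X Kern Top Kext \<longleftrightarrow>
     compact_space Top \<and> Hausdorff_space Top \<and>
     Inl ` X \<subseteq> topspace Top \<and>
     (\<forall>x\<in>X. openin Top {Inl x}) \<and>
     Top closure_of (Inl ` X) = topspace Top \<and>
     (\<forall>x\<in>X. continuous_map Top euclideanreal (Kext x)) \<and>
     (\<forall>x\<in>X. \<forall>y\<in>X. Kext x (Inl y) = Kern x y) \<and>
     (\<forall>\<xi>\<in>topspace Top - Inl ` X. \<forall>\<eta>\<in>topspace Top - Inl ` X.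
         \<xi> \<noteq> \<eta> \<longrightarrow> (\<exists>x\<in>X. Kext x \<xi> \<noteq> Kext x \<eta>))"

end

theory Submission
  imports Defs "HOL-Real_Asymp.Real_Asymp"
begin

text \<open>All operators \<open>P_d\<close> are polynomials in the simple random walk, so the spherical functions
  \<open>sph q k t\<close> diagonalise \<open>P\<close> and \<open>p^(n)(x,y)\<close> is the integral of \<open>sph q (d(x,y)) t * ahat t ^ n\<close>
  against the Plancherel measure on \<open>(0, pi)\<close>. The parity assumptions force \<open>|ahat|\<close> to be maximal
  only at \<open>t = 0\<close>; its value there is \<open>rho\<close>, and since \<open>ahat ^ n\<close> concentrates at \<open>0\<close>, the
  ratios tend to \<open>sph q k 0 = phi q k\<close>. Summing over \<open>n\<close>, the Green function at \<open>1 / rho\<close> is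
  \<open>q^(-k/2)\<close> times a sine coefficient of a function with a simple pole at \<open>0\<close>, and such
  coefficients tend to a positive constant. Hence both kernels have the form
  \<open>g (d(x,y)) / g (|y|)\<close> with \<open>g (m + 1) / g m\<close> tending to \<open>q^(-1/2)\<close>, and every kernel of this
  form induces the end compactification with boundary values \<open>q^(-hor/2)\<close>.\<close>

section \<open>Geometry of the tree\<close>

text \<open>Every estimate rests on one positivity: for \<open>q \<ge> 2\<close> the weights in
  \<open>sph\<close> are nonnegative and multiply cosines of integer frequencies of size at most
  \<open>k\<close>, so a bound on \<open>sph q k t\<close> reduces to a bound on
  \<open>cos (x * t)\<close> that can be summed against \<open>a\<close>. The small quantity is
  \<open>1 - cos t\<close> rather than \<open>t^2\<close>, because the inequalities in it hold for
  all \<open>t\<close>. No Plancherel theorem enters. The measure is written down explicitly, and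
  its key property is that \<open>sph q k\<close> has integral 1 for \<open>k = 0\<close> and 0
  otherwise, which is the case \<open>n = 0\<close> of the integral formula. Nor is any asymptotic
  formula for \<open>p^(n)\<close> derived: quotients only need the powers of \<open>ahat\<close> to
  concentrate. The delicate point is the Green function at the spectral radius, where
  \<open>1 / (rho - ahat t)\<close> grows like \<open>t^(-2)\<close>. The Plancherel weight carries
  the factor \<open>(sin t)^2\<close>: one \<open>sin t\<close> turns \<open>sph\<close> into sines,
  the other leaves a simple pole whose singular part is a multiple of \<open>cot (t / 2)\<close>,
  and all sine coefficients of \<open>cot (t / 2)\<close> are equal to \<open>pi\<close>.\<close>

fun cpl :: "'a list \<Rightarrow> 'a list \<Rightarrow> nat" where
  "cpl (x # xs) (y # ys) = (if x = y then Suc (cpl xs ys) else 0)"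
| "cpl _ _ = 0"

definition wdist :: "'a list \<Rightarrow> 'a list \<Rightarrow> nat" where
  "wdist x y = length x + length y - 2 * cpl x y"

lemma cpl_le: "cpl x y \<le> length x" "cpl x y \<le> length y"
  by (induction x y rule: cpl.induct) auto

lemma cpl_self [simp]: "cpl x x = length x"
  by (induction x) auto

lemma cpl_Nil2 [simp]: "cpl x [] = 0"
  by (cases x) auto

lemma cpl_append: "length x \<le> length y \<Longrightarrow> cpl x (y @ z) = cpl x y"
  by (induction x y rule: cpl.induct) auto

lemma cpl_eq_length_iff: "cpl x y = length x \<longleftrightarrow> (\<exists>z. y = x @ z)"
  by (induction x y rule: cpl.induct) auto

lemma cpl_snoc:
  "cpl (x @ [c]) y = (if \<exists>z. y = x @ c # z then Suc (cpl x y) else cpl x y)"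
proof (induction x arbitrary: y)
  case Nil
  then show ?case by (cases y) auto
next
  case (Cons a x)
  then show ?case by (cases y) auto
qed

lemma wdist_int: "int (wdist x y) = int (length x) + int (length y) - 2 * int (cpl x y)"
  using cpl_le[of x y] by (simp add: wdist_def)

text \<open>Every edge joins some \<open>x\<close> to some \<open>x @ [c]\<close>, so this one case
  decides how the distance to \<open>y\<close> changes along any edge.\<close>

lemma wdist_snoc:
  "int (wdist (x @ [c]) y) =
    (if \<exists>z. y = x @ c # z then int (wdist x y) - 1 else int (wdist x y) + 1)"
  by (simp add: wdist_int cpl_snoc)

lemma wdist_self [simp]: "wdist x x = 0"
  by (simp add: wdist_def)

lemma wdist_Nil [simp]: "wdist [] y = length y"
  by (simp add: wdist_def)

lemma wdist_eq_0_iff [simp]: "wdist x y = 0 \<longleftrightarrow> x = y"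
proof
  assume 0: "wdist x y = 0"
  then have "cpl x y = length x" "cpl x y = length y"
    using cpl_le[of x y] by (auto simp: wdist_def)
  then obtain z where "y = x @ z" "length x = length y"
    using cpl_eq_length_iff[of x y] by auto
  then show "x = y" by simp
qed simp

section \<open>Neighbours and the graph distance\<close>

definition nbrs :: "nat \<Rightarrow> nat list \<Rightarrow> nat list set" where
  "nbrs q x = {z. (x, z) \<in> tree_edges q}"

lemma Nil_in_vertices [simp]: "[] \<in> tree_vertices q"
  by (simp add: tree_vertices_def)

lemma snoc_in_vertices:
  "x @ [c] \<in> tree_vertices q \<longleftrightarrow> x \<in> tree_vertices q \<and> c \<le> q \<and> (x = [] \<or> c \<noteq> last x)"
proof
  assume A: "x @ [c] \<in> tree_vertices q"
  have 1: "x ! i \<le> q" if "i < length x" for i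
  proof -
    have "(x @ [c]) ! i \<le> q"
      using A that unfolding tree_vertices_def by simp
    then show ?thesis using that by (simp add: nth_append)
  qed
  have 2: "x ! Suc i \<noteq> x ! i" if "Suc i < length x" for i
  proof -
    have "(x @ [c]) ! Suc i \<noteq> (x @ [c]) ! i"
      using A that unfolding tree_vertices_def by simp
    then show ?thesis using that by (simp add: nth_append)
  qed
  have 3: "c \<le> q"
  proof -
    have "(x @ [c]) ! length x \<le> q"
      using A unfolding tree_vertices_def by (simp del: nth_append_length)
    then show ?thesis by simp
  qed
  have 4: "c \<noteq> last x" if ne: "x \<noteq> []"
  proof -
    obtain m where m: "length x = Suc m" using ne by (cases x) auto
    have "(x @ [c]) ! Suc m \<noteq> (x @ [c]) ! m"
      using A m unfolding tree_vertices_def by simp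
    then show ?thesis using m ne by (simp add: nth_append last_conv_nth)
  qed
  have "x \<in> tree_vertices q"
    using 1 2 unfolding tree_vertices_def by simp
  then show "x \<in> tree_vertices q \<and> c \<le> q \<and> (x = [] \<or> c \<noteq> last x)"
    using 3 4 by blast
next
  assume A: "x \<in> tree_vertices q \<and> c \<le> q \<and> (x = [] \<or> c \<noteq> last x)"
  have "(x @ [c]) ! i \<le> q" if "i < Suc (length x)" for i
    using A that unfolding tree_vertices_def by (cases "i = length x") (auto simp: nth_append)
  moreover have "(x @ [c]) ! Suc i \<noteq> (x @ [c]) ! i" if "i < length x" for i
  proof (cases "Suc i = length x")
    case True
    then have "x \<noteq> []" by auto
    then have "last x = x ! i" using True by (metis diff_Suc_1 last_conv_nth)
    then show ?thesis using A True by (auto simp: nth_append)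
  next
    case False
    then show ?thesis using A that unfolding tree_vertices_def by (auto simp: nth_append)
  qed
  ultimately show "x @ [c] \<in> tree_vertices q"
    unfolding tree_vertices_def by auto
qed

lemma prefix_in_vertices: "x @ y \<in> tree_vertices q \<Longrightarrow> x \<in> tree_vertices q"
proof (induction y rule: rev_induct)
  case (snoc c y)
  then show ?case using snoc_in_vertices[of "x @ y" c q] by simp
qed simp

lemma nbrs_Nil: "nbrs q [] = (\<lambda>c. [c]) ` {..q}"
  using snoc_in_vertices[of "[]" _ q] by (auto simp: nbrs_def tree_edges_def)

lemma nbrs_snoc:
  assumes "x @ [b] \<in> tree_vertices q"
  shows "nbrs q (x @ [b]) = insert x ((\<lambda>c. x @ [b, c]) ` ({..q} - {b}))"
  using assms snoc_in_vertices[of "x @ [b]" _ q] prefix_in_vertices[OF assms]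
  by (auto simp: nbrs_def tree_edges_def)

lemma nbrs_vertices: "z \<in> nbrs q x \<Longrightarrow> z \<in> tree_vertices q"
  by (auto simp: nbrs_def tree_edges_def)

lemma finite_nbrs [simp]: assumes "x \<in> tree_vertices q" shows "finite (nbrs q x)"
  using assms by (cases x rule: rev_cases) (auto simp: nbrs_Nil nbrs_snoc)

lemma card_nbrs: assumes "x \<in> tree_vertices q" shows "card (nbrs q x) = q + 1"
proof (cases x rule: rev_cases)
  case Nil
  then show ?thesis by (simp add: nbrs_Nil card_image inj_on_def)
next
  case (snoc y b)
  then have yb: "y @ [b] \<in> tree_vertices q" using assms by simp
  then have "b \<le> q" unfolding snoc_in_vertices by simp
  then have "card ({..q} - {b}) = q" by simp
  moreover have "inj_on (\<lambda>c. y @ [b, c]) ({..q} - {b})" by (simp add: inj_on_def)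
  ultimately have "card ((\<lambda>c. y @ [b, c]) ` ({..q} - {b})) = q" by (simp add: card_image)
  moreover have "y \<notin> (\<lambda>c. y @ [b, c]) ` ({..q} - {b})" by auto
  ultimately show ?thesis unfolding snoc nbrs_snoc[OF yb] by simp
qed

lemma nbrs_wdist:
  assumes "z \<in> nbrs q x"
  shows "wdist z y = Suc (wdist x y) \<or> wdist x y = Suc (wdist z y)"
proof -
  from assms consider c where "z = x @ [c]" | c where "x = z @ [c]"
    by (auto simp: nbrs_def tree_edges_def)
  then show ?thesis
  proof cases
    case 1
    then show ?thesis using wdist_snoc[of x c y] by (auto split: if_splits)
  next
    case 2
    then show ?thesis using wdist_snoc[of z c y] by (auto split: if_splits)
  qed
qed

text \<open>Uniqueness of geodesics in local form: if \<open>x\<close> is a prefix of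
  \<open>y\<close>, the closer neighbour is the child of \<open>x\<close> along \<open>y\<close>;
  otherwise it is the parent of \<open>x\<close>.\<close>

lemma closer_nbr:
  assumes x: "x \<in> tree_vertices q" and y: "y \<in> tree_vertices q" and "x \<noteq> y"
  shows "\<exists>w. {z \<in> nbrs q x. wdist x y = Suc (wdist z y)} = {w}"
proof (cases "\<exists>z. y = x @ z")
  case True
  then obtain c r where yy: "y = x @ c # r" using \<open>x \<noteq> y\<close> by (metis append_Nil2 neq_Nil_conv)
  have xc: "x @ [c] \<in> tree_vertices q"
    using y prefix_in_vertices[of "x @ [c]" r q] yy by simp
  have "z = x @ [c]" if z: "z \<in> nbrs q x" and d: "wdist x y = Suc (wdist z y)" for z
  proof -
    from z consider c' where "z = x @ [c']" | c' where "x = z @ [c']"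
      by (auto simp: nbrs_def tree_edges_def)
    then show ?thesis
    proof cases
      case 1
      then show ?thesis using d wdist_snoc[of x c' y] yy by (auto split: if_splits)
    next
      case 2
      then show ?thesis using d wdist_snoc[of z c' y] yy by (auto split: if_splits)
    qed
  qed
  moreover have "x @ [c] \<in> nbrs q x" using x xc by (auto simp: nbrs_def tree_edges_def)
  moreover have "wdist x y = Suc (wdist (x @ [c]) y)"
    using wdist_snoc[of x c y] yy by (auto split: if_splits)
  ultimately have "{z \<in> nbrs q x. wdist x y = Suc (wdist z y)} = {x @ [c]}" by blast
  then show ?thesis ..
next
  case False
  then obtain x' b where xx: "x = x' @ [b]" by (cases x rule: rev_cases) auto
  have x': "x' \<in> tree_vertices q" using x xx prefix_in_vertices by blast
  have "z = x'" if z: "z \<in> nbrs q x" and d: "wdist x y = Suc (wdist z y)" for z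
  proof -
    from z consider c' where "z = x @ [c']" | c' where "x = z @ [c']"
      by (auto simp: nbrs_def tree_edges_def)
    then show ?thesis
    proof cases
      case 1
      then show ?thesis using d wdist_snoc[of x c' y] False by (auto split: if_splits)
    next
      case 2
      then show ?thesis using xx by simp
    qed
  qed
  moreover have "x' \<in> nbrs q x" using x x' xx by (auto simp: nbrs_def tree_edges_def)
  moreover have "wdist x y = Suc (wdist x' y)"
    using wdist_snoc[of x' b y] xx False by (auto split: if_splits)
  ultimately have "{z \<in> nbrs q x. wdist x y = Suc (wdist z y)} = {x'}" by blast
  then show ?thesis ..
qed

lemma wdist_le_path: "(x, y) \<in> tree_edges q ^^ n \<Longrightarrow> wdist x y \<le> n"
proof (induction n arbitrary: x)
  case (Suc n)
  then obtain z where z: "(x, z) \<in> tree_edges q" "(z, y) \<in> tree_edges q ^^ n"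
    by (meson relpow_Suc_D2)
  then have "z \<in> nbrs q x" by (simp add: nbrs_def)
  then show ?case using Suc.IH[OF z(2)] nbrs_wdist[of z q x y] by linarith
qed simp

lemma path_of_wdist:
  assumes "y \<in> tree_vertices q"
  shows "x \<in> tree_vertices q \<Longrightarrow> wdist x y = n \<Longrightarrow> (x, y) \<in> tree_edges q ^^ n"
proof (induction n arbitrary: x)
  case (Suc n)
  then have "x \<noteq> y" by (metis wdist_self nat.distinct(1))
  then obtain z where z: "z \<in> nbrs q x" "wdist x y = Suc (wdist z y)"
    using closer_nbr[OF Suc.prems(1) assms] by blast
  then have "(z, y) \<in> tree_edges q ^^ n"
    using Suc.IH[OF nbrs_vertices[OF z(1)]] Suc.prems(2) by simp
  moreover have "(x, z) \<in> tree_edges q" using z(1) by (simp add: nbrs_def)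
  ultimately show ?case by (rule relpow_Suc_I2[rotated])
qed simp

text \<open>An edge changes \<open>wdist\<close> by exactly one, so no path is shorter than
  \<open>wdist x y\<close>; repeatedly moving to the closer neighbour attains it.\<close>

lemma tdist_eq_wdist:
  assumes "x \<in> tree_vertices q" "y \<in> tree_vertices q"
  shows "tdist q x y = wdist x y"
  unfolding tdist_def
proof (rule Least_equality)
  show "(x, y) \<in> tree_edges q ^^ wdist x y" using path_of_wdist assms by blast
qed (rule wdist_le_path)

section \<open>Spheres and the sphere-sum operators\<close>

definition sphere_at :: "nat \<Rightarrow> nat list \<Rightarrow> nat \<Rightarrow> nat list set" where
  "sphere_at q x d = {z \<in> tree_vertices q. wdist x z = d}"

lemma sphere_at_0: "x \<in> tree_vertices q \<Longrightarrow> sphere_at q x 0 = {x}"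
  by (auto simp: sphere_at_def)

lemma finite_sphere_at: "x \<in> tree_vertices q \<Longrightarrow> finite (sphere_at q x d)"
proof (induction d arbitrary: x)
  case (Suc d)
  have "sphere_at q x (Suc d) \<subseteq> (\<Union>z\<in>nbrs q x. sphere_at q z d)"
  proof
    fix y assume y: "y \<in> sphere_at q x (Suc d)"
    then have "x \<noteq> y" "y \<in> tree_vertices q" by (auto simp: sphere_at_def)
    then obtain z where "z \<in> nbrs q x" "wdist x y = Suc (wdist z y)"
      using closer_nbr[OF Suc.prems] by blast
    then show "y \<in> (\<Union>z\<in>nbrs q x. sphere_at q z d)" using y by (auto simp: sphere_at_def)
  qed
  then show ?case using Suc nbrs_vertices
    by (meson finite_UN_I finite_nbrs finite_subset)
qed (simp add: sphere_at_0)

lemma nbrs_count: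
  assumes x: "x \<in> tree_vertices q" and y: "y \<in> tree_vertices q"
  shows "card {z \<in> nbrs q x. wdist z y = d} =
    (if wdist x y = Suc d then 1 else if Suc (wdist x y) = d then (if x = y then q + 1 else q) else 0)"
proof (cases "x = y")
  case True
  then have "wdist z y = 1" if "z \<in> nbrs q x" for z
    using nbrs_wdist[OF that, of y] by auto
  then have "{z \<in> nbrs q x. wdist z y = d} = (if d = 1 then nbrs q x else {})" by auto
  then show ?thesis using True card_nbrs[OF x] by auto
next
  case False
  obtain w where w: "{z \<in> nbrs q x. wdist x y = Suc (wdist z y)} = {w}"
    using closer_nbr[OF x y False] by blast
  have w': "z \<in> nbrs q x \<and> wdist x y = Suc (wdist z y) \<longleftrightarrow> z = w" for z
    using w unfolding set_eq_iff mem_Collect_eq singleton_iff by (rule spec)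
  have "w \<in> nbrs q x" using w'[of w] by simp
  then have cd: "card (nbrs q x - {w}) = q"
    using card_nbrs[OF x] finite_nbrs[OF x] by simp
  have eq: "{z \<in> nbrs q x. wdist z y = d} =
    (if wdist x y = Suc d then {w} else if Suc (wdist x y) = d then nbrs q x - {w} else {})"
  proof (intro set_eqI)
    fix z
    show "z \<in> {z \<in> nbrs q x. wdist z y = d} \<longleftrightarrow> z \<in>
      (if wdist x y = Suc d then {w} else if Suc (wdist x y) = d then nbrs q x - {w} else {})"
    proof (cases "z \<in> nbrs q x")
      case True
      \<comment> \<open>Pure propositional bookkeeping, instantiated with
        \<open>n = wdist x y\<close>, \<open>k = wdist z y\<close> and \<open>P\<close> the
        statement \<open>z = w\<close>.\<close>
      have "n = Suc k \<longleftrightarrow> P \<Longrightarrow> k = Suc n \<or> n = Suc k \<Longrightarrow>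
          k = d \<longleftrightarrow> (if n = Suc d then P else if Suc n = d then \<not> P else False)" for n k :: nat and P
        by auto
      from this[OF _ nbrs_wdist[OF True, of y], of "z = w"] show ?thesis
        using w'[of z] True by simp
    next
      case False
      then show ?thesis using w'[of z] by (cases "z = w") auto
    qed
  qed
  show ?thesis unfolding eq using False cd by simp
qed

text \<open>The recurrence \<open>S_1 S_d = S_(d+1) + q S_(d-1)\<close> for the sphere sums
  \<open>S_d\<close>, with \<open>q + 1\<close> in place of \<open>q\<close> when
  \<open>d = 1\<close>. It is a double count: \<open>f y\<close> occurs once for every neighbour of
  \<open>x\<close> at distance \<open>d\<close> from \<open>y\<close>.\<close>

lemma sphere_sum_step:
  fixes f :: "nat list \<Rightarrow> real"
  assumes x: "x \<in> tree_vertices q"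
  shows "(\<Sum>w\<in>nbrs q x. sum f (sphere_at q w d)) =
    sum f (sphere_at q x (Suc d)) +
    (if d = 0 then 0 else if d = 1 then (real q + 1) * f x else real q * sum f (sphere_at q x (d - 1)))"
proof -
  \<comment> \<open>A neighbour of \<open>x\<close> is one step from \<open>x\<close>, so its sphere
    of radius \<open>d\<close> only meets the spheres of radius \<open>d + 1\<close> and
    \<open>d - 1\<close> about \<open>x\<close>.\<close>
  define Y where "Y = sphere_at q x (Suc d) \<union> (if d = 0 then {} else sphere_at q x (d - 1))"
  have fY: "finite Y" using finite_sphere_at[OF x] by (auto simp: Y_def)
  have sub: "sphere_at q w d \<subseteq> Y" if "w \<in> nbrs q x" for w
  proof
    fix y assume "y \<in> sphere_at q w d"
    then show "y \<in> Y"
      using nbrs_wdist[OF that, of y] by (auto simp: Y_def sphere_at_def)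
  qed
  have YV: "y \<in> tree_vertices q" if "y \<in> Y" for y
    using that by (auto simp: Y_def sphere_at_def split: if_splits)
  have "(\<Sum>w\<in>nbrs q x. sum f (sphere_at q w d)) =
        (\<Sum>w\<in>nbrs q x. \<Sum>y\<in>Y. if wdist w y = d then f y else 0)"
  proof (rule sum.cong[OF refl])
    fix w assume "w \<in> nbrs q x"
    then have "sphere_at q w d = {y \<in> Y. wdist w y = d}"
      using sub YV by (auto simp: sphere_at_def)
    then show "sum f (sphere_at q w d) = (\<Sum>y\<in>Y. if wdist w y = d then f y else 0)"
      using sum.inter_filter[OF fY, of f "\<lambda>y. wdist w y = d"] by simp
  qed
  also have "\<dots> = (\<Sum>y\<in>Y. \<Sum>w\<in>nbrs q x. if wdist w y = d then f y else 0)"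
    by (rule sum.swap)
  also have "\<dots> = (\<Sum>y\<in>Y. real (card {w \<in> nbrs q x. wdist w y = d}) * f y)"
    by (intro sum.cong[OF refl], subst sum.inter_filter[symmetric]) (simp_all add: finite_nbrs[OF x])
  also have "\<dots> = (\<Sum>y\<in>Y. (if wdist x y = Suc d then 1 else if Suc (wdist x y) = d
                     then (if x = y then real q + 1 else real q) else 0) * f y)"
    by (rule sum.cong[OF refl]) (simp add: nbrs_count[OF x YV])
  also have "\<dots> = sum f (sphere_at q x (Suc d)) +
    (if d = 0 then 0 else if d = 1 then (real q + 1) * f x else real q * sum f (sphere_at q x (d - 1)))"
  proof -
    have disj: "sphere_at q x (Suc d) \<inter> sphere_at q x (d - 1) = {}"
      by (auto simp: sphere_at_def)
    consider "d = 0" | "d = 1" | "d > 1" by linarith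
    then show ?thesis
    proof cases
      case 1
      have "sum f (sphere_at q x (Suc 0)) = (\<Sum>y\<in>Y. (if wdist x y = Suc d then 1 else if Suc (wdist x y) = d
                     then (if x = y then real q + 1 else real q) else 0) * f y)"
        by (rule sum.cong) (use 1 in \<open>simp_all add: Y_def sphere_at_def\<close>)
      then show ?thesis using 1 by simp
    next
      case 2
      have "(\<Sum>y\<in>sphere_at q x 2. (if wdist x y = Suc d then 1 else if Suc (wdist x y) = d
                     then (if x = y then real q + 1 else real q) else 0) * f y) = sum f (sphere_at q x 2)"
        by (rule sum.cong) (use 2 in \<open>simp_all add: sphere_at_def\<close>)
      moreover have "Y = insert x (sphere_at q x 2)"
        unfolding Y_def using 2 sphere_at_0[OF x] by (simp add: numeral_2_eq_2)
      moreover have "x \<notin> sphere_at q x 2" by (simp add: sphere_at_def)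
      ultimately show ?thesis using finite_sphere_at[OF x] 2 by (simp add: numeral_2_eq_2)
    next
      case 3
      have "(\<Sum>y\<in>sphere_at q x (Suc d). (if wdist x y = Suc d then 1 else if Suc (wdist x y) = d
                     then (if x = y then real q + 1 else real q) else 0) * f y) = sum f (sphere_at q x (Suc d))"
        by (rule sum.cong) (simp_all add: sphere_at_def)
      moreover have "(\<Sum>y\<in>sphere_at q x (d - 1). (if wdist x y = Suc d then 1 else if Suc (wdist x y) = d
                     then (if x = y then real q + 1 else real q) else 0) * f y) =
                     real q * sum f (sphere_at q x (d - 1))"
        unfolding sum_distrib_left
        by (rule sum.cong) (use 3 in \<open>auto simp: sphere_at_def\<close>)
      ultimately show ?thesis unfolding Y_def using disj finite_sphere_at[OF x] 3
        by (simp add: sum.union_disjoint)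
    qed
  qed
  finally show ?thesis .
qed

text \<open>The polynomial in the neighbour-sum operator that gives the sphere-sum operator of radius
  \<open>d\<close>, evaluated at an eigenvalue \<open>l\<close>.\<close>

fun sphere_eval :: "real \<Rightarrow> real \<Rightarrow> nat \<Rightarrow> real" where
  "sphere_eval q l 0 = 1"
| "sphere_eval q l (Suc 0) = l"
| "sphere_eval q l (Suc (Suc d)) =
     l * sphere_eval q l (Suc d) - (if d = 0 then q + 1 else q) * sphere_eval q l d"

text \<open>\<open>sphere_eval\<close> repeats the recurrence of \<open>sphere_sum_step\<close>, so
  an eigenfunction of the neighbour sum is one of all sphere sums. It is applied to the constant 1
  and to spherical functions centred at \<open>y\<close>.\<close>

lemma sphere_sum_eigen:
  fixes f :: "nat list \<Rightarrow> real"
  assumes eig: "\<And>x. x \<in> tree_vertices q \<Longrightarrow> sum f (nbrs q x) = l * f x"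
  shows "x \<in> tree_vertices q \<Longrightarrow> sum f (sphere_at q x d) = sphere_eval (real q) l d * f x"
proof (induction d arbitrary: x rule: less_induct)
  case (less d)
  note x = \<open>x \<in> tree_vertices q\<close>
  consider "d = 0" | "d = 1" | d' where "d = Suc (Suc d')"
    by (metis One_nat_def old.nat.exhaust)
  then show ?case
  proof cases
    case 1
    then show ?thesis by (simp add: sphere_at_0 x)
  next
    case 2
    have "sum f (sphere_at q x 1) = (\<Sum>w\<in>nbrs q x. sum f (sphere_at q w 0))"
      using sphere_sum_step[OF x, of f 0] by simp
    also have "\<dots> = sum f (nbrs q x)"
      by (rule sum.cong[OF refl]) (simp add: sphere_at_0 nbrs_vertices)
    finally show ?thesis using 2 eig[OF x] by simp
  next
    case (3 d')
    have "(\<Sum>w\<in>nbrs q x. sum f (sphere_at q w (Suc d'))) =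
          (\<Sum>w\<in>nbrs q x. sphere_eval q l (Suc d') * f w)"
      by (rule sum.cong[OF refl]) (use 3 less.IH nbrs_vertices in auto)
    also have "\<dots> = sphere_eval q l (Suc d') * (l * f x)"
      by (simp add: sum_distrib_left[symmetric] eig[OF x])
    finally have "sum f (sphere_at q x (Suc (Suc d'))) = sphere_eval q l (Suc d') * (l * f x) -
       (if d' = 0 then (real q + 1) * f x else real q * sum f (sphere_at q x d'))"
      using sphere_sum_step[OF x, of f "Suc d'"] by (cases "d' = 0") (auto simp: algebra_simps)
    moreover have "sum f (sphere_at q x d') = sphere_eval q l d' * f x"
      using less.IH[of d'] x 3 by simp
    ultimately show ?thesis using 3 by (cases "d' = 0") (auto simp: algebra_simps)
  qed
qed

definition sphere_size :: "nat \<Rightarrow> nat \<Rightarrow> real" where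
  "sphere_size q d = (if d = 0 then 1 else (real q + 1) * real q ^ (d - 1))"

lemma sphere_eval_sphere_size: "sphere_eval (real q) (real q + 1) d = sphere_size q d"
proof (induction d rule: less_induct)
  case (less d)
  consider "d = 0" | "d = 1" | "d = 2" | d' where "d = Suc (Suc (Suc d'))"
    by (metis One_nat_def Suc_1 old.nat.exhaust)
  then show ?case
  proof cases
    case 3
    then show ?thesis by (simp add: numeral_2_eq_2 sphere_size_def algebra_simps)
  next
    case (4 d')
    have "sphere_eval (real q) (real q + 1) d =
        (real q + 1) * sphere_eval (real q) (real q + 1) (Suc (Suc d')) -
        real q * sphere_eval (real q) (real q + 1) (Suc d')"
      unfolding 4 by (subst sphere_eval.simps(3)) simp
    also have "\<dots> = (real q + 1) * sphere_size q (Suc (Suc d')) - real q * sphere_size q (Suc d')"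
      using less[of "Suc d'"] less[of "Suc (Suc d')"] 4 by (simp del: sphere_eval.simps)
    finally show ?thesis using 4 by (simp add: sphere_size_def algebra_simps)
  qed (auto simp: sphere_size_def)
qed

text \<open>The constant function 1 is an eigenfunction with eigenvalue \<open>q + 1\<close>, so
  spheres are counted by the eigenvalue formula rather than by enumerating words.\<close>

lemma card_sphere_at: "x \<in> tree_vertices q \<Longrightarrow> real (card (sphere_at q x d)) = sphere_size q d"
  using sphere_sum_eigen[of q "\<lambda>_. 1" "real q + 1" x d]
  by (simp add: card_nbrs sphere_eval_sphere_size)

lemma nbrs_sum_radial:
  fixes g :: "nat \<Rightarrow> real"
  assumes x: "x \<in> tree_vertices q" and y: "y \<in> tree_vertices q"
  shows "(\<Sum>z\<in>nbrs q x. g (wdist z y)) =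
    (if x = y then (real q + 1) * g 1
     else g (wdist x y - 1) + real q * g (wdist x y + 1))"
proof -
  define n where "n = wdist x y"
  have *: "(\<Sum>z\<in>nbrs q x. if wdist z y = d then g d else 0) =
           real (card {z \<in> nbrs q x. wdist z y = d}) * g d" for d
    by (subst sum.inter_filter[symmetric]) (simp_all add: finite_nbrs[OF x])
  have "(\<Sum>z\<in>nbrs q x. g (wdist z y)) =
     (\<Sum>z\<in>nbrs q x. (if wdist z y = Suc n then g (Suc n) else 0) +
        (if n > 0 \<and> wdist z y = n - 1 then g (n - 1) else 0))"
  proof (rule sum.cong[OF refl])
    fix z assume "z \<in> nbrs q x"
    then consider "wdist z y = Suc n" | "n = Suc (wdist z y)"
      using nbrs_wdist[of z q x y] unfolding n_def by blast
    then have "wdist z y = Suc n \<and> wdist z y \<noteq> n - 1 \<or> n > 0 \<and> wdist z y = n - 1 \<and> wdist z y \<noteq> Suc n"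
      by cases auto
    then show "g (wdist z y) = (if wdist z y = Suc n then g (Suc n) else 0) +
        (if n > 0 \<and> wdist z y = n - 1 then g (n - 1) else 0)"
      by auto
  qed
  also have "\<dots> = (if x = y then (real q + 1) * g 1 else g (n - 1) + real q * g (n + 1))"
  proof (cases "x = y")
    case True
    then have "n = 0" by (simp add: n_def)
    then show ?thesis
      using *[of "Suc n"] nbrs_count[OF x y, of "Suc n"] True by (simp add: sum.distrib)
  next
    case False
    then have "n > 0" by (metis n_def gr0I wdist_eq_0_iff)
    then show ?thesis
      using *[of "Suc n"] *[of "n - 1"] nbrs_count[OF x y, of "Suc n"] nbrs_count[OF x y, of "n - 1"] False
      by (simp add: sum.distrib n_def)
  qed
  finally show ?thesis by (simp add: n_def)
qed

section \<open>Spherical functions\<close>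

text \<open>The Chebyshev polynomial of the second kind \<open>U_k (cos t)\<close>, that is
  \<open>sin ((k + 1) t) / sin t\<close>. The cosine form makes sense at \<open>t = 0\<close> and
  has coefficients 1, which the positivity arguments use.\<close>

definition cos_sum :: "nat \<Rightarrow> real \<Rightarrow> real" where
  "cos_sum k t = (\<Sum>j\<le>k. cos ((real k - 2 * real j) * t))"

lemma cos_sum_rec: "2 * cos t * cos_sum (Suc k) t = cos_sum (Suc (Suc k)) t + cos_sum k t"
proof -
  have "2 * cos t * cos ((real (Suc k) - 2 * real j) * t) =
      cos ((real (Suc (Suc k)) - 2 * real j) * t) + cos ((real k - 2 * real j) * t)" for j
  proof -
    have "cos ((real (Suc (Suc k)) - 2 * real j) * t) = cos ((real (Suc k) - 2 * real j) * t + t)"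
      "cos ((real k - 2 * real j) * t) = cos ((real (Suc k) - 2 * real j) * t - t)"
      by (simp_all add: algebra_simps)
    then show ?thesis by (simp add: cos_add cos_diff)
  qed
  then have "2 * cos t * cos_sum (Suc k) t = (\<Sum>j\<le>Suc k.
      cos ((real (Suc (Suc k)) - 2 * real j) * t) + cos ((real k - 2 * real j) * t))"
    by (simp only: cos_sum_def sum_distrib_left)
  also have "\<dots> = (\<Sum>j\<le>Suc k. cos ((real (Suc (Suc k)) - 2 * real j) * t)) +
      (\<Sum>j\<le>Suc k. cos ((real k - 2 * real j) * t))"
    by (rule sum.distrib)
  also have "\<dots> = cos_sum (Suc (Suc k)) t + cos_sum k t"
  proof -
    \<comment> \<open>The first sum lacks its last term and the second has one too many; both terms
      have frequency \<open>-(k + 2)\<close>, so they can be exchanged.\<close>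
    have "(real (Suc (Suc k)) - 2 * real (Suc (Suc k))) * t = (real k - 2 * real (Suc k)) * t"
      by (simp add: algebra_simps)
    then have "cos ((real (Suc (Suc k)) - 2 * real (Suc (Suc k))) * t) = cos ((real k - 2 * real (Suc k)) * t)"
      by (simp only:)
    then show ?thesis
      unfolding cos_sum_def sum.atMost_Suc[of _ "Suc k"] sum.atMost_Suc[of "\<lambda>j. cos ((real k - 2 * real j) * t)" k]
      by linarith
  qed
  finally show ?thesis .
qed

lemma sin_cos_sum: "sin t * cos_sum k t = sin (real (Suc k) * t)"
proof (induction k rule: less_induct)
  case (less k)
  consider "k = 0" | "k = 1" | m where "k = Suc (Suc m)" by (metis One_nat_def old.nat.exhaust)
  then show ?case
  proof cases
    case 1
    then show ?thesis by (simp add: cos_sum_def)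
  next
    case 2
    then show ?thesis by (simp add: cos_sum_def sin_double)
  next
    case (3 m)
    have "sin t * cos_sum k t = 2 * cos t * (sin t * cos_sum (Suc m) t) - sin t * cos_sum m t"
      using cos_sum_rec[of t m] 3 by (simp add: algebra_simps)
    also have "\<dots> = 2 * cos t * sin (real (Suc (Suc m)) * t) - sin (real (Suc m) * t)"
      using less[of m] less[of "Suc m"] 3 by simp
    also have "\<dots> = sin (real (Suc k) * t)"
    proof -
      have "sin (real (Suc k) * t) = sin (real (Suc (Suc m)) * t + t)"
        "sin (real (Suc m) * t) = sin (real (Suc (Suc m)) * t - t)"
        using 3 by (simp_all add: algebra_simps)
      then show ?thesis by (simp add: sin_add sin_diff)
    qed
    finally show ?thesis .
  qed
qed

lemma sin_mult_diff: "sin (real (Suc k) * t) - sin ((real k - 1) * t) = 2 * cos (real k * t) * sin t"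
proof -
  have "sin (real (Suc k) * t) = sin (real k * t + t)" "sin ((real k - 1) * t) = sin (real k * t - t)"
    by (simp_all add: algebra_simps)
  then show ?thesis by (simp add: sin_add sin_diff)
qed

text \<open>The spherical function at eigenvalue \<open>2 * sqrt q * cos t / (q + 1)\<close> of the simple random walk,
  written as a positive combination of cosines.\<close>

definition sph :: "nat \<Rightarrow> nat \<Rightarrow> real \<Rightarrow> real" where
  "sph q k t = real q powr (- real k / 2) / (1 + 1 / real q) *
     ((1 - 1 / real q) * cos_sum k t + 2 / real q * cos (real k * t))"

text \<open>At \<open>t = 0\<close> all cosines are 1 and \<open>cos_sum k 0 = k + 1\<close>; this
  identity then produces the affine factor of \<open>phi\<close>, and for \<open>k = 0\<close> the
  normalisation \<open>sph q 0 t = 1\<close>.\<close>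

lemma weight_identity:
  assumes "q \<ge> 2"
  shows "(1 - 1 / real q) * (k + 1) + 2 / real q = (1 + 1 / real q) * (1 + (real q - 1) / (real q + 1) * k)"
proof -
  have Q: "real q + 1 \<noteq> 0" "real q \<noteq> 0" using assms by auto
  have a: "1 + 1 / real q = (real q + 1) / real q" using Q by (simp add: field_simps)
  have "(real q + 1) * (1 + (real q - 1) / (real q + 1) * k) = real q + 1 + (real q - 1) * k"
    using Q(1) by (simp add: distrib_left)
  then have "(real q + 1) / real q * (1 + (real q - 1) / (real q + 1) * k) = (real q + 1 + (real q - 1) * k) / real q"
    by (simp only: times_divide_eq_left)
  then show ?thesis unfolding a using Q(2) by (simp add: field_simps)
qed

lemma sph_0 [simp]: assumes "q \<ge> 2" shows "sph q 0 t = 1"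
proof -
  have "1 + 1 / real q > 0" by (simp add: add_pos_nonneg)
  then show ?thesis using weight_identity[OF assms, of 0] assms by (simp add: sph_def cos_sum_def)
qed

lemma sph_at_0: assumes "q \<ge> 2" shows "sph q k 0 = phi q k"
proof -
  have "1 + 1 / real q > 0" by (simp add: add_pos_nonneg)
  moreover have "cos_sum k 0 = real k + 1" by (simp add: cos_sum_def)
  ultimately show ?thesis
    using weight_identity[OF assms, of "real k"] by (simp add: sph_def phi_def)
qed

lemma powr_half_Suc:
  assumes "q \<ge> 2"
  shows "sqrt (real q) * real q powr (- real (Suc k) / 2) = real q powr (- real k / 2)"
proof -
  have "sqrt (real q) * real q powr (- real (Suc k) / 2) = real q powr (1 / 2 + (- real (Suc k) / 2))"
    using assms by (simp add: powr_add powr_half_sqrt)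
  also have "1 / 2 + (- real (Suc k) / 2) = - real k / 2" by (simp add: field_simps)
  finally show ?thesis .
qed

lemma sph_1: assumes "q \<ge> 2" shows "(real q + 1) * sph q 1 t = 2 * sqrt (real q) * cos t"
proof -
  have p: "real q powr (- real 1 / 2) = 1 / sqrt (real q)"
    using powr_half_Suc[OF assms, of 0] assms by (simp add: field_simps)
  have "cos_sum 1 t = 2 * cos t" by (simp add: cos_sum_def)
  then have "(1 - 1 / real q) * cos_sum 1 t + 2 / real q * cos (real 1 * t) = 2 * cos t"
    by (simp add: algebra_simps)
  then have "(real q + 1) * sph q 1 t = (real q + 1) * (1 / sqrt (real q) / (1 + 1 / real q) * (2 * cos t))"
    unfolding sph_def p by (simp only:)
  also have "\<dots> = (real q + 1) / (1 + 1 / real q) / sqrt (real q) * (2 * cos t)" by simp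
  also have "(real q + 1) / (1 + 1 / real q) = real q"
    using assms by (simp add: divide_simps)
  also have "real q / sqrt (real q) = sqrt (real q)" by (rule real_div_sqrt) simp
  finally show ?thesis by simp
qed

lemma sph_rec:
  assumes "q \<ge> 2"
  shows "2 * sqrt (real q) * cos t * sph q (Suc k) t = real q * sph q (Suc (Suc k)) t + sph q k t"
proof -
  define B where "B k = (1 - 1 / real q) * cos_sum k t + 2 / real q * cos (real k * t)" for k
  have "2 * cos t * cos (real (Suc k) * t) = cos (real (Suc (Suc k)) * t) + cos (real k * t)"
  proof -
    have "cos (real (Suc (Suc k)) * t) = cos (real (Suc k) * t + t)" "cos (real k * t) = cos (real (Suc k) * t - t)"
      by (simp_all add: algebra_simps)
    then show ?thesis by (simp add: cos_add cos_diff)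
  qed
  moreover have "2 * cos t * B (Suc k) = (1 - 1 / real q) * (2 * cos t * cos_sum (Suc k) t) +
      2 / real q * (2 * cos t * cos (real (Suc k) * t))"
    by (simp add: B_def algebra_simps)
  ultimately have B: "2 * cos t * B (Suc k) = B (Suc (Suc k)) + B k"
    unfolding cos_sum_rec by (simp add: B_def algebra_simps)
  define P where "P k = real q powr (- real k / 2)" for k
  have P1: "sqrt (real q) * P (Suc k) = P k" for k
    unfolding P_def by (rule powr_half_Suc[OF assms])
  have P2: "real q * P (Suc (Suc k)) = P k"
    using P1[of "Suc k"] P1[of k] by (metis mult.assoc of_nat_0_le_iff real_sqrt_mult_self abs_of_nonneg)
  have s: "sph q k t = P k / (1 + 1 / real q) * B k" for k
    by (simp add: sph_def P_def B_def)
  have "2 * sqrt (real q) * cos t * sph q (Suc k) t =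
     (sqrt (real q) * P (Suc k)) / (1 + 1 / real q) * (2 * cos t * B (Suc k))"
    unfolding s by simp
  also have "\<dots> = P k / (1 + 1 / real q) * B (Suc (Suc k)) + P k / (1 + 1 / real q) * B k"
    unfolding P1 B by (simp only: distrib_left)
  also have "P k / (1 + 1 / real q) * B (Suc (Suc k)) = real q * sph q (Suc (Suc k)) t"
    unfolding s P2[symmetric] by simp
  finally show ?thesis unfolding s .
qed

text \<open>A factor \<open>sin t\<close> reduces the spherical function to two sines, opening the
  way to orthogonality of sines. The difference \<open>real k - 1\<close> is real on purpose: for
  \<open>k = 0\<close> the second sine is \<open>sin (- t)\<close>.\<close>

lemma sin_sph:
  assumes "q \<ge> 2"
  shows "sin t * sph q k t = real q powr (- real k / 2) / (1 + 1 / real q) *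
     (sin (real (Suc k) * t) - sin ((real k - 1) * t) / real q)"
proof -
  have *: "sin t * ((1 - 1 / real q) * cos_sum k t + 2 / real q * cos (real k * t)) =
     sin (real (Suc k) * t) - sin ((real k - 1) * t) / real q"
  proof -
    have "sin t * ((1 - 1 / real q) * cos_sum k t + 2 / real q * cos (real k * t)) =
      (1 - 1 / real q) * (sin t * cos_sum k t) + (2 * cos (real k * t) * sin t) / real q"
      by (simp add: algebra_simps)
    also have "\<dots> = sin (real (Suc k) * t) - sin ((real k - 1) * t) / real q"
      unfolding sin_cos_sum sin_mult_diff[symmetric]
      by (simp only: left_diff_distrib diff_divide_distrib) simp
    finally show ?thesis .
  qed
  show ?thesis unfolding sph_def *[symmetric] by (rule mult.left_commute)
qed

lemma sphere_eval_sph: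
  assumes "q \<ge> 2"
  shows "sphere_eval (real q) (2 * sqrt (real q) * cos t) d = sphere_size q d * sph q d t"
proof (induction d rule: less_induct)
  case (less d)
  consider "d = 0" | "d = 1" | "d = 2" | m where "d = Suc (Suc (Suc m))"
    by (metis One_nat_def Suc_1 old.nat.exhaust)
  then show ?case
  proof cases
    case 1
    then show ?thesis using assms by (simp add: sphere_size_def)
  next
    case 2
    then show ?thesis using sph_1[OF assms, of t] by (simp add: sphere_size_def)
  next
    case 3
    have "sphere_eval (real q) (2 * sqrt (real q) * cos t) 2 =
        2 * sqrt (real q) * cos t * (2 * sqrt (real q) * cos t) - (real q + 1)"
      by (simp add: numeral_2_eq_2)
    also have "\<dots> = (real q + 1) * (2 * sqrt (real q) * cos t * sph q 1 t - 1)"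
      unfolding sph_1[OF assms, symmetric] by (simp add: algebra_simps)
    also have "2 * sqrt (real q) * cos t * sph q 1 t = real q * sph q 2 t + 1"
      using sph_rec[OF assms, of t 0] assms by (simp add: numeral_2_eq_2)
    finally show ?thesis using 3 by (simp add: sphere_size_def)
  next
    case (4 m)
    have "sphere_eval (real q) (2 * sqrt (real q) * cos t) d =
        2 * sqrt (real q) * cos t * sphere_eval (real q) (2 * sqrt (real q) * cos t) (Suc (Suc m)) -
        real q * sphere_eval (real q) (2 * sqrt (real q) * cos t) (Suc m)"
      unfolding 4 by (subst sphere_eval.simps(3)) simp
    also have "\<dots> = 2 * sqrt (real q) * cos t * (sphere_size q (Suc (Suc m)) * sph q (Suc (Suc m)) t) -
        real q * (sphere_size q (Suc m) * sph q (Suc m) t)"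
      using less[of "Suc m"] less[of "Suc (Suc m)"] 4 by (simp del: sphere_eval.simps)
    also have "\<dots> = sphere_size q (Suc (Suc m)) *
        (2 * sqrt (real q) * cos t * sph q (Suc (Suc m)) t - sph q (Suc m) t)"
      by (simp add: sphere_size_def algebra_simps)
    also have "\<dots> = sphere_size q (Suc (Suc m)) * (real q * sph q (Suc (Suc (Suc m))) t)"
      unfolding sph_rec[OF assms] by simp
    finally show ?thesis using 4 by (simp add: sphere_size_def)
  qed
qed

text \<open>The product formula for spherical functions. Through it the operator of radius
  \<open>d\<close>, applied to the spherical function about \<open>y\<close>, becomes multiplication
  by \<open>sph q d t\<close>.\<close>

lemma sphere_sum_sph:
  assumes q: "q \<ge> 2" and x: "x \<in> tree_vertices q" and y: "y \<in> tree_vertices q"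
  shows "(\<Sum>z\<in>sphere_at q x d. sph q (wdist z y) t) = sphere_size q d * sph q d t * sph q (wdist x y) t"
proof -
  have "(\<Sum>z\<in>nbrs q w. sph q (wdist z y) t) = 2 * sqrt (real q) * cos t * sph q (wdist w y) t"
    if w: "w \<in> tree_vertices q" for w
  proof (cases "w = y")
    case True
    then show ?thesis using nbrs_sum_radial[OF w y, of "\<lambda>k. sph q k t"] sph_1[OF q, of t] q by simp
  next
    case False
    then obtain k where "wdist w y = Suc k" by (metis wdist_eq_0_iff not0_implies_Suc)
    then show ?thesis
      using nbrs_sum_radial[OF w y, of "\<lambda>k. sph q k t"] sph_rec[OF q, of t k] False by simp
  qed
  from sphere_sum_eigen[of q "\<lambda>z. sph q (wdist z y) t", OF this x, of d] show ?thesis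
    by (simp add: sphere_eval_sph[OF q])
qed

section \<open>Cosine inequalities and bounds for spherical functions\<close>

lemma one_minus_cos_mult_nat:
  fixes t :: real and m :: nat
  defines "v \<equiv> 1 - cos t" and "e \<equiv> (\<lambda>m::nat. real m ^ 2 * (1 - cos t) - (1 - cos (real m * t)))"
  shows "0 \<le> e m \<and> e m \<le> 2 * real m ^ 4 * v\<^sup>2 \<and> 0 \<le> e (Suc m) - e m \<and> e (Suc m) - e m \<le> 2 * real m ^ 3 * v\<^sup>2"
proof (induction m)
  case 0
  then show ?case by (simp add: e_def)
next
  case (Suc m)
  have v: "v \<ge> 0" by (simp add: v_def)
  \<comment> \<open>The second difference of the error \<open>e\<close> is nonnegative, and by the
    bound already known for \<open>m + 1\<close> it is at most \<open>2 * (m + 1)^2 * v^2\<close>.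
    Summing it once gives the cubic bound for the first difference, summing again the quartic bound
    for \<open>e\<close>; hence the induction carries both.\<close>
  have rec: "e (Suc (Suc m)) - e (Suc m) = e (Suc m) - e m + 2 * v * (1 - cos (real (Suc m) * t))"
  proof -
    have "cos (real (Suc (Suc m)) * t) + cos (real m * t) = 2 * cos t * cos (real (Suc m) * t)"
    proof -
      have "cos (real (Suc (Suc m)) * t) = cos (real (Suc m) * t + t)" "cos (real m * t) = cos (real (Suc m) * t - t)"
        by (simp_all add: algebra_simps)
      then show ?thesis by (simp add: cos_add cos_diff)
    qed
    moreover have "e (Suc (Suc m)) - 2 * e (Suc m) + e m =
      2 * v + (cos (real (Suc (Suc m)) * t) + cos (real m * t)) - 2 * cos (real (Suc m) * t)"
    proof -
      define c where "c n = cos (real n * t)" for n :: nat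
      show ?thesis unfolding e_def v_def c_def[symmetric]
        by (simp add: power2_eq_square algebra_simps)
    qed
    ultimately have "e (Suc (Suc m)) - 2 * e (Suc m) + e m =
        2 * v + 2 * cos t * cos (real (Suc m) * t) - 2 * cos (real (Suc m) * t)" by (simp only:)
    also have "\<dots> = 2 * v * (1 - cos (real (Suc m) * t))"
      unfolding v_def by (simp only: algebra_simps)
    finally show ?thesis by linarith
  qed
  have e1: "0 \<le> e (Suc m)" using Suc by linarith
  then have "1 - cos (real (Suc m) * t) \<le> real (Suc m) ^ 2 * v" by (simp add: e_def v_def)
  then have "2 * v * (1 - cos (real (Suc m) * t)) \<le> 2 * v * (real (Suc m) ^ 2 * v)"
    using v by (intro mult_left_mono) auto
  then have "2 * v * (1 - cos (real (Suc m) * t)) \<le> 2 * real (Suc m) ^ 2 * v\<^sup>2"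
    by (simp add: power2_eq_square algebra_simps)
  moreover have "2 * real m ^ 3 * v\<^sup>2 + 2 * real (Suc m) ^ 2 * v\<^sup>2 \<le> 2 * real (Suc m) ^ 3 * v\<^sup>2"
  proof -
    have "real m ^ 3 + real (Suc m) ^ 2 \<le> real (Suc m) ^ 3"
      by (simp add: power2_eq_square power3_eq_cube algebra_simps)
    then have "(real m ^ 3 + real (Suc m) ^ 2) * (2 * v\<^sup>2) \<le> real (Suc m) ^ 3 * (2 * v\<^sup>2)"
      by (rule mult_right_mono) simp
    then show ?thesis by (simp only: algebra_simps)
  qed
  moreover have "0 \<le> 2 * v * (1 - cos (real (Suc m) * t))" using v by simp
  moreover have "e (Suc m) \<le> 2 * real (Suc m) ^ 4 * v\<^sup>2"
  proof -
    have "real m ^ 4 + real m ^ 3 \<le> real (Suc m) ^ 4"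
      by (simp add: power4_eq_xxxx power3_eq_cube algebra_simps)
    then have "(real m ^ 4 + real m ^ 3) * (2 * v\<^sup>2) \<le> real (Suc m) ^ 4 * (2 * v\<^sup>2)"
      by (rule mult_right_mono) simp
    moreover have "e (Suc m) \<le> (real m ^ 4 + real m ^ 3) * (2 * v\<^sup>2)"
      using Suc by (simp add: algebra_simps)
    ultimately show ?thesis by (simp only: algebra_simps)
  qed
  ultimately show ?case using rec e1 Suc by linarith
qed

lemma one_minus_cos_mult:
  fixes t x :: real
  assumes "\<bar>x\<bar> = real m" "m \<le> k"
  shows "1 - cos (x * t) \<le> x\<^sup>2 * (1 - cos t)"
    and "x\<^sup>2 * (1 - cos t) - (1 - cos (x * t)) \<le> 2 * real k ^ 4 * (1 - cos t)\<^sup>2"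
proof -
  have "x = real m \<or> x = - real m" using assms by linarith
  then have *: "cos (x * t) = cos (real m * t)" "x\<^sup>2 = (real m)\<^sup>2" by auto
  show "1 - cos (x * t) \<le> x\<^sup>2 * (1 - cos t)"
    unfolding * using one_minus_cos_mult_nat[where m = m and t = t] by simp
  have "2 * real m ^ 4 * (1 - cos t)\<^sup>2 \<le> 2 * real k ^ 4 * (1 - cos t)\<^sup>2"
    using assms(2) by (intro mult_right_mono mult_left_mono power_mono) auto
  then show "x\<^sup>2 * (1 - cos t) - (1 - cos (x * t)) \<le> 2 * real k ^ 4 * (1 - cos t)\<^sup>2"
    unfolding * using one_minus_cos_mult_nat[where m = m and t = t] by linarith
qed

text \<open>Minus the second derivative of \<open>sph q k\<close> at 0: the weights are those of
  \<open>sph\<close>, with each \<open>cos (x * t)\<close> replaced by \<open>x^2\<close>.\<close>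

definition sph_curv :: "nat \<Rightarrow> nat \<Rightarrow> real" where
  "sph_curv q k = real q powr (- real k / 2) / (1 + 1 / real q) *
     ((1 - 1 / real q) * (\<Sum>j\<le>k. (real k - 2 * real j)\<^sup>2) + 2 / real q * (real k)\<^sup>2)"

lemma sph_combination:
  assumes "q \<ge> 2"
  shows "\<alpha> * phi q k + \<beta> * sph q k t + \<gamma> * sph_curv q k = real q powr (- real k / 2) / (1 + 1 / real q) *
     ((1 - 1 / real q) * (\<Sum>j\<le>k. \<alpha> + \<beta> * cos ((real k - 2 * real j) * t) + \<gamma> * (real k - 2 * real j)\<^sup>2)
       + 2 / real q * (\<alpha> + \<beta> * cos (real k * t) + \<gamma> * (real k)\<^sup>2))"
proof -
  define A where "A = real q powr (- real k / 2) / (1 + 1 / real q)"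
  define u where "u = 1 - 1 / real q"
  define w where "w = 2 / real q"
  define S where "S = (\<Sum>j\<le>k. (real k - 2 * real j)\<^sup>2)"
  have "(\<Sum>j\<le>k. \<alpha> + \<beta> * cos ((real k - 2 * real j) * t) + \<gamma> * (real k - 2 * real j)\<^sup>2) =
      \<alpha> * cos_sum k 0 + \<beta> * cos_sum k t + \<gamma> * S"
    unfolding sum.distrib sum_distrib_left[symmetric] S_def cos_sum_def by simp
  then show ?thesis
    unfolding sph_at_0[OF assms, symmetric] sph_def sph_curv_def
    unfolding A_def[symmetric] u_def[symmetric] w_def[symmetric] S_def[symmetric]
    by (simp add: distrib_left distrib_right mult.assoc mult.left_commute)
qed

text \<open>\<open>phi\<close>, \<open>sph\<close> and \<open>sph_curv\<close> are the same
  nonnegative combination of 1, \<open>cos (x * t)\<close> and \<open>x^2\<close> over integer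
  frequencies \<open>x\<close>, so a linear inequality between them only has to be checked for each
  frequency. The second claim keeps a single frequency and drops the other terms, which yields
  strictly positive lower bounds.\<close>

lemma sph_combination_nonneg:
  assumes q: "q \<ge> 2"
    and nn: "\<And>x m. \<bar>x\<bar> = real m \<Longrightarrow> m \<le> k \<Longrightarrow> 0 \<le> \<alpha> + \<beta> * cos (x * t) + \<gamma> * x\<^sup>2"
  shows "0 \<le> \<alpha> * phi q k + \<beta> * sph q k t + \<gamma> * sph_curv q k"
    and "j \<le> k \<Longrightarrow> real q powr (- real k / 2) / (1 + 1 / real q) * ((1 - 1 / real q) *
      (\<alpha> + \<beta> * cos ((real k - 2 * real j) * t) + \<gamma> * (real k - 2 * real j)\<^sup>2)) \<le>
      \<alpha> * phi q k + \<beta> * sph q k t + \<gamma> * sph_curv q k"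
proof -
  have t: "0 \<le> \<alpha> + \<beta> * cos ((real k - 2 * real j) * t) + \<gamma> * (real k - 2 * real j)\<^sup>2" if "j \<le> k" for j
  proof (rule nn)
    show "\<bar>real k - 2 * real j\<bar> = real (nat \<bar>int k - 2 * int j\<bar>)" by linarith
    show "nat \<bar>int k - 2 * int j\<bar> \<le> k" using that by linarith
  qed
  have k: "0 \<le> \<alpha> + \<beta> * cos (real k * t) + \<gamma> * (real k)\<^sup>2" by (rule nn[of _ k]) auto
  have c: "0 \<le> 1 - 1 / real q" "0 \<le> real q powr (- real k / 2) / (1 + 1 / real q)" "0 \<le> 2 / real q"
    using q by (auto simp: field_simps)
  show "0 \<le> \<alpha> * phi q k + \<beta> * sph q k t + \<gamma> * sph_curv q k"
    unfolding sph_combination[OF q]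
  proof (rule mult_nonneg_nonneg[OF c(2) add_nonneg_nonneg[OF mult_nonneg_nonneg[OF c(1) sum_nonneg]
        mult_nonneg_nonneg[OF c(3) k]]])
    fix i assume "i \<in> {..k}"
    then show "0 \<le> \<alpha> + \<beta> * cos ((real k - 2 * real i) * t) + \<gamma> * (real k - 2 * real i)\<^sup>2" using t by simp
  qed
  assume "j \<le> k"
  then have "\<alpha> + \<beta> * cos ((real k - 2 * real j) * t) + \<gamma> * (real k - 2 * real j)\<^sup>2 \<le>
     (\<Sum>j\<le>k. \<alpha> + \<beta> * cos ((real k - 2 * real j) * t) + \<gamma> * (real k - 2 * real j)\<^sup>2)"
    using t by (intro member_le_sum) auto
  then have "(1 - 1 / real q) * (\<alpha> + \<beta> * cos ((real k - 2 * real j) * t) + \<gamma> * (real k - 2 * real j)\<^sup>2) \<le>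
     (1 - 1 / real q) * (\<Sum>j\<le>k. \<alpha> + \<beta> * cos ((real k - 2 * real j) * t) + \<gamma> * (real k - 2 * real j)\<^sup>2)"
    by (rule mult_left_mono) (rule c)
  moreover have "0 \<le> 2 / real q * (\<alpha> + \<beta> * cos (real k * t) + \<gamma> * (real k)\<^sup>2)"
    using k c by (intro mult_nonneg_nonneg)
  ultimately show "real q powr (- real k / 2) / (1 + 1 / real q) * ((1 - 1 / real q) *
      (\<alpha> + \<beta> * cos ((real k - 2 * real j) * t) + \<gamma> * (real k - 2 * real j)\<^sup>2)) \<le>
      \<alpha> * phi q k + \<beta> * sph q k t + \<gamma> * sph_curv q k"
    unfolding sph_combination[OF q] using c by (intro mult_left_mono) auto
qed

lemma abs_sph_le_phi: assumes "q \<ge> 2" shows "\<bar>sph q k t\<bar> \<le> phi q k"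
  using sph_combination_nonneg(1)[OF assms, where \<alpha> = 1 and \<beta> = 1 and \<gamma> = 0 and k = k and t = t]
    sph_combination_nonneg(1)[OF assms, where \<alpha> = 1 and \<beta> = "- 1" and \<gamma> = 0 and k = k and t = t]
    cos_ge_minus_one cos_le_one
  by (simp add: abs_le_iff) (smt (verit) cos_ge_minus_one)

lemma phi_pos: "q \<ge> 2 \<Longrightarrow> phi q k > 0"
  by (simp add: phi_def add_pos_nonneg)

text \<open>Both claims are the inequalities of \<open>one_minus_cos_mult\<close> summed over
  frequencies. Together they expand \<open>phi q k - sph q k t\<close> to first order in
  \<open>1 - cos t\<close>, with an error whose dependence on \<open>k\<close> is explicit.\<close>

lemma sph_second_order:
  assumes "q \<ge> 2"
  shows "0 \<le> sph_curv q k * (1 - cos t) - (phi q k - sph q k t)"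
    and "sph_curv q k * (1 - cos t) - (phi q k - sph q k t) \<le> 2 * real k ^ 4 * phi q k * (1 - cos t)\<^sup>2"
proof -
  have "0 \<le> (- 1) * phi q k + 1 * sph q k t + (1 - cos t) * sph_curv q k"
  proof (rule sph_combination_nonneg(1)[OF assms])
    fix x m assume "\<bar>x\<bar> = real m" "m \<le> k"
    from one_minus_cos_mult(1)[OF this, of t]
    show "0 \<le> - 1 + 1 * cos (x * t) + (1 - cos t) * x\<^sup>2" by (simp add: algebra_simps)
  qed
  then show "0 \<le> sph_curv q k * (1 - cos t) - (phi q k - sph q k t)" by (simp add: algebra_simps)
  have "0 \<le> (1 + 2 * real k ^ 4 * (1 - cos t)\<^sup>2) * phi q k + (- 1) * sph q k t + (- (1 - cos t)) * sph_curv q k"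
  proof (rule sph_combination_nonneg(1)[OF assms])
    fix x m assume "\<bar>x\<bar> = real m" "m \<le> k"
    from one_minus_cos_mult(2)[OF this, of t]
    show "0 \<le> (1 + 2 * real k ^ 4 * (1 - cos t)\<^sup>2) + - 1 * cos (x * t) + - (1 - cos t) * x\<^sup>2"
      by (simp add: algebra_simps)
  qed
  then show "sph_curv q k * (1 - cos t) - (phi q k - sph q k t) \<le> 2 * real k ^ 4 * phi q k * (1 - cos t)\<^sup>2"
    by (simp add: algebra_simps)
qed

lemma sph_curv_bounds: assumes "q \<ge> 2" shows "0 \<le> sph_curv q k" "sph_curv q k \<le> (real k)\<^sup>2 * phi q k"
proof -
  show "0 \<le> sph_curv q k"
    using sph_combination_nonneg(1)[OF assms, where \<alpha> = 0 and \<beta> = 0 and \<gamma> = 1 and k = k and t = 0] by simp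
  have "0 \<le> (real k)\<^sup>2 * phi q k + 0 * sph q k 0 + (- 1) * sph_curv q k"
  proof (rule sph_combination_nonneg(1)[OF assms])
    fix x m assume "\<bar>x\<bar> = real m" "m \<le> k"
    then have "\<bar>x\<bar> \<le> \<bar>real k\<bar>" by simp
    then have "x\<^sup>2 \<le> (real k)\<^sup>2" by (simp only: abs_le_square_iff)
    then show "0 \<le> (real k)\<^sup>2 + 0 * cos (x * 0) + - 1 * x\<^sup>2" by simp
  qed
  then show "sph_curv q k \<le> (real k)\<^sup>2 * phi q k" by simp
qed

text \<open>For odd \<open>k\<close> the frequency 1 occurs in \<open>cos_sum k\<close>; keeping
  only that one leaves \<open>1 - cos t\<close>.\<close>

lemma phi_minus_sph_odd:
  assumes "q \<ge> 2" "odd k"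
  shows "real q powr (- real k / 2) / (1 + 1 / real q) * (1 - 1 / real q) * (1 - cos t) \<le> phi q k - sph q k t"
proof -
  obtain j where j: "k = 2 * j + 1" using \<open>odd k\<close> by (elim oddE)
  have "real q powr (- real k / 2) / (1 + 1 / real q) * ((1 - 1 / real q) *
      (1 + (- 1) * cos ((real k - 2 * real j) * t) + 0 * (real k - 2 * real j)\<^sup>2)) \<le>
      1 * phi q k + (- 1) * sph q k t + 0 * sph_curv q k"
    by (rule sph_combination_nonneg(2)[OF assms(1)]) (auto simp: j)
  then show ?thesis by (simp add: j algebra_simps)
qed

text \<open>For even \<open>k\<close> the frequency 0 occurs, and its term
  \<open>1 + cos 0 = 2\<close> does not depend on \<open>t\<close>.\<close>

lemma phi_plus_sph_even:
  assumes "q \<ge> 2" "even k"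
  shows "real q powr (- real k / 2) / (1 + 1 / real q) * (1 - 1 / real q) * 2 \<le> phi q k + sph q k t"
proof -
  obtain j where j: "k = 2 * j" using \<open>even k\<close> by (elim evenE)
  have "real q powr (- real k / 2) / (1 + 1 / real q) * ((1 - 1 / real q) *
      (1 + 1 * cos ((real k - 2 * real j) * t) + 0 * (real k - 2 * real j)\<^sup>2)) \<le>
      1 * phi q k + 1 * sph q k t + 0 * sph_curv q k"
    by (rule sph_combination_nonneg(2)[OF assms(1)]) (auto simp: j, smt (verit) cos_ge_minus_one)
  then show ?thesis by (simp add: j algebra_simps)
qed

section \<open>Trigonometric integrals\<close>

definition arc_measure :: "real measure" where
  "arc_measure = restrict_space lborel {0<..<pi}"

lemma space_arc [simp]: "space arc_measure = {0<..<pi}"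
  by (simp add: arc_measure_def space_restrict_space)

lemma borel_measurable_arc: "f \<in> borel_measurable borel \<Longrightarrow> f \<in> borel_measurable arc_measure"
  unfolding arc_measure_def by (intro measurable_restrict_space1) simp

lemma continuous_imp_measurable_arc:
  fixes f :: "real \<Rightarrow> real"
  shows "continuous_on UNIV f \<Longrightarrow> f \<in> borel_measurable arc_measure"
  by (intro borel_measurable_arc borel_measurable_continuous_onI)

lemma finite_measure_arc: "finite_measure arc_measure"
  by (rule finite_measureI) (simp add: arc_measure_def emeasure_restrict_space)

lemma integrable_arc_bounded:
  fixes f :: "real \<Rightarrow> real"
  assumes "f \<in> borel_measurable arc_measure" "\<And>t. 0 < t \<Longrightarrow> t < pi \<Longrightarrow> \<bar>f t\<bar> \<le> B"
  shows "integrable arc_measure f"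
  using assms by (intro finite_measure.integrable_const_bound[OF finite_measure_arc, of _ B] AE_I2) auto

lemma integral_arc_FTC:
  fixes f :: "real \<Rightarrow> real"
  assumes F: "\<And>x. (F has_real_derivative f x) (at x)" and f: "continuous_on UNIV f"
  shows "(\<integral>t. f t \<partial>arc_measure) = F pi - F 0"
proof -
  have "(\<integral>t. f t \<partial>arc_measure) = (\<integral>t. indicator {0<..<pi} t *\<^sub>R f t \<partial>lborel)"
    unfolding arc_measure_def by (rule integral_restrict_space) simp
  also have "\<dots> = (\<integral>t. f t * indicator {0..pi} t \<partial>lborel)"
  proof (rule integral_cong_AE)
    show "AE t in lborel. indicator {0<..<pi} t *\<^sub>R f t = f t * indicator {0..pi} t"
      using AE_lborel_singleton[of 0] AE_lborel_singleton[of pi]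
      by eventually_elim (auto simp: indicator_def)
  qed (use borel_measurable_continuous_onI[OF f] in auto)
  also have "\<dots> = F pi - F 0"
    by (rule integral_FTC_Icc_real) (use F f in \<open>auto simp: continuous_on_eq_continuous_at\<close>)
  finally show ?thesis .
qed

lemma integral_cos_arc: "(\<integral>t. cos (real_of_int m * t) \<partial>arc_measure) = (if m = 0 then pi else 0)"
proof (cases "m = 0")
  case True
  then show ?thesis
    using integral_arc_FTC[of "\<lambda>t. t" "\<lambda>_. 1"] by (simp add: DERIV_ident)
next
  case False
  have "(\<integral>t. cos (real_of_int m * t) \<partial>arc_measure) = sin (real_of_int m * pi) / real_of_int m - sin (real_of_int m * 0) / real_of_int m"
    by (rule integral_arc_FTC) (use False in \<open>auto intro!: derivative_eq_intros continuous_intros\<close>)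
  then show ?thesis using False sin_npi_int[of m] by (simp add: mult.commute)
qed

lemma integrable_cos_arc: "integrable arc_measure (\<lambda>t. cos (c * t))"
  by (rule integrable_arc_bounded[of _ 1]) (auto intro!: continuous_imp_measurable_arc continuous_intros)

lemma integral_sin_sin_arc:
  "(\<integral>t. sin (real (Suc j) * t) * sin (real (Suc k) * t) \<partial>arc_measure) = (if j = k then pi / 2 else 0)"
proof -
  have "sin (real (Suc j) * t) * sin (real (Suc k) * t) =
      (1 / 2) * cos (real_of_int (int j - int k) * t) - (1 / 2) * cos (real_of_int (int j + int k + 2) * t)" for t
  proof -
    have "real_of_int (int j - int k) * t = real (Suc j) * t - real (Suc k) * t"
      "real_of_int (int j + int k + 2) * t = real (Suc j) * t + real (Suc k) * t"
      by (simp_all add: algebra_simps)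
    then show ?thesis unfolding sin_times_sin by (simp add: diff_divide_distrib)
  qed
  then have "(\<integral>t. sin (real (Suc j) * t) * sin (real (Suc k) * t) \<partial>arc_measure) =
      (1 / 2) * (\<integral>t. cos (real_of_int (int j - int k) * t) \<partial>arc_measure) -
      (1 / 2) * (\<integral>t. cos (real_of_int (int j + int k + 2) * t) \<partial>arc_measure)"
    by (simp only: Bochner_Integration.integral_diff[OF integrable_mult_right[OF integrable_cos_arc] integrable_mult_right[OF integrable_cos_arc]]
        integral_mult_right_zero)
  then show ?thesis unfolding integral_cos_arc by auto
qed

text \<open>Bessel's inequality for the orthogonal system \<open>sin (k t)\<close> makes the coefficients square
  summable.\<close>

lemma Riemann_Lebesgue_arc:
  fixes f :: "real \<Rightarrow> real"
  assumes [measurable]: "f \<in> borel_measurable arc_measure" and B: "\<And>t. 0 < t \<Longrightarrow> t < pi \<Longrightarrow> \<bar>f t\<bar> \<le> B"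
  shows "(\<lambda>k. \<integral>t. f t * sin (real (Suc k) * t) \<partial>arc_measure) \<longlonglongrightarrow> 0"
proof -
  define c where "c k = (\<integral>t. f t * sin (real (Suc k) * t) \<partial>arc_measure)" for k
  have [measurable]: "(\<lambda>t. sin (real k * t)) \<in> borel_measurable arc_measure" for k
    by (intro continuous_imp_measurable_arc continuous_intros)
  have B0: "B \<ge> 0" using B[of "pi / 2"] pi_gt_zero by linarith
  have i1: "integrable arc_measure (\<lambda>t. f t * sin (real (Suc k) * t))" for k
  proof (rule integrable_arc_bounded[of _ "B * 1"])
    fix t :: real assume "0 < t" "t < pi"
    then show "\<bar>f t * sin (real (Suc k) * t)\<bar> \<le> B * 1"
      unfolding abs_mult by (intro mult_mono B B0) auto
  qed measurable
  have i2: "integrable arc_measure (\<lambda>t. sin (real (Suc j) * t) * sin (real (Suc k) * t))" for j k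
  proof (rule integrable_arc_bounded[of _ "1 * 1"])
    fix t :: real assume "0 < t" "t < pi"
    show "\<bar>sin (real (Suc j) * t) * sin (real (Suc k) * t)\<bar> \<le> 1 * 1"
      unfolding abs_mult by (intro mult_mono) auto
  qed measurable
  have i3: "integrable arc_measure (\<lambda>t. f t * f t)"
  proof (rule integrable_arc_bounded[of _ "B * B"])
    fix t :: real assume "0 < t" "t < pi"
    then show "\<bar>f t * f t\<bar> \<le> B * B" unfolding abs_mult by (intro mult_mono B B0) auto
  qed measurable
  have bessel: "(\<Sum>k<N. (c k)\<^sup>2) \<le> pi / 2 * (\<integral>t. f t * f t \<partial>arc_measure)" for N
  proof -
    define S where "S t = (\<Sum>k<N. c k * sin (real (Suc k) * t))" for t
    have fS: "f t * S t = (\<Sum>k<N. c k * (f t * sin (real (Suc k) * t)))" for t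
      by (simp add: S_def sum_distrib_left algebra_simps)
    have SS: "S t * S t = (\<Sum>j<N. \<Sum>k<N. c j * c k * (sin (real (Suc j) * t) * sin (real (Suc k) * t)))" for t
      unfolding S_def sum_product by (simp add: algebra_simps)
    \<comment> \<open>Each \<open>sin ((k + 1) t)\<close> has squared norm \<open>pi / 2\<close>, so
      \<open>2 / pi * S\<close> is the orthogonal projection of \<open>f\<close>; expanding its
      distance to \<open>f\<close> gives the inequality.\<close>
    have "0 \<le> (\<integral>t. (f t - 2 / pi * S t)\<^sup>2 \<partial>arc_measure)" by (rule Bochner_Integration.integral_nonneg) simp
    also have "(\<lambda>t. (f t - 2 / pi * S t)\<^sup>2) =
        (\<lambda>t. f t * f t - 4 / pi * (f t * S t) + 4 / pi\<^sup>2 * (S t * S t))"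
      by (simp add: fun_eq_iff power2_eq_square algebra_simps)
    also have "(\<integral>t. f t * f t - 4 / pi * (f t * S t) + 4 / pi\<^sup>2 * (S t * S t) \<partial>arc_measure) =
        (\<integral>t. f t * f t \<partial>arc_measure) - 4 / pi * (\<Sum>k<N. c k * c k)
          + 4 / pi\<^sup>2 * (\<Sum>j<N. \<Sum>k<N. c j * c k * (if j = k then pi / 2 else 0))"
      unfolding fS SS using i1 i2 i3
      by (simp add: integral_sin_sin_arc c_def[symmetric] del: of_nat_Suc)
    also have "(\<Sum>j<N. \<Sum>k<N. c j * c k * (if j = k then pi / 2 else 0)) = pi / 2 * (\<Sum>k<N. c k * c k)"
      by (simp add: if_distrib[of "\<lambda>x. _ * x"] sum.delta sum_distrib_left algebra_simps cong: if_cong)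
    finally have "0 \<le> (\<integral>t. f t * f t \<partial>arc_measure) - 2 / pi * (\<Sum>k<N. c k * c k)"
      by (simp add: power2_eq_square field_simps)
    then show ?thesis by (simp add: power2_eq_square field_simps)
  qed
  have "summable (\<lambda>k. (c k)\<^sup>2)"
    by (rule summableI_nonneg_bounded[OF _ bessel]) simp
  then have "(\<lambda>k. (c k)\<^sup>2) \<longlonglongrightarrow> 0" by (rule summable_LIMSEQ_zero)
  then have "(\<lambda>k. sqrt ((c k)\<^sup>2)) \<longlonglongrightarrow> sqrt 0" by (rule tendsto_real_sqrt)
  then have "c \<longlonglongrightarrow> 0" by (simp add: tendsto_rabs_zero_iff)
  then show ?thesis by (simp add: c_def[abs_def])
qed

text \<open>\<open>sin t / (1 - cos t)\<close> is \<open>cot (t / 2)\<close>, formally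
  \<open>2 * (sin t + sin (2 t) + ...)\<close>. Passing from \<open>sin (k t)\<close> to
  \<open>sin ((k + 2) t)\<close> adds \<open>2 cos ((k + 1) t) (1 + cos t)\<close>, a sum of cosines
  that integrates to 0 except for \<open>k = 0\<close>.\<close>

lemma integral_sin_cot_half:
  shows integrable_sin_cot_half: "integrable arc_measure (\<lambda>t. sin (real (Suc k) * t) * (sin t / (1 - cos t)))"
    and "(\<integral>t. sin (real (Suc k) * t) * (sin t / (1 - cos t)) \<partial>arc_measure) = pi"
proof -
  have ne: "1 - cos t \<noteq> 0" if "0 < t" "t < pi" for t
    using cos_monotone_0_pi[of 0 t] that by auto
  have sq: "sin t * (sin t / (1 - cos t)) = 1 + cos t" if "0 < t" "t < pi" for t
  proof -
    have "sin t * sin t = (1 + cos t) * (1 - cos t)"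
      using sin_squared_eq[of t] by (simp add: power2_eq_square algebra_simps)
    then show ?thesis using ne[OF that] by (simp add: divide_eq_eq)
  qed
  have [measurable]: "(\<lambda>t. sin (c * t)) \<in> borel_measurable arc_measure" "sin \<in> borel_measurable arc_measure"
    "cos \<in> borel_measurable arc_measure" for c
    by (intro continuous_imp_measurable_arc continuous_intros)+
  define I where "I k = (\<integral>t. sin (real k * t) * (sin t / (1 - cos t)) \<partial>arc_measure)" for k
  have step: "sin (real (Suc (Suc k)) * t) * (sin t / (1 - cos t)) =
      sin (real k * t) * (sin t / (1 - cos t)) + (2 * cos (real_of_int (int k + 1) * t) +
        cos (real_of_int (int k) * t) + cos (real_of_int (int k + 2) * t))"
    if "0 < t" "t < pi" for t k
  proof -
    have "sin (real (Suc (Suc k)) * t) = sin ((real k + 1) * t + t)" "sin (real k * t) = sin ((real k + 1) * t - t)"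
      by (simp_all add: algebra_simps)
    then have "sin (real (Suc (Suc k)) * t) - sin (real k * t) = 2 * cos ((real k + 1) * t) * sin t"
      by (simp only: sin_add sin_diff)
    then have "sin (real (Suc (Suc k)) * t) * (sin t / (1 - cos t)) - sin (real k * t) * (sin t / (1 - cos t)) =
       2 * cos ((real k + 1) * t) * (sin t * (sin t / (1 - cos t)))"
      by (simp only: left_diff_distrib[symmetric] mult.assoc)
    also have "\<dots> = 2 * cos ((real k + 1) * t) + 2 * cos ((real k + 1) * t) * cos t"
      unfolding sq[OF that] by (simp add: algebra_simps)
    also have "2 * cos ((real k + 1) * t) * cos t = cos ((real k + 1) * t - t) + cos ((real k + 1) * t + t)"
      by (simp only: cos_add cos_diff)
    finally show ?thesis by (simp add: algebra_simps)
  qed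
  \<comment> \<open>\<open>cot (t / 2)\<close> itself is not integrable near 0, so integrability of
    the products needs the same recurrence; two consecutive indices are carried because it advances
    by two.\<close>
  have int: "integrable arc_measure (\<lambda>t. sin (real k * t) * (sin t / (1 - cos t))) \<and>
     integrable arc_measure (\<lambda>t. sin (real (Suc k) * t) * (sin t / (1 - cos t)))" for k
  proof (induction k)
    case 0
    have "integrable arc_measure (\<lambda>t. sin t * (sin t / (1 - cos t)))"
    proof (rule integrable_arc_bounded[of _ 2])
      fix t :: real assume "0 < t" "t < pi"
      then show "\<bar>sin t * (sin t / (1 - cos t))\<bar> \<le> 2"
        unfolding sq[OF \<open>0 < t\<close> \<open>t < pi\<close>] using cos_le_one[of t] cos_ge_minus_one[of t] by linarith
    qed measurable
    then show ?case by simp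
  next
    case (Suc k)
    have "integrable arc_measure (\<lambda>t. sin (real k * t) * (sin t / (1 - cos t)) + (2 * cos (real_of_int (int k + 1) * t) +
        cos (real_of_int (int k) * t) + cos (real_of_int (int k + 2) * t)))"
      using Suc by (intro Bochner_Integration.integrable_add integrable_mult_right integrable_cos_arc) auto
    then have "integrable arc_measure (\<lambda>t. sin (real (Suc (Suc k)) * t) * (sin t / (1 - cos t)))"
      by (rule Bochner_Integration.integrable_cong[THEN iffD1, rotated 2]) (simp_all only: step space_arc greaterThanLessThan_iff)
    then show ?case using Suc by blast
  qed
  have rec: "I (Suc (Suc k)) = I k + (if k = 0 then pi else 0)" for k
  proof -
    have "I (Suc (Suc k)) = (\<integral>t. sin (real k * t) * (sin t / (1 - cos t)) + (2 * cos (real_of_int (int k + 1) * t) +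
        cos (real_of_int (int k) * t) + cos (real_of_int (int k + 2) * t)) \<partial>arc_measure)"
      unfolding I_def by (rule Bochner_Integration.integral_cong) (simp_all only: step space_arc greaterThanLessThan_iff)
    also have "\<dots> = I k + (2 * (\<integral>t. cos (real_of_int (int k + 1) * t) \<partial>arc_measure) +
        (\<integral>t. cos (real_of_int (int k) * t) \<partial>arc_measure) + (\<integral>t. cos (real_of_int (int k + 2) * t) \<partial>arc_measure))"
      unfolding I_def using int[of k]
      by (simp only: Bochner_Integration.integral_add Bochner_Integration.integrable_add integrable_mult_right
          integrable_cos_arc integral_mult_right_zero)
    finally show ?thesis unfolding integral_cos_arc by simp
  qed
  have "I (Suc 0) = (\<integral>t. cos (real_of_int 0 * t) + cos (real_of_int 1 * t) \<partial>arc_measure)"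
    unfolding I_def by (rule Bochner_Integration.integral_cong) (simp_all add: sq del: times_divide_eq_right)
  also have "\<dots> = pi"
    by (subst Bochner_Integration.integral_add) (simp_all only: integrable_cos_arc integral_cos_arc, simp)
  finally have I1: "I (Suc 0) = pi" .
  have "I (Suc k) = pi \<and> I (Suc (Suc k)) = pi"
  proof (induction k)
    case 0
    have "I 0 = 0" by (simp add: I_def)
    then show ?case using I1 rec[of 0] by simp
  next
    case (Suc k)
    then show ?case using rec[of "Suc k"] by simp
  qed
  then show "(\<integral>t. sin (real (Suc k) * t) * (sin t / (1 - cos t)) \<partial>arc_measure) = pi" by (simp add: I_def)
  show "integrable arc_measure (\<lambda>t. sin (real (Suc k) * t) * (sin t / (1 - cos t)))" using int[of k] by blast
qed

text \<open>Laplace's method in its crudest form: the powers of \<open>f\<close> concentrate where \<open>f\<close> is close to its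
  bound \<open>R\<close>, which the hypotheses allow to be attained only with positive sign.\<close>

lemma integral_power_concentration:
  fixes f g :: "'a \<Rightarrow> real"
  assumes "finite_measure M"
    and f [measurable]: "f \<in> borel_measurable M" and g [measurable]: "g \<in> borel_measurable M"
    and R: "R > 0" "\<And>x. x \<in> space M \<Longrightarrow> \<bar>f x\<bar> \<le> R"
    and B: "\<And>x. x \<in> space M \<Longrightarrow> \<bar>g x\<bar> \<le> B"
    and mass: "\<And>b. b < R \<Longrightarrow> measure M {x \<in> space M. f x > b} > 0"
    and conc: "\<And>e. e > 0 \<Longrightarrow> \<exists>b<R. \<forall>x\<in>space M. \<bar>f x\<bar> > b \<longrightarrow> f x > 0 \<and> \<bar>g x - g0\<bar> \<le> e"
  shows "(\<lambda>n. (\<integral>x. g x * f x ^ n \<partial>M) / (\<integral>x. f x ^ n \<partial>M)) \<longlonglongrightarrow> g0"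
    and "\<forall>\<^sub>F n in sequentially. (\<integral>x. f x ^ n \<partial>M) > 0"
proof -
  interpret finite_measure M by fact
  have main: "\<forall>\<^sub>F n in sequentially. (\<integral>x. f x ^ n \<partial>M) > 0 \<and>
     \<bar>(\<integral>x. g x * f x ^ n \<partial>M) - g0 * (\<integral>x. f x ^ n \<partial>M)\<bar> \<le> 4 * e * (\<integral>x. f x ^ n \<partial>M)" if e: "e > 0" for e
  proof -
    obtain b0 where b0: "b0 < R" "\<And>x. x \<in> space M \<Longrightarrow> \<bar>f x\<bar> > b0 \<Longrightarrow> f x > 0 \<and> \<bar>g x - g0\<bar> \<le> e"
      using conc[OF e] by blast
    define b where "b = max b0 0"
    have b: "0 \<le> b" "b < R" using b0 R by (auto simp: b_def)
    \<comment> \<open>With \<open>be\<close> strictly between \<open>b\<close> and \<open>R\<close>,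
      the set where \<open>f > be\<close> contributes at least \<open>be ^ n * m\<close>, while
      outside \<open>S\<close> the powers are at most \<open>b ^ n\<close>. The quotient of the two
      decays geometrically.\<close>
    define be where "be = (b + R) / 2"
    have be: "b < be" "be < R" "0 < be" using b R by (auto simp: be_def)
    define m where "m = measure M {x \<in> space M. f x > be}"
    have m: "m > 0" unfolding m_def by (rule mass) (rule be)
    define S where "S = {x \<in> space M. \<bar>f x\<bar> > b}"
    have [measurable]: "S \<in> sets M" unfolding S_def by measurable
    have Spos: "f x > 0" "\<bar>g x - g0\<bar> \<le> e" if "x \<in> S" for x
      using b0(2)[of x] that by (auto simp: S_def b_def)
    define G where "G = \<bar>B\<bar> + \<bar>g0\<bar>"
    have G: "\<bar>g x - g0\<bar> \<le> G" if "x \<in> space M" for x using B[OF that] by (simp add: G_def)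
    have G0: "G \<ge> 0" by (simp add: G_def)
    define A where "A n = (\<integral>x. indicator S x * f x ^ n \<partial>M)" for n
    define D where "D n = b ^ n * measure M (space M)" for n
    have pw: "\<bar>f x ^ n\<bar> \<le> R ^ n" if "x \<in> space M" for x n
      unfolding power_abs by (rule power_mono) (use R(2)[OF that] in auto)
    have intf: "integrable M (\<lambda>x. f x ^ n)" for n
      by (rule integrable_const_bound[of _ "R ^ n"]) (auto simp: pw)
    have intA: "integrable M (\<lambda>x. indicator S x * f x ^ n)" for n
      by (rule integrable_const_bound[of _ "R ^ n"])
        (auto simp: abs_mult indicator_def R(1) less_imp_le intro!: pw AE_I2)
    have intg: "integrable M (\<lambda>x. g x * f x ^ n)" for n
    proof (rule integrable_const_bound[of _ "\<bar>B\<bar> * R ^ n"])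
      have "\<bar>g x * f x ^ n\<bar> \<le> \<bar>B\<bar> * R ^ n" if "x \<in> space M" for x
        unfolding abs_mult using B[OF that] pw[OF that] by (intro mult_mono) auto
      then show "AE x in M. norm (g x * f x ^ n) \<le> \<bar>B\<bar> * R ^ n" by (auto intro!: AE_I2)
    qed measurable
    have out: "\<bar>f x ^ n\<bar> \<le> b ^ n" if "x \<in> space M" "x \<notin> S" for x n
      unfolding power_abs by (rule power_mono) (use that in \<open>auto simp: S_def\<close>)
    have Alow: "be ^ n * m \<le> A n" for n
    proof -
      have "be ^ n * m = (\<integral>x. be ^ n * indicator {x \<in> space M. f x > be} x \<partial>M)"
        by (simp add: m_def)
      also have "\<dots> \<le> A n"
        unfolding A_def
      proof (rule integral_mono)
        show "integrable M (\<lambda>x. be ^ n * indicator {x \<in> space M. be < f x} x)"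
          by (rule integrable_mult_right) (auto simp: emeasure_eq_measure)
        fix x assume x: "x \<in> space M"
        show "be ^ n * indicator {x \<in> space M. be < f x} x \<le> indicator S x * f x ^ n"
        proof (cases "be < f x")
          case True
          then have "x \<in> S" using x be b by (auto simp: S_def)
          then show ?thesis using True be by (auto simp: indicator_def intro!: power_mono)
        next
          case False
          then show ?thesis using Spos(1)[of x] by (auto simp: indicator_def)
        qed
      qed (rule intA)
      finally show ?thesis .
    qed
    have fl: "A n - D n \<le> (\<integral>x. f x ^ n \<partial>M)" for n
    proof -
      have "A n - D n = (\<integral>x. indicator S x * f x ^ n - b ^ n \<partial>M)"
        using intA by (simp add: A_def D_def)
      also have "\<dots> \<le> (\<integral>x. f x ^ n \<partial>M)"
      proof (rule integral_mono[OF _ intf])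
        fix x assume x: "x \<in> space M"
        show "indicator S x * f x ^ n - b ^ n \<le> f x ^ n"
          using out[OF x, of n] b by (cases "x \<in> S") auto
      qed (use intA in simp)
      finally show ?thesis .
    qed
    have up: "\<bar>(\<integral>x. g x * f x ^ n \<partial>M) - g0 * (\<integral>x. f x ^ n \<partial>M)\<bar> \<le> e * A n + G * D n" for n
    proof -
      have "(\<integral>x. g x * f x ^ n \<partial>M) - g0 * (\<integral>x. f x ^ n \<partial>M) = (\<integral>x. g x * f x ^ n - g0 * f x ^ n \<partial>M)"
        using intf intg by simp
      also have "\<bar>\<dots>\<bar> \<le> (\<integral>x. \<bar>g x * f x ^ n - g0 * f x ^ n\<bar> \<partial>M)"
        by (rule integral_abs_bound)
      also have "\<dots> \<le> (\<integral>x. e * (indicator S x * f x ^ n) + G * b ^ n \<partial>M)"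
      proof (rule integral_mono)
        fix x assume x: "x \<in> space M"
        have *: "\<bar>g x * f x ^ n - g0 * f x ^ n\<bar> = \<bar>g x - g0\<bar> * \<bar>f x ^ n\<bar>"
          unfolding abs_mult[symmetric] by (simp add: algebra_simps)
        show "\<bar>g x * f x ^ n - g0 * f x ^ n\<bar> \<le> e * (indicator S x * f x ^ n) + G * b ^ n"
        proof (cases "x \<in> S")
          case True
          then have "\<bar>g x - g0\<bar> * \<bar>f x ^ n\<bar> \<le> e * f x ^ n"
            using Spos[OF True] by (intro mult_mono) auto
          then show ?thesis unfolding * using True G0 b
            by (simp add: add_increasing2)
        next
          case False
          have "\<bar>g x - g0\<bar> * \<bar>f x ^ n\<bar> \<le> G * b ^ n"
            by (intro mult_mono G[OF x] out[OF x False] G0) auto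
          then show ?thesis unfolding * using False by simp
        qed
      qed (use intf intg intA in simp_all)
      also have "\<dots> = e * A n + G * D n" using intA by (simp add: A_def D_def)
      finally show ?thesis .
    qed
    \<comment> \<open>Two thresholds are imposed on this null sequence: \<open>1 / 2\<close> gives
      that \<open>A n\<close> is at most twice the full integral, and \<open>e / (G + 1)\<close>
      gives \<open>G * D n \<le> e * A n\<close>. Together they account for the factor 4 in
      \<open>main\<close>.\<close>
    have "(\<lambda>n. (b / be) ^ n * (measure M (space M) / m)) \<longlonglongrightarrow> 0 * (measure M (space M) / m)"
      by (intro tendsto_mult_right LIMSEQ_power_zero) (use b be in auto)
    then have "\<forall>\<^sub>F n in sequentially. (b / be) ^ n * (measure M (space M) / m) < min (1 / 2) (e / (G + 1))"
      by (rule order_tendstoD(2)) (use e G0 in auto)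
    then show ?thesis
    proof eventually_elim
      case (elim n)
      have "A n > 0" using Alow[of n] m be by (smt (verit) mult_pos_pos zero_less_power)
      have "D n = (b / be) ^ n * (measure M (space M) / m) * (be ^ n * m)"
        using be m by (simp add: D_def power_divide)
      also have "\<dots> \<le> (b / be) ^ n * (measure M (space M) / m) * A n"
        using Alow[of n] b be m by (intro mult_left_mono mult_nonneg_nonneg) auto
      finally have DA: "D n \<le> (b / be) ^ n * (measure M (space M) / m) * A n" .
      have "(b / be) ^ n * (measure M (space M) / m) * A n \<le> 1 / 2 * A n"
        using elim \<open>A n > 0\<close> by (intro mult_right_mono) auto
      then have half: "A n \<le> 2 * (\<integral>x. f x ^ n \<partial>M)" using DA fl[of n] by linarith
      have "(b / be) ^ n * (measure M (space M) / m) * A n \<le> e / (G + 1) * A n"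
        using elim \<open>A n > 0\<close> by (intro mult_right_mono) auto
      then have "D n \<le> e / (G + 1) * A n" using DA by linarith
      then have "G * D n \<le> G * (e / (G + 1) * A n)" using G0 by (rule mult_left_mono)
      also have "\<dots> = (G / (G + 1)) * (e * A n)" by simp
      also have "\<dots> \<le> 1 * (e * A n)" using G0 e \<open>A n > 0\<close> by (intro mult_right_mono) auto
      finally have "e * A n + G * D n \<le> 2 * (e * A n)" by simp
      also have "\<dots> \<le> 2 * (e * (2 * (\<integral>x. f x ^ n \<partial>M)))" using half e by simp
      finally show ?case using up[of n] half \<open>A n > 0\<close> by auto
    qed
  qed
  show "\<forall>\<^sub>F n in sequentially. (\<integral>x. f x ^ n \<partial>M) > 0"
    using main[of 1] by (auto elim: eventually_mono)
  show "(\<lambda>n. (\<integral>x. g x * f x ^ n \<partial>M) / (\<integral>x. f x ^ n \<partial>M)) \<longlonglongrightarrow> g0"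
  proof (rule tendstoI)
    fix e :: real assume "e > 0"
    then have "e / 8 > 0" by simp
    from main[OF this] show "\<forall>\<^sub>F n in sequentially.
        dist ((\<integral>x. g x * f x ^ n \<partial>M) / (\<integral>x. f x ^ n \<partial>M)) g0 < e"
    proof eventually_elim
      case (elim n)
      define p where "p = (\<integral>x. f x ^ n \<partial>M)"
      have p: "p > 0" "\<bar>(\<integral>x. g x * f x ^ n \<partial>M) - g0 * p\<bar> \<le> e / 2 * p" using elim by (auto simp: p_def)
      have "\<bar>(\<integral>x. g x * f x ^ n \<partial>M) / p - g0\<bar> = \<bar>(\<integral>x. g x * f x ^ n \<partial>M) - g0 * p\<bar> / p"
        using p(1) by (simp add: field_simps abs_divide[symmetric])
      also have "\<dots> \<le> e / 2" using p by (simp add: divide_le_eq)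
      finally show ?case using \<open>e > 0\<close> by (simp add: dist_real_def p_def)
    qed
  qed
qed

text \<open>Dominated convergence for partial sums. It serves twice: for the sum over step lengths
  \<open>d\<close> when \<open>P\<close> is applied, and for the sum over \<open>n\<close> in the
  Green function.\<close>

lemma integral_sums_bounded:
  fixes f :: "nat \<Rightarrow> 'a \<Rightarrow> real"
  assumes "finite_measure M"
    and [measurable]: "\<And>n. f n \<in> borel_measurable M" "F \<in> borel_measurable M"
    and sums: "\<And>x. x \<in> space M \<Longrightarrow> (\<lambda>n. f n x) sums F x"
    and B: "\<And>n x. x \<in> space M \<Longrightarrow> \<bar>\<Sum>i<n. f i x\<bar> \<le> B"
  shows "(\<lambda>n. \<integral>x. f n x \<partial>M) sums (\<integral>x. F x \<partial>M)"
proof -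
  interpret finite_measure M by fact
  have "integrable M (f n)" for n
  proof (rule integrable_const_bound[of _ "2 * B"])
    have "\<bar>f n x\<bar> \<le> 2 * B" if "x \<in> space M" for x
      using B[OF that, of n] B[OF that, of "Suc n"] by simp
    then show "AE x in M. norm (f n x) \<le> 2 * B" by (auto intro!: AE_I2)
  qed measurable
  moreover have "(\<lambda>n. \<integral>x. (\<Sum>i<n. f i x) \<partial>M) \<longlonglongrightarrow> (\<integral>x. F x \<partial>M)"
  proof (rule integral_dominated_convergence[where w = "\<lambda>_. B"])
    show "AE x in M. (\<lambda>n. \<Sum>i<n. f i x) \<longlonglongrightarrow> F x"
      using sums by (auto intro!: AE_I2 simp: sums_def)
    show "AE x in M. norm (\<Sum>i<n. f i x) \<le> B" for n
      using B by (auto intro!: AE_I2)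
  qed simp_all
  ultimately show ?thesis by (simp add: sums_def)
qed

section \<open>The Plancherel measure\<close>

text \<open>The squared modulus of \<open>1 - exp (2 i t) / q\<close>, the denominator of the
  Plancherel density; it also equals \<open>(1 - 1/q)^2 + 4/q * (sin t)^2\<close>, hence is smallest
  at \<open>t = 0\<close>.\<close>

definition planch_den :: "nat \<Rightarrow> real \<Rightarrow> real" where
  "planch_den q t = 1 - 2 * cos (2 * t) / real q + 1 / (real q)\<^sup>2"

lemma planch_den_bounds:
  assumes "q \<ge> 2"
  shows "planch_den q 0 > 0" "planch_den q 0 \<le> planch_den q t" "planch_den q t > 0"
    "planch_den q t \<le> planch_den q 0 + 8 * (1 - cos t)"
proof -
  have q: "real q \<ge> 2" using assms by simp
  have e0: "planch_den q 0 = (1 - 1 / real q)\<^sup>2"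
    by (simp add: planch_den_def power2_eq_square algebra_simps)
  have "1 / real q < 1" using q by simp
  then show 1: "planch_den q 0 > 0" unfolding e0 by (intro zero_less_power) simp
  have d: "planch_den q t = planch_den q 0 + 4 / real q * (sin t)\<^sup>2"
    unfolding planch_den_def cos_double_sin by (simp add: diff_divide_distrib right_diff_distrib)
  then show 2: "planch_den q 0 \<le> planch_den q t" using q by simp
  show "planch_den q t > 0" using 1 2 by linarith
  have "(sin t)\<^sup>2 = (1 - cos t) * (1 + cos t)"
    unfolding sin_squared_eq by (simp add: power2_eq_square algebra_simps)
  also have "\<dots> \<le> (1 - cos t) * 2" by (rule mult_left_mono) auto
  finally have s: "(sin t)\<^sup>2 \<le> (1 - cos t) * 2" .
  have "4 / real q * (sin t)\<^sup>2 \<le> 4 * (sin t)\<^sup>2"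
    using q by (intro mult_right_mono) (auto simp: field_simps)
  with s show "planch_den q t \<le> planch_den q 0 + 8 * (1 - cos t)" unfolding d by linarith
qed

lemma continuous_planch_den: "continuous_on A (planch_den q)"
  unfolding planch_den_def divide_inverse by (intro continuous_intros)

text \<open>The constant normalises the total mass to 1, as \<open>measure_planch\<close>
  confirms.\<close>

definition planch_weight :: "nat \<Rightarrow> real \<Rightarrow> real" where
  "planch_weight q t = 2 / pi * (1 + 1 / real q) * (sin t)\<^sup>2 / planch_den q t"

definition planch :: "nat \<Rightarrow> real measure" where
  "planch q = density arc_measure (\<lambda>t. ennreal (planch_weight q t))"

lemma space_planch [simp]: "space (planch q) = {0<..<pi}"
  by (simp add: planch_def)

lemma sets_planch [measurable_cong]: "sets (planch q) = sets arc_measure"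
  by (simp add: planch_def)

lemma planch_weight_nonneg: "q \<ge> 2 \<Longrightarrow> planch_weight q t \<ge> 0"
  using planch_den_bounds(3)[of q t] by (simp add: planch_weight_def)

lemma planch_weight_pos: assumes "q \<ge> 2" "0 < t" "t < pi" shows "planch_weight q t > 0"
proof -
  have "1 + 1 / real q > 0" by (simp add: add_pos_nonneg)
  then show ?thesis
    using planch_den_bounds(3)[OF assms(1), of t] sin_gt_zero[OF assms(2,3)]
    unfolding planch_weight_def by simp
qed

text \<open>The quadratic vanishing at \<open>t = 0\<close> is what later compensates
  \<open>1 / (rho - ahat t)\<close> and makes the Green function finite at the spectral
  radius.\<close>

lemma planch_weight_le:
  assumes "q \<ge> 2"
  shows "planch_weight q t \<le> 4 / (pi * planch_den q 0) * (sin t)\<^sup>2"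
proof -
  note E = planch_den_bounds(1)[OF assms] planch_den_bounds(2,3)[OF assms, of t]
  have "planch_weight q t \<le> 2 / pi * (1 + 1 / real q) * (sin t)\<^sup>2 / planch_den q 0"
    unfolding planch_weight_def
    by (rule divide_left_mono) (use E in auto)
  also have "\<dots> = (1 + 1 / real q) * (2 / (pi * planch_den q 0) * (sin t)\<^sup>2)" by simp
  also have "\<dots> \<le> 2 * (2 / (pi * planch_den q 0) * (sin t)\<^sup>2)"
    by (rule mult_right_mono) (use assms E in auto)
  finally show ?thesis by simp
qed

lemma measurable_planch_weight [measurable]:
  assumes "q \<ge> 2" shows "planch_weight q \<in> borel_measurable arc_measure"
  unfolding planch_weight_def
  by (intro continuous_imp_measurable_arc continuous_intros continuous_planch_den)
    (use planch_den_bounds(3)[OF assms] in \<open>auto simp: less_imp_neq[THEN not_sym]\<close>)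

lemma planch_weight_le_const: "q \<ge> 2 \<Longrightarrow> planch_weight q t \<le> 4 / (pi * planch_den q 0)"
proof -
  assume q: "q \<ge> 2"
  have "(sin t)\<^sup>2 \<le> 1" by (simp add: abs_square_le_1)
  then have "4 / (pi * planch_den q 0) * (sin t)\<^sup>2 \<le> 4 / (pi * planch_den q 0) * 1"
    using planch_den_bounds(1)[OF q] by (intro mult_left_mono) auto
  then show ?thesis using planch_weight_le[OF q, of t] by linarith
qed

lemma finite_measure_planch: assumes q: "q \<ge> 2" shows "finite_measure (planch q)"
proof (rule finite_measureI)
  have "integrable arc_measure (planch_weight q)"
    by (rule integrable_arc_bounded[of _ "4 / (pi * planch_den q 0)"])
      (use planch_weight_nonneg[OF q] planch_weight_le_const[OF q] measurable_planch_weight[OF q] in auto)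
  then have "(\<integral>\<^sup>+t. ennreal (planch_weight q t) \<partial>arc_measure) = ennreal (\<integral>t. planch_weight q t \<partial>arc_measure)"
    by (rule nn_integral_eq_integral) (simp add: planch_weight_nonneg[OF q])
  moreover have "emeasure (planch q) (space (planch q)) = (\<integral>\<^sup>+t. ennreal (planch_weight q t) \<partial>arc_measure)"
  proof -
    have "emeasure (planch q) (space (planch q)) = (\<integral>\<^sup>+t. ennreal (planch_weight q t) * indicator (space arc_measure) t \<partial>arc_measure)"
      unfolding planch_def using measurable_planch_weight[OF q]
      by (subst emeasure_density) (simp_all add: sets.top[of arc_measure, simplified])
    also have "\<dots> = (\<integral>\<^sup>+t. ennreal (planch_weight q t) \<partial>arc_measure)"
      by (rule nn_integral_cong) simp
    finally show ?thesis .
  qed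
  ultimately show "emeasure (planch q) (space (planch q)) \<noteq> \<infinity>" by simp
qed

lemma integral_planch:
  fixes f :: "real \<Rightarrow> real"
  assumes "q \<ge> 2" "f \<in> borel_measurable arc_measure"
  shows "(\<integral>t. f t \<partial>planch q) = (\<integral>t. planch_weight q t * f t \<partial>arc_measure)"
  unfolding planch_def using assms planch_weight_nonneg[OF assms(1)]
  by (subst integral_density) auto

definition sin_comb :: "nat \<Rightarrow> nat \<Rightarrow> real \<Rightarrow> real" where
  "sin_comb q k t = sin (real (Suc k) * t) - sin ((real k - 1) * t) / real q"

lemma continuous_sin_comb: "continuous_on A (sin_comb q k)"
  unfolding sin_comb_def divide_inverse by (intro continuous_intros)

lemma abs_sin_comb_le: assumes "q \<ge> 2" shows "\<bar>sin_comb q k t\<bar> \<le> 2"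
proof -
  have "\<bar>sin ((real k - 1) * t) / real q\<bar> \<le> 1 / 1"
    unfolding abs_divide by (rule frac_le) (use assms in auto)
  then show ?thesis unfolding sin_comb_def
    using abs_sin_le_one[of "real (Suc k) * t"] by linarith
qed

text \<open>One of the two factors \<open>sin t\<close> of the weight is spent on
  \<open>sin_sph\<close>; the other stays with the denominator.\<close>

lemma planch_weight_sph:
  assumes "q \<ge> 2"
  shows "planch_weight q t * sph q k t =
    2 / pi * real q powr (- real k / 2) * (sin_comb q k t * (sin t / planch_den q t))"
proof -
  have p: "1 + 1 / real q > 0" by (simp add: add_pos_nonneg)
  have "planch_weight q t * sph q k t =
      2 / pi * (1 + 1 / real q) * (sin t * sph q k t) * (sin t / planch_den q t)"
    by (simp add: planch_weight_def power2_eq_square)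
  also have "\<dots> = 2 / pi * real q powr (- real k / 2) * (sin_comb q k t * (sin t / planch_den q t))"
  proof -
    have "(1 + 1 / real q) * (P / (1 + 1 / real q) * s) = P * s" for P s using p by simp
    then have "2 / pi * (1 + 1 / real q) * (P / (1 + 1 / real q) * s) * r = 2 / pi * P * (s * r)" for P s r
      by (metis (no_types, opaque_lifting) mult.assoc)
    then show ?thesis unfolding sin_sph[OF assms] sin_comb_def[symmetric] .
  qed
  finally show ?thesis .
qed

lemma integrable_sin_comb_den:
  assumes "q \<ge> 2"
  shows "integrable arc_measure (\<lambda>t. sin_comb q k t * (sin t / planch_den q t))"
proof (rule integrable_arc_bounded)
  show "(\<lambda>t. sin_comb q k t * (sin t / planch_den q t)) \<in> borel_measurable arc_measure"
    by (intro continuous_imp_measurable_arc continuous_intros continuous_planch_den continuous_sin_comb)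
      (use planch_den_bounds(3)[OF assms] in \<open>auto simp: less_imp_neq[THEN not_sym]\<close>)
  show "\<bar>sin_comb q k t * (sin t / planch_den q t)\<bar> \<le> 2 * (1 / planch_den q 0)" for t
  proof -
    have "\<bar>sin t / planch_den q t\<bar> \<le> 1 / planch_den q 0"
      using planch_den_bounds(1)[OF assms] planch_den_bounds(2,3)[OF assms, of t] unfolding abs_divide by (intro frac_le) auto
    then show ?thesis unfolding abs_mult by (intro mult_mono abs_sin_comb_le[OF assms]) auto
  qed
qed

text \<open>\<open>sin_comb q k t\<close> is the imaginary part of
  \<open>exp (i (k + 1) t) * (1 - exp (- 2 i t) / q)\<close>. The left-hand side multiplies this by
  \<open>1 - exp (2 i t) / q\<close>, completing the squared modulus
  \<open>planch_den q t\<close>.\<close>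

lemma sin_comb_recurrence:
  "sin_comb q k t - sin_comb q (Suc (Suc k)) t / real q = sin (real (Suc k) * t) * planch_den q t"
proof -
  have "sin (real (Suc (Suc (Suc k))) * t) = sin (real (Suc k) * t + 2 * t)"
    "sin ((real k - 1) * t) = sin (real (Suc k) * t - 2 * t)"
    by (simp_all add: algebra_simps)
  then have *: "sin (real (Suc (Suc (Suc k))) * t) + sin ((real k - 1) * t) =
      2 * (sin (real (Suc k) * t) * cos (2 * t))"
    unfolding sin_add sin_diff by simp
  have n: "real (Suc (Suc k)) - 1 = real (Suc k)" by simp
  have "sin_comb q k t - sin_comb q (Suc (Suc k)) t / real q = sin (real (Suc k) * t) * (1 + 1 / (real q)\<^sup>2)
     - (sin (real (Suc (Suc (Suc k))) * t) + sin ((real k - 1) * t)) / real q"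
    unfolding sin_comb_def n
    by (simp add: power2_eq_square distrib_left add_divide_distrib diff_divide_distrib del: of_nat_Suc)
  then show ?thesis unfolding * planch_den_def
    by (simp add: distrib_left right_diff_distrib del: of_nat_Suc)
qed

text \<open>The recurrence gives \<open>c (k + 2) = q * c k\<close> for \<open>k \<ge> 1\<close>, so bounded moments must vanish.\<close>

lemma integral_sin_comb_den:
  assumes q: "q \<ge> 2"
  shows "(\<integral>t. sin_comb q k t * (sin t / planch_den q t) \<partial>arc_measure) = (if k = 0 then pi / 2 else 0)"
proof -
  define c where "c k = (\<integral>t. sin_comb q k t * (sin t / planch_den q t) \<partial>arc_measure)" for k
  have rec: "c k - c (Suc (Suc k)) / real q = (if k = 0 then pi / 2 else 0)" for k
  proof -
    have "sin_comb q k t * (sin t / planch_den q t) - 1 / real q * (sin_comb q (Suc (Suc k)) t * (sin t / planch_den q t)) =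
        sin (real (Suc k) * t) * sin (real (Suc 0) * t)" for t
    proof -
      have "sin_comb q k t * (sin t / planch_den q t) - 1 / real q * (sin_comb q (Suc (Suc k)) t * (sin t / planch_den q t)) =
        (sin_comb q k t - sin_comb q (Suc (Suc k)) t / real q) * (sin t / planch_den q t)"
        by (simp only: left_diff_distrib) simp
      also have "\<dots> = sin (real (Suc k) * t) * sin (real (Suc 0) * t)"
        unfolding sin_comb_recurrence using planch_den_bounds(3)[OF q, of t] by simp
      finally show ?thesis .
    qed
    note pointwise = this
    have "c k - 1 / real q * c (Suc (Suc k)) = (\<integral>t. sin_comb q k t * (sin t / planch_den q t) -
        1 / real q * (sin_comb q (Suc (Suc k)) t * (sin t / planch_den q t)) \<partial>arc_measure)"
      unfolding c_def integral_mult_right_zero[symmetric]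
      by (intro Bochner_Integration.integral_diff[symmetric] integrable_mult_right integrable_sin_comb_den[OF q])
    also have "\<dots> = (\<integral>t. sin (real (Suc k) * t) * sin (real (Suc 0) * t) \<partial>arc_measure)"
      by (simp only: pointwise)
    finally show ?thesis unfolding integral_sin_sin_arc by simp
  qed
  obtain C where C: "\<And>k. \<bar>c k\<bar> \<le> C"
  proof
    fix k
    have "\<bar>c k\<bar> \<le> (\<integral>t. \<bar>sin_comb q k t * (sin t / planch_den q t)\<bar> \<partial>arc_measure)"
      unfolding c_def by (rule integral_abs_bound)
    also have "\<dots> \<le> (\<integral>t. 2 * (1 / planch_den q 0) \<partial>arc_measure)"
    proof (rule integral_mono)
      show "integrable arc_measure (\<lambda>t. 2 * (1 / planch_den q 0))"
        by (rule integrable_arc_bounded[OF _ order.refl]) simp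
      show "integrable arc_measure (\<lambda>t. \<bar>sin_comb q k t * (sin t / planch_den q t)\<bar>)"
        using integrable_sin_comb_den[OF q] by (rule integrable_abs)
      show "\<bar>sin_comb q k t * (sin t / planch_den q t)\<bar> \<le> 2 * (1 / planch_den q 0)" for t
      proof -
        have "\<bar>sin t / planch_den q t\<bar> \<le> 1 / planch_den q 0"
          using planch_den_bounds(1)[OF q] planch_den_bounds(2,3)[OF q, of t] unfolding abs_divide by (intro frac_le) auto
        then show ?thesis unfolding abs_mult by (intro mult_mono abs_sin_comb_le[OF q]) auto
      qed
    qed
    finally show "\<bar>c k\<bar> \<le> (\<integral>t. 2 * (1 / planch_den q 0) \<partial>arc_measure)" .
  qed
  have zero: "c (Suc k) = 0" for k
  proof (rule ccontr)
    assume ne: "c (Suc k) \<noteq> 0"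
    have pw: "c (Suc k + 2 * n) = real q ^ n * c (Suc k)" for n
    proof (induction n)
      case (Suc n)
      have "c (Suc k + 2 * Suc n) = real q * c (Suc k + 2 * n)"
        using rec[of "Suc k + 2 * n"] q by (simp add: field_simps)
      then show ?case using Suc by simp
    qed simp
    obtain n where "C / \<bar>c (Suc k)\<bar> < real q ^ n" using real_arch_pow[of "real q"] q by auto
    then have "C < real q ^ n * \<bar>c (Suc k)\<bar>" using ne by (simp add: divide_less_eq)
    then show False using C[of "Suc k + 2 * n"] unfolding pw by (simp add: abs_mult)
  qed
  show ?thesis
  proof (cases k)
    case 0
    then show ?thesis using rec[of 0] zero[of 1] by (simp add: c_def)
  next
    case (Suc m)
    then show ?thesis using zero[of m] by (simp add: c_def)
  qed
qed

lemma continuous_sph: "continuous_on A (sph q k)"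
  unfolding sph_def cos_sum_def divide_inverse by (intro continuous_intros)

lemma measurable_sph [measurable]: "sph q k \<in> borel_measurable arc_measure"
  by (rule continuous_imp_measurable_arc continuous_sph)+

text \<open>The link between measure and tree: these are the integrals required to represent the
  identity matrix, since \<open>k = 0\<close> means \<open>x = y\<close>.\<close>

lemma integral_sph_planch:
  assumes q: "q \<ge> 2"
  shows "(\<integral>t. sph q k t \<partial>planch q) = (if k = 0 then 1 else 0)"
  unfolding integral_planch[OF q measurable_sph] planch_weight_sph[OF q] integral_mult_right_zero
    integral_sin_comb_den[OF q]
  using q by simp

text \<open>The exponential decay of \<open>phi\<close> absorbs the fourth power from
  \<open>sph_second_order\<close>. Boundedness is enough, because the bound is then summed against
  the probability weights \<open>a\<close>.\<close>

lemma phi_growth: assumes "q \<ge> 2" shows "\<exists>B. \<forall>d. (1 + real d ^ 4) * phi q d \<le> B"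
proof -
  have le: "phi q d \<le> (1 + real d) * (3 / 4) ^ d" for d
  proof -
    have "real q powr (- real d / 2) = (real q powr (- 1 / 2)) ^ d"
      using assms by (simp add: powr_realpow[symmetric] powr_powr)
    \<comment> \<open>\<open>3 / 4\<close> is a convenient rational number between
      \<open>1 / sqrt 2\<close> and 1.\<close>
    also have "\<dots> \<le> (3 / 4) ^ d"
    proof (rule power_mono)
      have "real q powr (- 1 / 2) \<le> 2 powr (- 1 / 2)" using assms by (intro powr_mono2') auto
      also have "2 powr (- 1 / 2) = 1 / sqrt 2" by (simp add: powr_minus_divide powr_half_sqrt)
      also have "\<dots> \<le> 3 / 4"
      proof -
        have "4 / 3 \<le> sqrt 2" by (rule real_le_rsqrt) (simp add: power2_eq_square)
        then show ?thesis by (simp add: field_simps)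
      qed
      finally show "real q powr (- 1 / 2) \<le> 3 / 4" .
    qed simp
    finally have 1: "real q powr (- real d / 2) \<le> (3 / 4) ^ d" .
    have "(real q - 1) / (real q + 1) \<le> 1" by simp
    then have "1 + (real q - 1) / (real q + 1) * real d \<le> 1 + real d"
      using mult_right_mono[of "(real q - 1) / (real q + 1)" 1 "real d"] by simp
    then show ?thesis unfolding phi_def using assms by (intro mult_mono 1) auto
  qed
  have "(\<lambda>d::nat. (1 + real d ^ 4) * ((1 + real d) * (3 / 4) ^ d)) \<longlonglongrightarrow> 0"
    by real_asymp
  then have "Bseq (\<lambda>d::nat. (1 + real d ^ 4) * ((1 + real d) * (3 / 4) ^ d))"
    by (intro convergent_imp_Bseq convergentI)
  then obtain B where B: "\<And>d. norm ((1 + real d ^ 4) * ((1 + real d) * (3 / 4) ^ d)) \<le> B"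
    unfolding Bseq_def by blast
  have "(1 + real d ^ 4) * phi q d \<le> B" for d
  proof -
    have "(1 + real d ^ 4) * phi q d \<le> (1 + real d ^ 4) * ((1 + real d) * (3 / 4) ^ d)"
      by (rule mult_left_mono[OF le]) simp
    also have "\<dots> \<le> B" by (rule abs_le_D1[OF B[unfolded real_norm_def]])
    finally show ?thesis .
  qed
  then show ?thesis by blast
qed

section \<open>Transition probabilities and spectral radius\<close>

locale radial_walk =
  fixes q :: nat and a :: "nat \<Rightarrow> real"
  assumes q: "q \<ge> 2"
    and a_nonneg: "\<And>d. a d \<ge> 0"
    and a_sums: "a sums 1"
    and odd_step: "\<exists>d. odd d \<and> a d > 0"
    and even_step: "\<exists>d. even d \<and> a d > 0"
begin

lemma summable_weighted:
  assumes "\<And>d. \<bar>X d\<bar> \<le> C * ((1 + real d ^ 4) * phi q d)" "C \<ge> 0"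
  shows "summable (\<lambda>d. a d * X d)"
proof -
  obtain B where B: "\<And>d. (1 + real d ^ 4) * phi q d \<le> B" using phi_growth[OF q] by blast
  show ?thesis
  proof (rule summable_comparison_test')
    show "summable (\<lambda>d. a d * (C * B))"
      using a_sums by (intro summable_mult2) (auto simp: sums_iff)
    show "norm (a d * X d) \<le> a d * (C * B)" if "d \<ge> 0" for d
    proof -
      have "\<bar>X d\<bar> \<le> C * B"
        using assms(1)[of d] mult_left_mono[OF B[of d] assms(2)] by linarith
      then show ?thesis using a_nonneg[of d] by (simp add: abs_mult mult_left_mono)
    qed
  qed
qed

lemma phi_le_growth: "phi q d \<le> (1 + real d ^ 4) * phi q d"
  using phi_pos[OF q, of d] mult_right_mono[of 1 "1 + real d ^ 4" "phi q d"] by simp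

lemma summable_sph: "summable (\<lambda>d. a d * sph q d t)"
  using abs_sph_le_phi[OF q, of _ t] phi_le_growth
  by (intro summable_weighted[of _ 1]) (auto intro: order.trans)

lemma summable_phi: "summable (\<lambda>d. a d * phi q d)"
  using summable_sph[of 0] unfolding sph_at_0[OF q] .

lemma summable_curv: "summable (\<lambda>d. a d * sph_curv q d)"
proof (rule summable_weighted[of _ 1])
  fix d
  have "real d ^ 2 \<le> 1 + real d ^ 4"
  proof (cases "d = 0")
    case False
    then have "real d ^ 2 \<le> real d ^ 4" by (intro power_increasing) auto
    then show ?thesis by simp
  qed simp
  then have "real d ^ 2 * phi q d \<le> (1 + real d ^ 4) * phi q d"
    using phi_pos[OF q, of d] by (intro mult_right_mono) auto
  then show "\<bar>sph_curv q d\<bar> \<le> 1 * ((1 + real d ^ 4) * phi q d)"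
    using sph_curv_bounds[OF q, of d] by simp
qed simp

lemma summable_fourth: "summable (\<lambda>d. a d * (2 * real d ^ 4 * phi q d))"
proof (rule summable_weighted[of _ 2])
  fix d
  show "\<bar>2 * real d ^ 4 * phi q d\<bar> \<le> 2 * ((1 + real d ^ 4) * phi q d)"
    using phi_pos[OF q, of d] by (simp add: distrib_right)
qed simp

definition ahat :: "real \<Rightarrow> real" where
  "ahat t = (\<Sum>d. a d * sph q d t)"

text \<open>The value of \<open>ahat\<close> at 0, as \<open>sph q d 0 = phi q d\<close>; that it is
  the spectral radius is established in \<open>spec_rad_eq\<close>.\<close>

definition rho :: real where
  "rho = (\<Sum>d. a d * phi q d)"

text \<open>The coefficient in \<open>rho - ahat t = kappa * (1 - cos t) + O((1 - cos t)^2)\<close>;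
  the two sides of this expansion are \<open>rho_minus_ahat_le\<close> and
  \<open>rho_minus_ahat_ge\<close>.\<close>

definition kappa :: real where
  "kappa = (\<Sum>d. a d * sph_curv q d)"

lemma ahat_sums: "(\<lambda>d. a d * sph q d t) sums ahat t"
  unfolding ahat_def using summable_sph by (rule summable_sums)

lemma rho_sums: "(\<lambda>d. a d * phi q d) sums rho"
  unfolding rho_def using summable_phi by (rule summable_sums)

lemma kappa_sums: "(\<lambda>d. a d * sph_curv q d) sums kappa"
  unfolding kappa_def using summable_curv by (rule summable_sums)

lemma measurable_ahat [measurable]: "ahat \<in> borel_measurable arc_measure"
  unfolding ahat_def[abs_def] by measurable

lemma curvature_sums:
  "(\<lambda>d. a d * (sph_curv q d * (1 - cos t) - (phi q d - sph q d t))) sums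
     (kappa * (1 - cos t) - (rho - ahat t))"
proof -
  have "(\<lambda>d. a d * sph_curv q d * (1 - cos t) - (a d * phi q d - a d * sph q d t)) sums
      (kappa * (1 - cos t) - (rho - ahat t))"
    by (intro sums_diff sums_mult2 kappa_sums rho_sums ahat_sums)
  then show ?thesis by (simp add: right_diff_distrib mult.assoc)
qed

lemma rho_minus_ahat_le: "rho - ahat t \<le> kappa * (1 - cos t)"
proof -
  have "0 \<le> kappa * (1 - cos t) - (rho - ahat t)"
    by (rule sums_le[OF _ sums_zero curvature_sums])
      (intro mult_nonneg_nonneg a_nonneg sph_second_order[OF q])
  then show ?thesis by simp
qed

lemma rho_minus_ahat_ge:
  "\<exists>C\<ge>0. \<forall>t. kappa * (1 - cos t) - (rho - ahat t) \<le> C * (1 - cos t)\<^sup>2"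
proof (intro exI[of _ "\<Sum>d. a d * (2 * real d ^ 4 * phi q d)"] conjI allI)
  show "0 \<le> (\<Sum>d. a d * (2 * real d ^ 4 * phi q d))"
    using a_nonneg less_imp_le[OF phi_pos[OF q]] by (intro suminf_nonneg[OF summable_fourth]) simp
  fix t
  have "(\<lambda>d. a d * (2 * real d ^ 4 * phi q d) * (1 - cos t)\<^sup>2) sums
      ((\<Sum>d. a d * (2 * real d ^ 4 * phi q d)) * (1 - cos t)\<^sup>2)"
    by (intro sums_mult2 summable_sums summable_fourth)
  then show "kappa * (1 - cos t) - (rho - ahat t) \<le>
      (\<Sum>d. a d * (2 * real d ^ 4 * phi q d)) * (1 - cos t)\<^sup>2"
    by (rule sums_le[rotated, OF curvature_sums])
      (simp only: mult.assoc[of "a _"], intro mult_left_mono a_nonneg sph_second_order[OF q])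
qed

lemma kappa_nonneg: "kappa \<ge> 0"
  by (rule sums_le[OF _ sums_zero kappa_sums]) (intro mult_nonneg_nonneg a_nonneg sph_curv_bounds[OF q])

text \<open>An odd step size separates \<open>ahat\<close> from \<open>rho\<close> away from \<open>t = 0\<close>, an even one separates it
  from \<open>-rho\<close>.\<close>

lemma spectral_gap: "\<exists>c>0. \<forall>t. c * (1 - cos t) \<le> rho - \<bar>ahat t\<bar>"
proof -
  obtain k where k: "odd k" "a k > 0" using odd_step by blast
  obtain l where l: "even l" "a l > 0" using even_step by blast
  \<comment> \<open>\<open>w d\<close> is the weight of one single frequency of
    \<open>cos_sum d\<close> inside \<open>sph q d\<close>, as it appears in the odd and even
    bounds.\<close>
  define w where "w d = real q powr (- real d / 2) / (1 + 1 / real q) * (1 - 1 / real q)" for d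
  have w: "w d > 0" for d
    using q by (auto simp: w_def add_pos_nonneg intro!: mult_pos_pos divide_pos_pos)
  define c where "c = min (a k * w k) (a l * w l)"
  have c: "c > 0" using k l w by (simp add: c_def)
  have low: "c * (1 - cos t) \<le> rho - ahat t" for t
  proof -
    have s: "(\<lambda>d. a d * (phi q d - sph q d t)) sums (rho - ahat t)"
      unfolding right_diff_distrib by (intro sums_diff rho_sums ahat_sums)
    have nn: "0 \<le> a d * (phi q d - sph q d t)" for d
      using abs_sph_le_phi[OF q, of d t] by (intro mult_nonneg_nonneg a_nonneg) linarith
    have "c * (1 - cos t) \<le> a k * w k * (1 - cos t)"
      by (intro mult_right_mono) (auto simp: c_def)
    also have "\<dots> \<le> a k * (phi q k - sph q k t)"
      using phi_minus_sph_odd[OF q k(1), of t] a_nonneg[of k]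
      unfolding mult.assoc[of "a k"] by (intro mult_left_mono) (auto simp: w_def)
    also have "\<dots> \<le> rho - ahat t"
      using sum_le_suminf[OF sums_summable[OF s], of "{k}"] nn sums_unique[OF s] by auto
    finally show ?thesis .
  qed
  have up: "c * (1 - cos t) \<le> rho + ahat t" for t
  proof -
    have s: "(\<lambda>d. a d * (phi q d + sph q d t)) sums (rho + ahat t)"
      unfolding distrib_left by (intro sums_add rho_sums ahat_sums)
    have nn: "0 \<le> a d * (phi q d + sph q d t)" for d
      using abs_sph_le_phi[OF q, of d t] by (intro mult_nonneg_nonneg a_nonneg) linarith
    have "c * (1 - cos t) \<le> a l * w l * 2"
      using c cos_ge_minus_one[of t] by (intro mult_mono) (auto simp: c_def)
    also have "\<dots> \<le> a l * (phi q l + sph q l t)"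
      using phi_plus_sph_even[OF q l(1), of t] a_nonneg[of l]
      unfolding mult.assoc[of "a l"] by (intro mult_left_mono) (auto simp: w_def)
    also have "\<dots> \<le> rho + ahat t"
      using sum_le_suminf[OF sums_summable[OF s], of "{l}"] nn sums_unique[OF s] by auto
    finally show ?thesis .
  qed
  have "c * (1 - cos t) \<le> rho - \<bar>ahat t\<bar>" for t
    using low[of t] up[of t] by (simp add: abs_if)
  then show ?thesis using c by blast
qed

lemma abs_ahat_le: "\<bar>ahat t\<bar> \<le> rho"
proof -
  obtain c where "c > 0" "c * (1 - cos t) \<le> rho - \<bar>ahat t\<bar>" using spectral_gap by blast
  moreover from this have "0 \<le> c * (1 - cos t)" by simp
  ultimately show ?thesis by linarith
qed

lemma rho_pos: "rho > 0"
proof -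
  obtain c where "c > 0" "c * (1 - cos pi) \<le> rho - \<bar>ahat pi\<bar>" using spectral_gap by blast
  then show ?thesis by simp
qed

text \<open>At \<open>t = pi\<close> the gap bounds \<open>rho - ahat t\<close> below by a positive
  number, while \<open>kappa * (1 - cos t)\<close> bounds it above.\<close>

lemma kappa_pos: "kappa > 0"
proof -
  obtain c where "c > 0" "c * (1 - cos pi) \<le> rho - \<bar>ahat pi\<bar>" using spectral_gap by blast
  then show ?thesis using rho_minus_ahat_le[of pi] by (simp add: abs_if split: if_splits)
qed

section \<open>Transition probabilities as integrals over the spectrum\<close>

lemma Ptrans_eq:
  assumes "x \<in> tree_vertices q" "y \<in> tree_vertices q"
  shows "Ptrans q a x y = a (wdist x y) / sphere_size q (wdist x y)"
proof -
  have "Ptrans q a x y = (\<Sum>d\<in>{wdist x y}. a d * pd q d x y)"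
    unfolding Ptrans_def
    by (rule suminf_finite) (use tdist_eq_wdist[OF assms] in \<open>auto simp: pd_def\<close>)
  also have "\<dots> = a (wdist x y) / sphere_size q (wdist x y)"
    using tdist_eq_wdist[OF assms] by (auto simp: pd_def sphere_size_def)
  finally show ?thesis .
qed

lemma sphere_size_pos: "sphere_size q d > 0"
  using q by (simp add: sphere_size_def add_pos_nonneg)

text \<open>\<open>P\<close> depends only on the distance, so the sum over all vertices is regrouped
  into spheres about \<open>x\<close>. Nonnegativity and the bound on \<open>h\<close> supply the
  summability behind the rearrangement.\<close>

lemma infsum_Ptrans:
  assumes x: "x \<in> tree_vertices q"
    and h: "\<And>z. z \<in> tree_vertices q \<Longrightarrow> 0 \<le> h z" "\<And>z. z \<in> tree_vertices q \<Longrightarrow> h z \<le> C"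
  shows "(\<lambda>d. a d / sphere_size q d * sum h (sphere_at q x d)) sums
     (\<Sum>\<^sub>\<infinity>z\<in>tree_vertices q. Ptrans q a x z * h z)"
proof -
  let ?G = "\<lambda>(d, z). a d / sphere_size q d * h z"
  define g where "g d = a d / sphere_size q d * sum h (sphere_at q x d)" for d
  have S: "sphere_at q x d \<subseteq> tree_vertices q" for d by (auto simp: sphere_at_def)
  have co: "0 \<le> a d / sphere_size q d" for d using a_nonneg sphere_size_pos by (simp add: less_imp_le)
  have g0: "0 \<le> g d" for d
    unfolding g_def using S h(1) by (intro mult_nonneg_nonneg co sum_nonneg) auto
  have gC: "g d \<le> a d * C" for d
  proof -
    have "sum h (sphere_at q x d) \<le> of_nat (card (sphere_at q x d)) * C"
      using S h(2) by (intro sum_bounded_above) auto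
    then have "g d \<le> a d / sphere_size q d * (sphere_size q d * C)"
      unfolding g_def card_sphere_at[OF x] by (rule mult_left_mono[OF _ co])
    then show ?thesis using sphere_size_pos[of d] by simp
  qed
  have "summable (\<lambda>d. a d * C)" using a_sums by (intro summable_mult2) (auto simp: sums_iff)
  then have "summable g"
    by (rule summable_comparison_test'[where N = 0]) (use g0 gC in simp)
  then have gsum: "g summable_on UNIV" using g0 by (subst summable_on_UNIV_nonneg_real_iff) auto
  have inner: "((\<lambda>z. ?G (d, z)) has_sum g d) (sphere_at q x d)" for d
    using has_sum_finite[OF finite_sphere_at[OF x], of "\<lambda>z. ?G (d, z)" d]
    by (simp add: g_def sum_distrib_left)
  have "?G summable_on (Sigma UNIV (sphere_at q x))"
  proof (rule summable_on_SigmaI[OF inner gsum])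
    fix d z assume "z \<in> sphere_at q x d"
    then have "z \<in> tree_vertices q" using S by blast
    then show "0 \<le> ?G (d, z)" using mult_nonneg_nonneg[OF co h(1)] by simp
  qed
  then have "(?G has_sum infsum g UNIV) (Sigma UNIV (sphere_at q x))"
    by (rule has_sum_SigmaI[OF inner has_sum_infsum[OF gsum]])
  moreover have "?G p = Ptrans q a x (snd p) * h (snd p)" if "p \<in> Sigma UNIV (sphere_at q x)" for p
    using that Ptrans_eq[OF x] by (auto simp: sphere_at_def)
  ultimately have "((\<lambda>p. Ptrans q a x (snd p) * h (snd p)) has_sum infsum g UNIV) (Sigma UNIV (sphere_at q x))"
    by (subst has_sum_cong[where g = ?G]) auto
  \<comment> \<open>Each vertex lies on exactly one sphere about \<open>x\<close>, so the pairs of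
    radius and vertex are just the vertices.\<close>
  moreover have "bij_betw snd (Sigma UNIV (sphere_at q x)) (tree_vertices q)"
    by (rule bij_betwI[where g = "\<lambda>z. (wdist x z, z)"]) (auto simp: sphere_at_def)
  ultimately have "((\<lambda>z. Ptrans q a x z * h z) has_sum infsum g UNIV) (tree_vertices q)"
    by (subst (asm) has_sum_reindex_bij_betw)
  then have "(\<Sum>\<^sub>\<infinity>z\<in>tree_vertices q. Ptrans q a x z * h z) = infsum g UNIV" by (rule infsumI)
  moreover have "g sums infsum g UNIV" by (rule has_sum_imp_sums[OF has_sum_infsum[OF gsum]])
  ultimately show ?thesis by (simp add: g_def[abs_def])
qed

lemma pn_nonneg: "x \<in> tree_vertices q \<Longrightarrow> y \<in> tree_vertices q \<Longrightarrow> 0 \<le> pn q a n x y"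
proof (induction n arbitrary: x)
  case (Suc n)
  then show ?case
    using a_nonneg less_imp_le[OF sphere_size_pos]
    by (auto intro!: infsum_nonneg mult_nonneg_nonneg simp: Ptrans_eq)
qed simp

lemma measure_planch: "measure (planch q) (space (planch q)) = 1"
proof -
  have "(\<integral>t. 1 \<partial>planch q) = (1 :: real)" using integral_sph_planch[OF q, of 0] q by simp
  then show ?thesis by simp
qed

lemma abs_integral_planch_le:
  fixes f :: "real \<Rightarrow> real"
  assumes [measurable]: "f \<in> borel_measurable arc_measure" and B: "\<And>t. 0 < t \<Longrightarrow> t < pi \<Longrightarrow> \<bar>f t\<bar> \<le> B"
  shows "integrable (planch q) f" "\<bar>\<integral>t. f t \<partial>planch q\<bar> \<le> B"
proof -
  interpret finite_measure "planch q" by (rule finite_measure_planch[OF q])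
  show int: "integrable (planch q) f"
    by (rule integrable_const_bound[of _ B]) (use B in \<open>auto intro!: AE_I2\<close>)
  have "\<bar>\<integral>t. f t \<partial>planch q\<bar> \<le> (\<integral>t. \<bar>f t\<bar> \<partial>planch q)" by (rule integral_abs_bound)
  also have "\<dots> \<le> (\<integral>t. B \<partial>planch q)"
    by (rule integral_mono) (use int B in auto)
  also have "\<dots> = B" using measure_planch by simp
  finally show "\<bar>\<integral>t. f t \<partial>planch q\<bar> \<le> B" .
qed

lemma abs_sph_ahat_le: "\<bar>sph q k t * ahat t ^ n\<bar> \<le> phi q k * rho ^ n"
  unfolding abs_mult power_abs
  by (intro mult_mono abs_sph_le_phi[OF q] power_mono abs_ahat_le) (use phi_pos[OF q, of k] in auto)

text \<open>For \<open>n = 0\<close> this is orthogonality. In the induction step the product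
  formula turns the sum over the sphere of radius \<open>d\<close> into a factor
  \<open>sph q d t\<close>, and the average over \<open>d\<close> supplies one more factor
  \<open>ahat t\<close>.\<close>

lemma pn_eq_integral:
  assumes y: "y \<in> tree_vertices q"
  shows "x \<in> tree_vertices q \<Longrightarrow>
    pn q a n x y = (\<integral>t. sph q (wdist x y) t * ahat t ^ n \<partial>planch q)"
proof (induction n arbitrary: x)
  case 0
  then show ?case by (simp add: integral_sph_planch[OF q])
next
  case (Suc n)
  note x = Suc.prems
  define k where "k = wdist x y"
  \<comment> \<open>A bound on \<open>phi\<close> independent of the distance makes
    \<open>pn q a n z y\<close> bounded uniformly in \<open>z\<close>, as
    \<open>infsum_Ptrans\<close> demands.\<close>
  obtain B where "\<And>d. (1 + real d ^ 4) * phi q d \<le> B" using phi_growth[OF q] by blast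
  then have B: "phi q d \<le> B" for d using phi_le_growth[of d] order.trans by blast
  have "pn q a n z y \<le> B * rho ^ n" if z: "z \<in> tree_vertices q" for z
  proof -
    have "\<bar>pn q a n z y\<bar> \<le> phi q (wdist z y) * rho ^ n"
      unfolding Suc.IH[OF z] by (rule abs_integral_planch_le) (use abs_sph_ahat_le in auto)
    also have "\<dots> \<le> B * rho ^ n" using B rho_pos by (intro mult_right_mono) auto
    finally show ?thesis by linarith
  qed
  then have sums1: "(\<lambda>d. a d / sphere_size q d * (\<Sum>z\<in>sphere_at q x d. pn q a n z y)) sums pn q a (Suc n) x y"
    unfolding pn.simps by (intro infsum_Ptrans[OF x]) (auto simp: pn_nonneg y)
  have integral_term: "a d / sphere_size q d * (\<Sum>z\<in>sphere_at q x d. pn q a n z y) =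
      (\<integral>t. a d * sph q d t * (sph q k t * ahat t ^ n) \<partial>planch q)" for d
  proof -
    have "(\<Sum>z\<in>sphere_at q x d. pn q a n z y) =
        (\<Sum>z\<in>sphere_at q x d. \<integral>t. sph q (wdist z y) t * ahat t ^ n \<partial>planch q)"
      by (rule sum.cong[OF refl]) (use Suc.IH in \<open>auto simp: sphere_at_def\<close>)
    also have "\<dots> = (\<integral>t. (\<Sum>z\<in>sphere_at q x d. sph q (wdist z y) t * ahat t ^ n) \<partial>planch q)"
      by (rule Bochner_Integration.integral_sum[symmetric])
        (rule abs_integral_planch_le, measurable, rule abs_sph_ahat_le)
    also have "\<dots> = (\<integral>t. sphere_size q d * (sph q d t * (sph q k t * ahat t ^ n)) \<partial>planch q)"
      unfolding sum_distrib_right[symmetric] sphere_sum_sph[OF q x y] k_def by (simp add: mult.assoc)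
    finally show ?thesis using sphere_size_pos[of d] by (simp add: mult.assoc)
  qed
  have "(\<lambda>d. \<integral>t. a d * sph q d t * (sph q k t * ahat t ^ n) \<partial>planch q) sums
      (\<integral>t. ahat t * (sph q k t * ahat t ^ n) \<partial>planch q)"
  proof (rule integral_sums_bounded[OF finite_measure_planch[OF q]])
    show "(\<lambda>d. a d * sph q d t * (sph q k t * ahat t ^ n)) sums (ahat t * (sph q k t * ahat t ^ n))" for t
      by (intro sums_mult2 ahat_sums)
    show "\<bar>\<Sum>d<m. a d * sph q d t * (sph q k t * ahat t ^ n)\<bar> \<le> rho * (phi q k * rho ^ n)" for m t
    proof -
      have "\<bar>\<Sum>d<m. a d * sph q d t\<bar> \<le> (\<Sum>d<m. a d * phi q d)"
      proof (rule order.trans[OF sum_abs sum_mono])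
        show "\<bar>a d * sph q d t\<bar> \<le> a d * phi q d" for d
          using a_nonneg[of d] abs_sph_le_phi[OF q, of d t] by (simp add: abs_mult mult_left_mono)
      qed
      also have "\<dots> \<le> rho"
        unfolding rho_def using a_nonneg less_imp_le[OF phi_pos[OF q]]
        by (intro sum_le_suminf summable_phi) auto
      finally show ?thesis
        unfolding sum_distrib_right[symmetric] abs_mult[of "sum _ _"]
        by (intro mult_mono abs_sph_ahat_le) (use rho_pos in auto)
    qed
  qed measurable
  then have "pn q a (Suc n) x y = (\<integral>t. ahat t * (sph q k t * ahat t ^ n) \<partial>planch q)"
    using sums1 unfolding integral_term by (rule sums_unique2[rotated])
  then show ?case by (simp add: k_def mult.left_commute)
qed

lemma measure_ahat_gt_pos: assumes "b < rho" shows "measure (planch q) {t \<in> space (planch q). ahat t > b} > 0"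
proof -
  interpret finite_measure "planch q" by (rule finite_measure_planch[OF q])
  let ?S = "{t \<in> space (planch q). ahat t > b}"
  have [measurable]: "?S \<in> sets arc_measure" unfolding space_planch space_arc[symmetric] by measurable
  \<comment> \<open>From \<open>1 - cos t < t^2\<close> and
    \<open>rho - ahat t \<le> kappa * (1 - cos t)\<close>, the value \<open>ahat t\<close> exceeds
    \<open>b\<close> as soon as \<open>t^2\<close> is at most
    \<open>(rho - b) / kappa\<close>.\<close>
  define r where "r = min pi (sqrt ((rho - b) / kappa))"
  have r: "r > 0" "r \<le> pi" using assms kappa_pos by (auto simp: r_def)
  have sub: "{0<..<r} \<subseteq> ?S"
  proof
    fix t assume t: "t \<in> {0<..<r}"
    have "1 - cos t = 2 * (sin (t / 2))\<^sup>2" using cos_double_sin[of "t / 2"] by simp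
    also have "\<dots> \<le> 2 * (t / 2)\<^sup>2"
      using abs_sin_x_le_abs_x[of "t / 2"] by (intro mult_left_mono) (simp_all only: abs_le_square_iff)
    also have "\<dots> < t\<^sup>2" using t by (simp add: power2_eq_square)
    also have "t\<^sup>2 \<le> (rho - b) / kappa"
    proof -
      have "t \<le> sqrt ((rho - b) / kappa)" using t by (simp add: r_def)
      then have "t\<^sup>2 \<le> (sqrt ((rho - b) / kappa))\<^sup>2" using t by (intro power_mono) auto
      then show ?thesis using assms kappa_pos by simp
    qed
    finally have "kappa * (1 - cos t) < rho - b" using kappa_pos by (simp add: less_divide_eq mult.commute)
    then show "t \<in> ?S" using rho_minus_ahat_le[of t] t r by auto
  qed
  \<comment> \<open>The density is strictly positive on the open arc, so a null set of
    \<open>planch q\<close> is Lebesgue null there, whereas \<open>?S\<close> contains an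
    interval.\<close>
  have "emeasure (planch q) ?S \<noteq> 0"
  proof
    assume "emeasure (planch q) ?S = 0"
    moreover have "?S \<in> sets (planch q)" unfolding sets_planch by measurable
    ultimately have "?S \<in> null_sets (planch q)" by (rule null_setsI)
    then have "AE t in arc_measure. t \<in> ?S \<longrightarrow> ennreal (planch_weight q t) = 0"
      unfolding planch_def using measurable_planch_weight[OF q] by (subst (asm) null_sets_density_iff) auto
    moreover have "AE t in arc_measure. t \<in> space arc_measure" by (rule AE_space)
    ultimately have "AE t in arc_measure. t \<notin> {0<..<r}"
    proof eventually_elim
      case (elim t)
      then show ?case using sub planch_weight_pos[OF q, of t] by (auto simp: subset_iff)
    qed
    then have "emeasure arc_measure {0<..<r} = 0"
      using r by (subst (asm) AE_iff_measurable[of "{0<..<r}"])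
        (auto simp: arc_measure_def sets_restrict_space_iff)
    moreover have "emeasure arc_measure {0<..<r} = ennreal r"
      using r unfolding arc_measure_def by (subst emeasure_restrict_space) auto
    ultimately show False using r by simp
  qed
  then show ?thesis by (simp add: emeasure_eq_measure zero_less_measure_iff)
qed

lemma ahat_power_concentration:
  fixes g :: "real \<Rightarrow> real"
  assumes [measurable]: "g \<in> borel_measurable arc_measure"
    and g: "\<And>t. \<bar>g t - g0\<bar> \<le> K * (1 - cos t)" and K: "K \<ge> 0"
  shows "(\<lambda>n. (\<integral>t. g t * ahat t ^ n \<partial>planch q) / (\<integral>t. ahat t ^ n \<partial>planch q)) \<longlonglongrightarrow> g0"
    and "\<forall>\<^sub>F n in sequentially. (\<integral>t. ahat t ^ n \<partial>planch q) > 0"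
proof -
  have gB: "\<bar>g t\<bar> \<le> \<bar>g0\<bar> + 2 * K" for t
  proof -
    have "K * (1 - cos t) \<le> K * 2" using K by (intro mult_left_mono) auto
    then show ?thesis using g[of t] by linarith
  qed
  obtain c where c: "c > 0" "\<And>t. c * (1 - cos t) \<le> rho - \<bar>ahat t\<bar>" using spectral_gap by blast
  have conc: "\<exists>b<rho. \<forall>t\<in>space (planch q). \<bar>ahat t\<bar> > b \<longrightarrow> ahat t > 0 \<and> \<bar>g t - g0\<bar> \<le> e" if "e > 0" for e
  \<comment> \<open>By the spectral gap, exceeding this threshold forces \<open>1 - cos t\<close>
    below the minimum. The first entry then keeps \<open>g\<close> within \<open>e\<close> of
    \<open>g0\<close>, the second makes \<open>ahat t\<close> positive; the added 1 covers
    \<open>K = 0\<close>.\<close>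
  proof (intro exI[of _ "rho - c * min (e / (K + 1)) (rho / (kappa + 1))"] conjI ballI impI)
    have m: "min (e / (K + 1)) (rho / (kappa + 1)) > 0"
      using K \<open>e > 0\<close> rho_pos kappa_pos by simp
    then show "rho - c * min (e / (K + 1)) (rho / (kappa + 1)) < rho" using c(1) by simp
    fix t assume "\<bar>ahat t\<bar> > rho - c * min (e / (K + 1)) (rho / (kappa + 1))"
    then have "c * (1 - cos t) < c * min (e / (K + 1)) (rho / (kappa + 1))" using c(2)[of t] by linarith
    then have v: "1 - cos t < e / (K + 1)" "1 - cos t < rho / (kappa + 1)" using c(1) by auto
    have "(kappa + 1) * (1 - cos t) < rho" using v(2) kappa_pos by (simp add: less_divide_eq mult.commute)
    moreover have "(kappa + 1) * (1 - cos t) = kappa * (1 - cos t) + (1 - cos t)" by (simp add: distrib_right)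
    ultimately show "ahat t > 0" using rho_minus_ahat_le[of t] cos_le_one[of t] by linarith
    have "(K + 1) * (1 - cos t) < e" using v(1) K by (simp add: less_divide_eq mult.commute)
    moreover have "(K + 1) * (1 - cos t) = K * (1 - cos t) + (1 - cos t)" by (simp add: distrib_right)
    ultimately show "\<bar>g t - g0\<bar> \<le> e" using g[of t] cos_le_one[of t] by linarith
  qed
  show "(\<lambda>n. (\<integral>t. g t * ahat t ^ n \<partial>planch q) / (\<integral>t. ahat t ^ n \<partial>planch q)) \<longlonglongrightarrow> g0"
    by (rule integral_power_concentration(1)[OF finite_measure_planch[OF q] _ _ rho_pos _ gB measure_ahat_gt_pos conc])
      (auto simp: abs_ahat_le)
  show "\<forall>\<^sub>F n in sequentially. (\<integral>t. ahat t ^ n \<partial>planch q) > 0"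
    by (rule integral_power_concentration(2)[OF finite_measure_planch[OF q] _ _ rho_pos _ gB measure_ahat_gt_pos conc])
      (auto simp: abs_ahat_le)
qed

section \<open>Ratio limits and the spectral radius\<close>

lemma pn_root_eq: "pn q a n [] [] = (\<integral>t. ahat t ^ n \<partial>planch q)"
  using pn_eq_integral[OF Nil_in_vertices Nil_in_vertices, of n] q by simp

lemma pn_ratio_tendsto:
  assumes "x \<in> tree_vertices q" "y \<in> tree_vertices q"
  shows "(\<lambda>n. pn q a n x y / pn q a n [] []) \<longlonglongrightarrow> phi q (tdist q x y)"
proof -
  have "\<bar>sph q k t - phi q k\<bar> \<le> sph_curv q k * (1 - cos t)" for k t
    using sph_second_order(1)[OF q, of k t] abs_sph_le_phi[OF q, of k t] by linarith
  from ahat_power_concentration(1)[OF measurable_sph this sph_curv_bounds(1)[OF q]] show ?thesis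
    unfolding pn_root_eq pn_eq_integral[OF assms(2,1)] tdist_eq_wdist[OF assms] .
qed

lemma pn_root_pos: "\<forall>\<^sub>F n in sequentially. pn q a n [] [] > 0"
  unfolding pn_root_eq
  by (rule ahat_power_concentration(2)[of "\<lambda>_. 0" 0 0]) auto

text \<open>The extra factor \<open>ahat\<close> plays the part of the test function
  \<open>g\<close>, whose value at the concentration point is \<open>rho\<close>.\<close>

lemma pn_root_ratio_tendsto: "(\<lambda>n. pn q a (Suc n) [] [] / pn q a n [] []) \<longlonglongrightarrow> rho"
  unfolding pn_root_eq power_Suc
proof (rule ahat_power_concentration(1)[OF measurable_ahat _ kappa_nonneg])
  show "\<bar>ahat t - rho\<bar> \<le> kappa * (1 - cos t)" for t
    using rho_minus_ahat_le[of t] abs_ahat_le[of t] by linarith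
qed

lemma pn_root_le: "pn q a n [] [] \<le> rho ^ n"
proof -
  have "\<bar>pn q a n [] []\<bar> \<le> rho ^ n"
    unfolding pn_root_eq
    by (rule abs_integral_planch_le(2)) (auto simp: power_abs intro!: power_mono abs_ahat_le)
  then show ?thesis by linarith
qed

text \<open>The upper bound comes from \<open>pn_root_le\<close>. For the lower one, consecutive
  quotients eventually exceed any \<open>b < rho\<close>, which forces growth of at least
  \<open>C * b ^ n\<close>, and the constant disappears under the root.\<close>

lemma root_pn_tendsto: "(\<lambda>n. root n (pn q a n [] [])) \<longlonglongrightarrow> rho"
proof (rule order_tendstoI)
  fix y assume "y > rho"
  show "\<forall>\<^sub>F n in sequentially. root n (pn q a n [] []) < y"
    using eventually_gt_at_top[of 0]
  proof eventually_elim
    case (elim n)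
    have "root n (pn q a n [] []) \<le> root n (rho ^ n)" using elim pn_root_le by (intro real_root_le_mono)
    also have "\<dots> = rho" using elim rho_pos by (simp add: real_root_power_cancel)
    finally show ?case using \<open>y > rho\<close> by simp
  qed
next
  fix y assume y: "y < rho"
  define b where "b = (max y 0 + rho) / 2"
  have b: "y < b" "0 < b" "b < rho" using y rho_pos by (auto simp: b_def)
  have "\<forall>\<^sub>F n in sequentially. pn q a (Suc n) [] [] / pn q a n [] [] > b \<and> pn q a n [] [] > 0"
    using order_tendstoD(1)[OF pn_root_ratio_tendsto b(3)] pn_root_pos by (rule eventually_conj)
  then obtain N where N: "\<And>n. n \<ge> N \<Longrightarrow> pn q a (Suc n) [] [] / pn q a n [] [] > b \<and> pn q a n [] [] > 0"
    unfolding eventually_sequentially by blast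
  define C where "C = pn q a N [] [] / b ^ N"
  have C: "C > 0" using N[of N] b by (simp add: C_def)
  have low: "C * b ^ n \<le> pn q a n [] []" if "n \<ge> N" for n
    using that
  proof (induction n rule: dec_induct)
    case base
    then show ?case using b by (simp add: C_def)
  next
    case (step n)
    have "C * b ^ Suc n = b * (C * b ^ n)" by simp
    also have "\<dots> \<le> b * pn q a n [] []" using step b by (intro mult_left_mono) auto
    also have "\<dots> \<le> pn q a (Suc n) [] []" 
    proof -
      have "b < pn q a (Suc n) [] [] / pn q a n [] []" "pn q a n [] [] > 0" using N[of n] step(1) by blast+
      then show ?thesis by (simp only: pos_less_divide_eq less_imp_le)
    qed
    finally show ?case .
  qed
  have "(\<lambda>n. root n C * b) \<longlonglongrightarrow> 1 * b" by (intro tendsto_mult_right LIMSEQ_root_const C)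
  then have "\<forall>\<^sub>F n in sequentially. y < root n C * b" using b(1) by (intro order_tendstoD(1)) auto
  then show "\<forall>\<^sub>F n in sequentially. y < root n (pn q a n [] [])"
    using eventually_gt_at_top[of 0] eventually_ge_at_top[of N]
  proof eventually_elim
    case (elim n)
    have "root n C * b = root n (C * b ^ n)"
      using elim b by (simp add: real_root_mult real_root_power_cancel)
    also have "\<dots> \<le> root n (pn q a n [] [])" using elim low by (intro real_root_le_mono)
    finally show ?case using elim by simp
  qed
qed

lemma spec_rad_eq: "spec_rad q a = rho"
proof -
  have "limsup (\<lambda>n. ereal (root n (pn q a n [] []))) = ereal rho"
    using root_pn_tendsto by (intro lim_imp_Limsup) auto
  then show ?thesis by (simp add: spec_rad_def)
qed

end

section \<open>The end compactification\<close>

lemma length_eray [simp]: "length (eray xi n) = n"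
  by (simp add: eray_def)

lemma eray_Suc: "eray xi (Suc n) = eray xi n @ [xi n]"
  by (simp add: eray_def)

lemma eray_add: "m \<le> n \<Longrightarrow> \<exists>z. eray xi n = eray xi m @ z"
  unfolding eray_def by (metis map_append upt_add_eq_append[of 0 m "n - m"] le0 le_add_diff_inverse)

lemma eray_prefix_vertex: "eray xi n = y @ z \<Longrightarrow> eray xi (length y) = y"
  by (metis append_eq_append_conv eray_add length_append length_eray le_add1)

lemma eray_in_vertices: "xi \<in> tree_ends q \<Longrightarrow> eray xi n \<in> tree_vertices q"
  by (auto simp: tree_ends_def tree_vertices_def eray_def)

text \<open>Being reduced is a condition on adjacent letters, hence on finite prefixes; in the
  compactness argument this recognises a constructed ray as an end.\<close>

lemma tree_ends_iff: "xi \<in> tree_ends q \<longleftrightarrow> (\<forall>n. eray xi n \<in> tree_vertices q)"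
proof
  assume A: "\<forall>n. eray xi n \<in> tree_vertices q"
  have "xi i \<le> q" for i
    using A[rule_format, of "Suc i"] unfolding eray_Suc snoc_in_vertices by simp
  moreover have "xi (Suc i) \<noteq> xi i" for i
    using A[rule_format, of "Suc (Suc i)"] unfolding eray_Suc snoc_in_vertices by simp
  ultimately show "xi \<in> tree_ends q" by (simp add: tree_ends_def)
qed (use eray_in_vertices in blast)

lemma Inl_in_cone: "Inl w \<in> cone q x \<longleftrightarrow> w \<in> tree_vertices q \<and> (\<exists>z. w = x @ z)"
  by (auto simp: cone_def)

lemma Inr_in_cone: "Inr xi \<in> cone q x \<longleftrightarrow> xi \<in> tree_ends q \<and> eray xi (length x) = x"
  by (auto simp: cone_def)

lemma cone_append_subset: "cone q (x @ y) \<subseteq> cone q x"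
proof
  fix w assume w: "w \<in> cone q (x @ y)"
  show "w \<in> cone q x"
  proof (cases w)
    case (Inl v)
    then show ?thesis using w by (auto simp: Inl_in_cone)
  next
    case (Inr xi)
    then have "eray xi (length (x @ y)) = x @ y" using w by (simp add: Inr_in_cone)
    then show ?thesis using w Inr eray_prefix_vertex[of xi _ x y] by (simp add: Inr_in_cone)
  qed
qed

lemma cone_eray_antimono: "m \<le> n \<Longrightarrow> cone q (eray xi n) \<subseteq> cone q (eray xi m)"
  using eray_add[of m n xi] cone_append_subset by metis

lemma topspace_end_top: "topspace (end_top q) = Inl ` tree_vertices q \<union> Inr ` tree_ends q"
proof -
  have "cone q [] = Inl ` tree_vertices q \<union> Inr ` tree_ends q"
    by (simp add: cone_def eray_def)
  moreover have "\<Union>({{Inl v} | v. v \<in> tree_vertices q} \<union> {cone q x | x. x \<in> tree_vertices q}) = cone q []"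
    (is "\<Union>?S = _")
  proof
    have "s \<subseteq> cone q []" if "s \<in> ?S" for s
      using that cone_append_subset[of q "[]"] by (auto simp: Inl_in_cone)
    then show "\<Union>?S \<subseteq> cone q []" by blast
    show "cone q [] \<subseteq> \<Union>?S" using Nil_in_vertices[of q] by blast
  qed
  ultimately show ?thesis
    unfolding end_top_def topology_generated_by_topspace by simp
qed

lemma openin_end_top_vertex: "v \<in> tree_vertices q \<Longrightarrow> openin (end_top q) {Inl v}"
  unfolding end_top_def by (rule topology_generated_by_Basis) blast

lemma openin_end_top_cone: "x \<in> tree_vertices q \<Longrightarrow> openin (end_top q) (cone q x)"
  unfolding end_top_def by (rule topology_generated_by_Basis) blast

text \<open>The topology is given by a subbasis, so this goes by induction on how \<open>U\<close>
  is generated. Among the generators only cones contain \<open>Inr xi\<close>, and the cones along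
  the ray are nested, which settles intersections.\<close>

lemma end_nhd_contains_cone:
  assumes "openin (end_top q) U" "Inr xi \<in> U"
  shows "\<exists>n. cone q (eray xi n) \<subseteq> U"
proof -
  have "generate_topology_on
     ({{Inl v} | v. v \<in> tree_vertices q} \<union> {cone q x | x. x \<in> tree_vertices q}) U"
    using assms(1) unfolding end_top_def by (rule openin_topology_generated_by)
  then show ?thesis using assms(2)
  proof induction
    case (Int a b)
    then obtain m n where "cone q (eray xi m) \<subseteq> a" "cone q (eray xi n) \<subseteq> b" by blast
    then have "cone q (eray xi (max m n)) \<subseteq> a \<inter> b"
      using cone_eray_antimono[of m "max m n" q xi] cone_eray_antimono[of n "max m n" q xi] by auto
    then show ?case ..
  next
    case (UN K)
    then show ?case by blast
  next
    case (Basis s)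
    then obtain x where "s = cone q x" by blast
    then have "cone q (eray xi (length x)) \<subseteq> s" using Basis(2) by (simp add: Inr_in_cone)
    then show ?case ..
  qed simp
qed

text \<open>Finite branching: finite subcovers for the child cones and one set around
  \<open>x\<close> combine to a finite subcover of the parent cone.\<close>

lemma cone_subset_children:
  "cone q x \<subseteq> insert (Inl x) (\<Union>c\<in>{c. c \<le> q \<and> x @ [c] \<in> tree_vertices q}. cone q (x @ [c]))"
proof
  fix w assume w: "w \<in> cone q x"
  show "w \<in> insert (Inl x) (\<Union>c\<in>{c. c \<le> q \<and> x @ [c] \<in> tree_vertices q}. cone q (x @ [c]))"
  proof (cases w)
    case (Inl v)
    then obtain z where z: "v = x @ z" "v \<in> tree_vertices q" using w by (auto simp: Inl_in_cone)
    show ?thesis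
    proof (cases z)
      case Nil
      then show ?thesis using Inl z by simp
    next
      case (Cons c z')
      then have "x @ [c] \<in> tree_vertices q"
        using z prefix_in_vertices[of "x @ [c]" z' q] by simp
      moreover from this have "c \<le> q" by (simp add: snoc_in_vertices)
      moreover have "Inl v \<in> cone q (x @ [c])" using z Cons by (auto simp: Inl_in_cone)
      ultimately show ?thesis using Inl by blast
    qed
  next
    case (Inr xi)
    then have xi: "xi \<in> tree_ends q" "eray xi (length x) = x" using w by (auto simp: Inr_in_cone)
    then have e: "eray xi (Suc (length x)) = x @ [xi (length x)]" by (simp add: eray_Suc)
    then have "x @ [xi (length x)] \<in> tree_vertices q" using eray_in_vertices[OF xi(1)] by metis
    moreover from this have "xi (length x) \<le> q" by (simp add: snoc_in_vertices)
    moreover have "Inr xi \<in> cone q (x @ [xi (length x)])" using e xi by (simp add: Inr_in_cone)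
    ultimately show ?thesis using Inr by blast
  qed
qed

text \<open>Koenig's lemma: a cone without a finite subcover has a child cone without one, and the
  resulting ray converges to an end that no member of the cover can contain.\<close>

lemma compact_space_end_top: "compact_space (end_top q)"
  unfolding compact_space_alt
proof (intro allI impI, elim conjE)
  fix C assume op: "Ball C (openin (end_top q))" and cov: "topspace (end_top q) \<subseteq> \<Union>C"
  define bad where "bad x \<longleftrightarrow> x \<in> tree_vertices q \<and> \<not> (\<exists>F. finite F \<and> F \<subseteq> C \<and> cone q x \<subseteq> \<Union>F)" for x
  have step: "\<exists>c. bad (x @ [c])" if "bad x" for x
  proof (rule ccontr)
    assume nb: "\<nexists>c. bad (x @ [c])"
    have xV: "x \<in> tree_vertices q" using that by (simp add: bad_def)
    let ?K = "{c. c \<le> q \<and> x @ [c] \<in> tree_vertices q}"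
    have "\<forall>c\<in>?K. \<exists>F. finite F \<and> F \<subseteq> C \<and> cone q (x @ [c]) \<subseteq> \<Union>F"
      using nb by (auto simp: bad_def)
    then obtain F where F: "\<And>c. c \<in> ?K \<Longrightarrow> finite (F c) \<and> F c \<subseteq> C \<and> cone q (x @ [c]) \<subseteq> \<Union>(F c)"
      by metis
    obtain W where W: "W \<in> C" "Inl x \<in> W"
      using cov xV unfolding topspace_end_top by blast
    have "finite ?K" by (rule finite_subset[of _ "{..q}"]) auto
    then have "finite (insert W (\<Union>c\<in>?K. F c))" using F by blast
    moreover have "insert W (\<Union>c\<in>?K. F c) \<subseteq> C" using W F by blast
    moreover have "cone q x \<subseteq> \<Union>(insert W (\<Union>c\<in>?K. F c))"
    proof
      fix w assume "w \<in> cone q x"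
      then have "w = Inl x \<or> (\<exists>c\<in>?K. w \<in> cone q (x @ [c]))"
        using subsetD[OF cone_subset_children, of w q x] by simp
      then show "w \<in> \<Union>(insert W (\<Union>c\<in>?K. F c))"
      proof
        assume "w = Inl x"
        then show ?thesis using W by simp
      next
        assume "\<exists>c\<in>?K. w \<in> cone q (x @ [c])"
        then obtain c where c: "c \<in> ?K" "w \<in> cone q (x @ [c])" by (rule bexE)
        then have "w \<in> \<Union>(F c)" using F[OF c(1)] by (meson subsetD)
        then obtain U where "U \<in> F c" "w \<in> U" by (rule UnionE)
        then show ?thesis using c(1) by (intro UnionI[of U]) auto
      qed
    qed
    ultimately show False using that unfolding bad_def by blast
  qed
  have "\<not> bad []"
  proof
    assume "bad []"
    \<comment> \<open>The clause for \<open>n = 0\<close> pins the start of the sequence to the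
      root, so that \<open>f n\<close> has length \<open>n\<close> and is the \<open>n\<close>-th
      vertex of a ray.\<close>
    have "\<exists>f. \<forall>n. (bad (f n) \<and> (n = 0 \<longrightarrow> f n = [])) \<and> (\<exists>c. f (Suc n) = f n @ [c])"
    proof (rule dependent_nat_choice)
      show "\<exists>x. bad x \<and> ((0::nat) = 0 \<longrightarrow> x = [])" using \<open>bad []\<close> by blast
      show "\<exists>y. (bad y \<and> (Suc n = 0 \<longrightarrow> y = [])) \<and> (\<exists>c. y = x @ [c])"
        if "bad x \<and> (n = 0 \<longrightarrow> x = [])" for x n
        using step[of x] that by blast
    qed
    then obtain f where f: "f 0 = []" "\<And>n. bad (f n)" "\<And>n. \<exists>c. f (Suc n) = f n @ [c]"
      by blast
    define xi where "xi n = last (f (Suc n))" for n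
    have er: "eray xi n = f n" for n
    proof (induction n)
      case 0
      then show ?case using f(1) by (simp add: eray_def)
    next
      case (Suc n)
      then show ?case using f(3)[of n] by (auto simp: eray_Suc xi_def)
    qed
    then have "xi \<in> tree_ends q" using f(2) by (simp add: tree_ends_iff bad_def)
    then obtain W where W: "W \<in> C" "Inr xi \<in> W"
      using cov unfolding topspace_end_top by blast
    then obtain n where "cone q (f n) \<subseteq> W" using end_nhd_contains_cone[of q W xi] op er by auto
    then have "finite {W} \<and> {W} \<subseteq> C \<and> cone q (f n) \<subseteq> \<Union>{W}" using W by simp
    then show False using f(2)[of n] unfolding bad_def by blast
  qed
  then obtain F where F: "finite F" "F \<subseteq> C" "cone q [] \<subseteq> \<Union>F" unfolding bad_def by auto
  moreover have "topspace (end_top q) = cone q []"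
    unfolding topspace_end_top by (simp add: cone_def eray_def)
  ultimately show "\<exists>F. finite F \<and> F \<subseteq> C \<and> topspace (end_top q) \<subseteq> \<Union>F" by auto
qed

lemma Hausdorff_space_end_top: "Hausdorff_space (end_top q)"
proof -
  have vert: "\<exists>U V. openin (end_top q) U \<and> openin (end_top q) V \<and> Inl v \<in> U \<and> w \<in> V \<and> disjnt U V"
    if v: "v \<in> tree_vertices q" and w: "w \<in> topspace (end_top q)" "w \<noteq> Inl v" for v w
  proof (cases w)
    case (Inl u)
    then show ?thesis
      using v w openin_end_top_vertex[of v q] openin_end_top_vertex[of u q]
      by (intro exI[of _ "{Inl v}"] exI[of _ "{Inl u}"]) (auto simp: topspace_end_top disjnt_def)
  next
    case (Inr xi)
    \<comment> \<open>Going one level deeper than \<open>v\<close> guarantees that the cone contains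
      only words longer than \<open>v\<close>.\<close>
    let ?V = "cone q (eray xi (Suc (length v)))"
    have xi: "xi \<in> tree_ends q" using Inr w by (auto simp: topspace_end_top)
    have "v \<noteq> eray xi (Suc (length v)) @ z" for z
      by (metis length_append length_eray not_add_less1 lessI)
    then have "Inl v \<notin> ?V" by (simp add: Inl_in_cone)
    moreover have "Inr xi \<in> ?V" using xi by (simp add: Inr_in_cone)
    ultimately show ?thesis
      using Inr openin_end_top_vertex[OF v] openin_end_top_cone[OF eray_in_vertices[OF xi]]
      by (intro exI[of _ "{Inl v}"] exI[of _ ?V]) auto
  qed
  have ends: "\<exists>U V. openin (end_top q) U \<and> openin (end_top q) V \<and> Inr xi \<in> U \<and> Inr eta \<in> V \<and> disjnt U V"
    if xi: "xi \<in> tree_ends q" and eta: "eta \<in> tree_ends q" and "xi \<noteq> eta" for xi eta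
  proof -
    obtain n where n: "xi n \<noteq> eta n" using \<open>xi \<noteq> eta\<close> by blast
    then have ne: "eray xi (Suc n) \<noteq> eray eta (Suc n)" by (simp add: eray_Suc)
    have "disjnt (cone q (eray xi (Suc n))) (cone q (eray eta (Suc n)))"
    proof -
      have False if "w \<in> cone q (eray xi (Suc n))" "w \<in> cone q (eray eta (Suc n))" for w
      proof (cases w)
        case (Inl u)
        then obtain y z where "u = eray xi (Suc n) @ y" "u = eray eta (Suc n) @ z"
          using \<open>w \<in> cone q (eray xi (Suc n))\<close> \<open>w \<in> cone q (eray eta (Suc n))\<close>
          by (auto simp: Inl_in_cone)
        then show False using ne by (metis append_eq_append_conv length_eray)
      next
        case (Inr u)
        then show False
          using \<open>w \<in> cone q (eray xi (Suc n))\<close> \<open>w \<in> cone q (eray eta (Suc n))\<close> ne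
          by (auto simp: Inr_in_cone)
      qed
      then show ?thesis by (auto simp: disjnt_def)
    qed
    moreover have "Inr xi \<in> cone q (eray xi (Suc n))" "Inr eta \<in> cone q (eray eta (Suc n))"
      using xi eta by (auto simp: Inr_in_cone)
    ultimately show ?thesis
      using openin_end_top_cone[OF eray_in_vertices[OF xi]] openin_end_top_cone[OF eray_in_vertices[OF eta]]
      by blast
  qed
  show ?thesis
    unfolding Hausdorff_space_def
  proof (intro allI impI, elim conjE)
    fix v w assume v: "v \<in> topspace (end_top q)" and w: "w \<in> topspace (end_top q)" and "v \<noteq> w"
    show "\<exists>U V. openin (end_top q) U \<and> openin (end_top q) V \<and> v \<in> U \<and> w \<in> V \<and> disjnt U V"
    proof (cases v)
      case (Inl v')
      then show ?thesis using vert[of v' w] v w \<open>v \<noteq> w\<close> by (auto simp: topspace_end_top)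
    next
      case v': (Inr xi)
      show ?thesis
      proof (cases w)
        case (Inl w')
        then obtain U V where "openin (end_top q) U" "openin (end_top q) V" "w \<in> U" "v \<in> V" "disjnt U V"
          using vert[of w' v] v w \<open>v \<noteq> w\<close> unfolding topspace_end_top by blast
        then show ?thesis using disjnt_sym by blast
      next
        case (Inr eta)
        then show ?thesis using ends[of xi eta] v' v w \<open>v \<noteq> w\<close> by (auto simp: topspace_end_top)
      qed
    qed
  qed
qed

lemma vertices_dense_end_top: "end_top q closure_of (Inl ` tree_vertices q) = topspace (end_top q)"
proof (intro equalityI closure_of_subset_topspace subsetI)
  fix w assume w: "w \<in> topspace (end_top q)"
  have "\<exists>y. y \<in> Inl ` tree_vertices q \<and> y \<in> T" if T: "w \<in> T" "openin (end_top q) T" for T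
  proof (cases w)
    case (Inl v)
    then show ?thesis using T w by (auto simp: topspace_end_top)
  next
    case (Inr xi)
    then obtain n where "cone q (eray xi n) \<subseteq> T" using end_nhd_contains_cone T by blast
    moreover have "xi \<in> tree_ends q" using w Inr by (auto simp: topspace_end_top)
    ultimately have "Inl (eray xi n) \<in> T \<and> eray xi n \<in> tree_vertices q"
      using eray_in_vertices by (auto simp: Inl_in_cone)
    then show ?thesis by blast
  qed
  then show "w \<in> end_top q closure_of (Inl ` tree_vertices q)" using w by (auto simp: in_closure_of)
qed

text \<open>Vertices are isolated and the cones along a ray form a neighbourhood basis of its end,
  so continuity is an epsilon condition at the ends alone.\<close>

lemma continuous_map_end_topI:
  fixes f :: "nat list + (nat \<Rightarrow> nat) \<Rightarrow> real"
  assumes "\<And>xi e. xi \<in> tree_ends q \<Longrightarrow> e > 0 \<Longrightarrow> \<exists>n. \<forall>w\<in>cone q (eray xi n). \<bar>f w - f (Inr xi)\<bar> < e"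
  shows "continuous_map (end_top q) euclideanreal f"
  unfolding continuous_map_def
proof (intro conjI allI impI)
  fix U :: "real set" assume U: "openin euclideanreal U"
  show "openin (end_top q) {x \<in> topspace (end_top q). f x \<in> U}"
  proof (subst openin_subopen, intro ballI)
    fix w assume w: "w \<in> {x \<in> topspace (end_top q). f x \<in> U}"
    show "\<exists>T. openin (end_top q) T \<and> w \<in> T \<and> T \<subseteq> {x \<in> topspace (end_top q). f x \<in> U}"
    proof (cases w)
      case (Inl v)
      then show ?thesis using w openin_end_top_vertex[of v q]
        by (intro exI[of _ "{w}"]) (auto simp: topspace_end_top)
    next
      case (Inr xi)
      then have xi: "xi \<in> tree_ends q" and "f w \<in> U" using w by (auto simp: topspace_end_top)
      obtain e where e: "e > 0" "\<And>y. \<bar>y - f w\<bar> < e \<Longrightarrow> y \<in> U"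
        using U \<open>f w \<in> U\<close> open_dist[of U] by (auto simp: dist_real_def)
      obtain n where "\<forall>w\<in>cone q (eray xi n). \<bar>f w - f (Inr xi)\<bar> < e"
        using assms[OF xi e(1)] by blast
      then have "cone q (eray xi n) \<subseteq> {x \<in> topspace (end_top q). f x \<in> U}"
        using e(2) Inr openin_subset[OF openin_end_top_cone[OF eray_in_vertices[OF xi]]] by blast
      moreover have "w \<in> cone q (eray xi n)" using Inr xi by (simp add: Inr_in_cone)
      ultimately show ?thesis using openin_end_top_cone[OF eray_in_vertices[OF xi]] by blast
    qed
  qed
qed simp

text \<open>Once the ray is at least as long as \<open>x\<close>, its common prefix with
  \<open>x\<close> no longer changes. So d(x,w) - |w| is the same for all vertices of the cone, and
  this constant is the horocycle index.\<close>

lemma wdist_cone_eray: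
  assumes "length x \<le> n"
  shows "int (wdist x (eray xi n @ z)) =
    int (n + length z) + (int (length x) - 2 * int (cpl x (eray xi (length x))))"
proof -
  obtain z' where "eray xi n = eray xi (length x) @ z'" using eray_add[OF assms] by blast
  then have "cpl x (eray xi n @ z) = cpl x (eray xi (length x))"
    by (simp add: cpl_append)
  then show ?thesis by (simp add: wdist_int)
qed

lemma hor_eq:
  assumes "x \<in> tree_vertices q" "xi \<in> tree_ends q"
  shows "hor q x xi = real (length x) - 2 * real (cpl x (eray xi (length x)))"
  unfolding hor_def
proof (rule limI, rule tendsto_eventually, rule eventually_sequentiallyI)
  fix n assume "length x \<le> n"
  then have "int (wdist x (eray xi n)) = int n + (int (length x) - 2 * int (cpl x (eray xi (length x))))"
    using wdist_cone_eray[of x n xi "[]"] by simp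
  then have "real (wdist x (eray xi n)) = real n + (real (length x) - 2 * real (cpl x (eray xi (length x))))"
    by linarith
  then show "real (tdist q x (eray xi n)) - real (tdist q [] (eray xi n)) =
    real (length x) - 2 * real (cpl x (eray xi (length x)))"
    using assms by (simp add: tdist_eq_wdist eray_in_vertices)
qed

lemma hor_separates_ends:
  assumes xi: "xi \<in> tree_ends q" and eta: "eta \<in> tree_ends q" and "xi \<noteq> eta"
  shows "\<exists>x\<in>tree_vertices q. hor q x xi \<noteq> hor q x eta"
proof -
  obtain n where n: "xi n \<noteq> eta n" using \<open>xi \<noteq> eta\<close> by blast
  \<comment> \<open>Just past the point where the ends diverge: at this vertex of its own ray
    \<open>xi\<close> has index \<open>-(n + 1)\<close>, while \<open>eta\<close> shares a shorter
    prefix and so has a larger index.\<close>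
  let ?x = "eray xi (Suc n)"
  have x: "?x \<in> tree_vertices q" using eray_in_vertices[OF xi] .
  have "cpl ?x (eray eta (Suc n)) \<noteq> Suc n"
  proof
    assume "cpl ?x (eray eta (Suc n)) = Suc n"
    then obtain z where "eray eta (Suc n) = ?x @ z"
      using cpl_eq_length_iff[of ?x "eray eta (Suc n)"] by auto
    then have "eray eta (Suc n) = ?x" using eray_prefix_vertex[of eta "Suc n" ?x z] by simp
    then show False using n by (simp add: eray_Suc)
  qed
  then have "hor q ?x xi \<noteq> hor q ?x eta"
    using hor_eq[OF x xi] hor_eq[OF x eta] by simp
  then show ?thesis using x by blast
qed

lemma ratio_shift_tendsto:
  fixes g :: "nat \<Rightarrow> real"
  assumes pos: "\<And>m. g m > 0" and lim: "(\<lambda>m. g (Suc m) / g m) \<longlonglongrightarrow> r"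
  shows "(\<lambda>m. g (m + a) / g m) \<longlonglongrightarrow> r ^ a"
proof (induction a)
  have nz: "g m \<noteq> 0" for m using pos[of m] by simp
  case 0
  then show ?case by (simp add: nz)
next
  have nz: "g m \<noteq> 0" for m using pos[of m] by simp
  case (Suc a)
  have "(\<lambda>m. (g (Suc (m + a)) / g (m + a)) * (g (m + a) / g m)) \<longlonglongrightarrow> r * r ^ a"
    by (intro tendsto_mult Suc LIMSEQ_ignore_initial_segment[OF lim])
  moreover have "(g (Suc (m + a)) / g (m + a)) * (g (m + a) / g m) = g (m + Suc a) / g m" for m
    using nz by simp
  ultimately show ?case by (simp only: power_Suc)
qed

text \<open>On a deep cone the kernel is \<open>g (m + h) / g m\<close> with \<open>m = |y|\<close>
  and the fixed shift \<open>h = hor q x xi\<close>; the ratio hypothesis sends this to the power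
  \<open>h\<close> of \<open>q^(-1/2)\<close>. The topological properties do not involve
  \<open>g\<close>, so both kernels are instances.\<close>

lemma kernel_compactification_end_top:
  fixes g :: "nat \<Rightarrow> real"
  assumes q: "q \<ge> 2" and pos: "\<And>m. g m > 0"
    and lim: "(\<lambda>m. g (Suc m) / g m) \<longlonglongrightarrow> real q powr (- 1 / 2)"
    and Kern: "\<And>x y. x \<in> tree_vertices q \<Longrightarrow> y \<in> tree_vertices q \<Longrightarrow>
      Kern x y = g (tdist q x y) / g (tdist q [] y)"
  shows "kernel_compactification (tree_vertices q) Kern (end_top q)
    (\<lambda>x w. case w of Inl y \<Rightarrow> Kern x y | Inr xi \<Rightarrow> real q powr (- hor q x xi / 2))"
    (is "kernel_compactification _ _ _ ?K")
proof -
  have cont: "continuous_map (end_top q) euclideanreal (?K x)" if x: "x \<in> tree_vertices q" for x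
  proof (rule continuous_map_end_topI)
    fix xi and e :: real assume xi: "xi \<in> tree_ends q" and "e > 0"
    define c where "c = cpl x (eray xi (length x))"
    have "c \<le> length x" unfolding c_def by (rule cpl_le)
    define r where "r = real q powr (- 1 / 2)"
    have "r > 0" using q by (simp add: r_def)
    \<comment> \<open>The shift \<open>length x - 2 * c\<close> may be negative; evaluating at
      \<open>m + 2 * c\<close> leaves only forward shifts, and \<open>LIMSEQ_offset\<close> undoes
      the translation.\<close>
    have "(\<lambda>m. (g (m + length x) / g m) / (g (m + 2 * c) / g m)) \<longlonglongrightarrow> r ^ length x / r ^ (2 * c)"
      using \<open>r > 0\<close> unfolding r_def by (intro tendsto_divide ratio_shift_tendsto pos lim) auto
    moreover have "r ^ length x / r ^ (2 * c) = real q powr (- hor q x xi / 2)"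
    proof -
      have "r ^ n = real q powr (- real n / 2)" for n
        using q by (simp add: r_def powr_realpow[symmetric] powr_powr)
      then show ?thesis using hor_eq[OF x xi]
        by (simp add: c_def powr_diff[symmetric]) (simp add: field_simps)
    qed
    moreover have "(g (m + length x) / g m) / (g (m + 2 * c) / g m) =
        g (nat (int (m + 2 * c) + (int (length x) - 2 * int c))) / g (m + 2 * c)" for m
    proof -
      have "nat (int (m + 2 * c) + (int (length x) - 2 * int c)) = m + length x" by simp
      then show ?thesis using pos[of m] by (simp only:) simp
    qed
    ultimately have "(\<lambda>m. g (nat (int (m + 2 * c) + (int (length x) - 2 * int c))) / g (m + 2 * c))
       \<longlonglongrightarrow> real q powr (- hor q x xi / 2)" by (simp only:)
    then have "(\<lambda>m. g (nat (int m + (int (length x) - 2 * int c))) / g m)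
       \<longlonglongrightarrow> real q powr (- hor q x xi / 2)" by (rule LIMSEQ_offset)
    then obtain N where N: "\<And>m. m \<ge> N \<Longrightarrow>
      \<bar>g (nat (int m + (int (length x) - 2 * int c))) / g m - real q powr (- hor q x xi / 2)\<bar> < e"
      using \<open>e > 0\<close> unfolding LIMSEQ_iff by (auto simp: real_norm_def)
    define n where "n = max N (length x)"
    have "\<bar>?K x w - ?K x (Inr xi)\<bar> < e" if w: "w \<in> cone q (eray xi n)" for w
    proof (cases w)
      case (Inl y)
      then obtain z where y: "y \<in> tree_vertices q" "y = eray xi n @ z"
        using w by (auto simp: Inl_in_cone)
      have "int (wdist x y) = int (length y) + (int (length x) - 2 * int c)"
        using wdist_cone_eray[of x n xi z] y by (simp add: n_def c_def)
      then have "wdist x y = nat (int (length y) + (int (length x) - 2 * int c))" by simp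
      moreover have "length y \<ge> N" using y by (simp add: n_def)
      ultimately show ?thesis using N[of "length y"] Inl Kern[OF x y(1)] x y(1)
        by (simp add: tdist_eq_wdist)
    next
      \<comment> \<open>For another end in the cone no limit is involved: both rays agree beyond
        \<open>length x\<close>, so their horocycle indices at \<open>x\<close> coincide.\<close>
      case (Inr eta)
      then have eta: "eta \<in> tree_ends q" "eray eta n = eray xi n" using w by (auto simp: Inr_in_cone)
      obtain z where "eray xi n = eray xi (length x) @ z"
        using eray_add[of "length x" n xi] by (auto simp: n_def)
      then have "eray eta (length x) = eray xi (length x)"
        using eray_prefix_vertex[of eta n "eray xi (length x)" z] eta by simp
      then have "hor q x eta = hor q x xi" using hor_eq[OF x xi] hor_eq[OF x eta(1)] by simp
      then show ?thesis using Inr \<open>e > 0\<close> by simp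
    qed
    then show "\<exists>n. \<forall>w\<in>cone q (eray xi n). \<bar>?K x w - ?K x (Inr xi)\<bar> < e" by blast
  qed
  have sep: "\<exists>x\<in>tree_vertices q. ?K x v \<noteq> ?K x w"
    if vw: "v \<in> topspace (end_top q) - Inl ` tree_vertices q"
       "w \<in> topspace (end_top q) - Inl ` tree_vertices q" "v \<noteq> w" for v w
  proof -
    obtain xi eta where *: "v = Inr xi" "w = Inr eta" "xi \<in> tree_ends q" "eta \<in> tree_ends q"
      using vw unfolding topspace_end_top by blast
    then obtain x where "x \<in> tree_vertices q" "hor q x xi \<noteq> hor q x eta"
      using hor_separates_ends[of xi q eta] vw(3) by blast
    then show ?thesis using * q by (intro bexI[of _ x]) (auto simp: powr_inj)
  qed
  show ?thesis
    unfolding kernel_compactification_def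
  proof (intro conjI ballI impI)
    show "Inl ` tree_vertices q \<subseteq> topspace (end_top q)" by (simp add: topspace_end_top)
    show "continuous_map (end_top q) euclideanreal (?K x)" if "x \<in> tree_vertices q" for x
      using cont[OF that] .
  qed (simp_all add: compact_space_end_top Hausdorff_space_end_top vertices_dense_end_top
      openin_end_top_vertex cont sep)
qed

section \<open>The Green function at the spectral radius\<close>

context radial_walk
begin

text \<open>What remains beside \<open>sin_comb\<close> after summing the geometric series in
  \<open>ahat t / rho\<close>, up to a constant. Since \<open>rho - ahat t\<close> is of order
  \<open>t^2\<close>, it has a simple pole at 0.\<close>

definition green_density :: "real \<Rightarrow> real" where
  "green_density t = sin t / (planch_den q t * (rho - ahat t))"

definition green_radial :: "nat \<Rightarrow> real" where
  "green_radial k = 2 * rho / pi * real q powr (- real k / 2) *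
     (\<integral>t. sin_comb q k t * green_density t \<partial>arc_measure)"

lemma one_minus_cos_pos: "0 < t \<Longrightarrow> t < pi \<Longrightarrow> 0 < 1 - cos t"
  using cos_monotone_0_pi[of 0 t] by simp

lemma rho_minus_ahat_pos: assumes "0 < t" "t < pi" shows "\<bar>ahat t\<bar> < rho"
proof -
  obtain c where "c > 0" "c * (1 - cos t) \<le> rho - \<bar>ahat t\<bar>" using spectral_gap by blast
  moreover from this have "0 < c * (1 - cos t)" using one_minus_cos_pos[OF assms] by simp
  ultimately show ?thesis by linarith
qed

lemma measurable_planch_den [measurable]: "planch_den q \<in> borel_measurable arc_measure"
  by (rule continuous_imp_measurable_arc continuous_planch_den)+

lemma measurable_sin_comb [measurable]: "sin_comb q k \<in> borel_measurable arc_measure"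
  by (rule continuous_imp_measurable_arc continuous_sin_comb)+

lemma measurable_sin_arc [measurable]: "sin \<in> borel_measurable arc_measure" "cos \<in> borel_measurable arc_measure"
  by (intro continuous_imp_measurable_arc continuous_intros)+

lemma measurable_green_density [measurable]: "green_density \<in> borel_measurable arc_measure"
  unfolding green_density_def[abs_def] by measurable

lemma sin_squared_le: "(sin t)\<^sup>2 \<le> 2 * (1 - cos t)" for t :: real
proof -
  have "(sin t)\<^sup>2 = (1 + cos t) * (1 - cos t)"
    unfolding sin_squared_eq by (simp add: power2_eq_square algebra_simps)
  also have "\<dots> \<le> 2 * (1 - cos t)" by (rule mult_right_mono) auto
  finally show ?thesis .
qed

text \<open>The weight is at most a multiple of \<open>1 - cos t\<close>, and by the spectral gap
  the geometric partial sums are at most a multiple of \<open>1 / (1 - cos t)\<close>. The product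
  is bounded uniformly in \<open>t\<close> and \<open>n\<close>, so summation and integration may be
  exchanged.\<close>

lemma green_sums:
  assumes x: "x \<in> tree_vertices q" and y: "y \<in> tree_vertices q"
  shows "(\<lambda>n. pn q a n x y * (1 / rho) ^ n) sums green_radial (wdist x y)"
proof -
  define k where "k = wdist x y"
  define u where "u t = ahat t / rho" for t
  have [measurable]: "u \<in> borel_measurable arc_measure" unfolding u_def[abs_def] by measurable
  obtain c where c: "c > 0" "\<And>t. c * (1 - cos t) \<le> rho - \<bar>ahat t\<bar>" using spectral_gap by blast
  define E0 where "E0 = planch_den q 0"
  have E0: "E0 > 0" unfolding E0_def by (rule planch_den_bounds(1)[OF q])
  have u1: "\<bar>u t\<bar> < 1" if "0 < t" "t < pi" for t
    using rho_minus_ahat_pos[OF that] rho_pos by (simp add: u_def)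
  have eq: "pn q a n x y * (1 / rho) ^ n = (\<integral>t. planch_weight q t * sph q k t * u t ^ n \<partial>arc_measure)" for n
  proof -
    have "pn q a n x y = (\<integral>t. planch_weight q t * (sph q k t * ahat t ^ n) \<partial>arc_measure)"
      unfolding pn_eq_integral[OF y x] k_def by (rule integral_planch[OF q]) measurable
    then have "pn q a n x y * (1 / rho) ^ n = (\<integral>t. planch_weight q t * (sph q k t * ahat t ^ n) * (1 / rho) ^ n \<partial>arc_measure)"
      by (simp only: integral_mult_left_zero)
    also have "\<dots> = (\<integral>t. planch_weight q t * sph q k t * u t ^ n \<partial>arc_measure)"
      by (simp add: u_def power_divide mult.assoc)
    finally show ?thesis .
  qed
  have "(\<lambda>n. \<integral>t. planch_weight q t * sph q k t * u t ^ n \<partial>arc_measure) sums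
    (\<integral>t. 2 * rho / pi * real q powr (- real k / 2) * (sin_comb q k t * green_density t) \<partial>arc_measure)"
  proof (rule integral_sums_bounded[OF finite_measure_arc])
    show "(\<lambda>t. planch_weight q t * sph q k t * u t ^ n) \<in> borel_measurable arc_measure" for n
      using measurable_planch_weight[OF q] by measurable
    fix t assume "t \<in> space arc_measure"
    then have t: "0 < t" "t < pi" by auto
    have "(\<lambda>n. planch_weight q t * sph q k t * u t ^ n) sums (planch_weight q t * sph q k t * (1 / (1 - u t)))"
      using u1[OF t] by (intro sums_mult geometric_sums) simp
    moreover have "1 / (1 - u t) = rho / (rho - ahat t)"
      using rho_pos rho_minus_ahat_pos[OF t] by (simp add: u_def field_simps)
    ultimately show "(\<lambda>n. planch_weight q t * sph q k t * u t ^ n) sums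
        (2 * rho / pi * real q powr (- real k / 2) * (sin_comb q k t * green_density t))"
      unfolding planch_weight_sph[OF q] by (simp add: green_density_def mult_ac)
    fix n
    have v: "1 - cos t > 0" by (rule one_minus_cos_pos[OF t])
    have "(\<Sum>i<n. \<bar>u t\<bar> ^ i) \<le> 1 / (1 - \<bar>u t\<bar>)"
      using sum_le_suminf[of "\<lambda>i. \<bar>u t\<bar> ^ i" "{..<n}"] u1[OF t]
      by (simp add: summable_geometric suminf_geometric)
    also have "\<dots> = rho / (rho - \<bar>ahat t\<bar>)"
      using rho_pos rho_minus_ahat_pos[OF t] by (simp add: u_def field_simps)
    also have "\<dots> \<le> rho / (c * (1 - cos t))"
      using c rho_pos v by (intro divide_left_mono mult_pos_pos) (auto simp: rho_minus_ahat_pos[OF t])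
    finally have geo: "(\<Sum>i<n. \<bar>u t\<bar> ^ i) \<le> rho / (c * (1 - cos t))" .
    have "planch_weight q t \<le> 4 / (pi * E0) * (2 * (1 - cos t))"
      unfolding E0_def by (rule order.trans[OF planch_weight_le[OF q] mult_left_mono[OF sin_squared_le]])
        (use E0 in \<open>simp add: E0_def\<close>)
    then have w: "\<bar>planch_weight q t * sph q k t\<bar> \<le> 8 / (pi * E0) * (1 - cos t) * phi q k"
      unfolding abs_mult using planch_weight_nonneg[OF q, of t] abs_sph_le_phi[OF q, of k t] v E0
      by (intro mult_mono) auto
    have "\<bar>\<Sum>i<n. planch_weight q t * sph q k t * u t ^ i\<bar> = \<bar>planch_weight q t * sph q k t\<bar> * \<bar>\<Sum>i<n. u t ^ i\<bar>"
      by (simp add: sum_distrib_left[symmetric] abs_mult)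
    also have "\<dots> \<le> (8 / (pi * E0) * (1 - cos t) * phi q k) * (rho / (c * (1 - cos t)))"
    proof (rule mult_mono[OF w])
      show "\<bar>\<Sum>i<n. u t ^ i\<bar> \<le> rho / (c * (1 - cos t))"
        using geo sum_abs[of "\<lambda>i. u t ^ i" "{..<n}"] by (simp add: power_abs)
      show "0 \<le> 8 / (pi * E0) * (1 - cos t) * phi q k"
        using v E0 phi_pos[OF q, of k] by simp
    qed simp
    also have "\<dots> = 8 / (pi * E0) * phi q k * rho / c"
    proof -
      have "A * w * p * (rho / (c * w)) = A * p * rho / c" if "w \<noteq> 0" for A w p :: real
        using that by simp
      then show ?thesis using v by (metis less_irrefl)
    qed
    finally show "\<bar>\<Sum>i<n. planch_weight q t * sph q k t * u t ^ i\<bar> \<le> 8 / (pi * E0) * phi q k * rho / c" .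
  qed measurable
  then show ?thesis
    unfolding eq green_radial_def k_def integral_mult_right_zero .
qed

lemma green_eq:
  assumes "x \<in> tree_vertices q" "y \<in> tree_vertices q"
  shows "green q a x y (1 / spec_rad q a) = green_radial (tdist q x y)"
  unfolding green_def spec_rad_eq tdist_eq_wdist[OF assms]
  using sums_unique[OF green_sums[OF assms]] by simp

text \<open>All terms of the Green series are nonnegative, and the positive ratio limit shows that
  some \<open>p^(n)(e,y)\<close> is nonzero. The vertex \<open>y\<close> exists because spheres have
  positive size.\<close>

lemma green_radial_pos: "green_radial k > 0"
proof -
  have "real (card (sphere_at q [] k)) > 0"
    unfolding card_sphere_at[OF Nil_in_vertices] by (rule sphere_size_pos)
  then have "card (sphere_at q [] k) \<noteq> 0" by simp
  then have "sphere_at q [] k \<noteq> {}" by (metis card.empty)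
  then obtain y where y: "y \<in> tree_vertices q" "wdist [] y = k" unfolding sphere_at_def by blast
  have "\<forall>\<^sub>F n in sequentially. pn q a n [] y / pn q a n [] [] > 0"
    using pn_ratio_tendsto[OF Nil_in_vertices y(1)] phi_pos[OF q] by (rule order_tendstoD(1))
  then obtain n where "pn q a n [] y / pn q a n [] [] > 0"
    unfolding eventually_sequentially by blast
  then have "pn q a n [] y \<noteq> 0" by (metis div_0 less_irrefl)
  then have "pn q a n [] y > 0" using pn_nonneg[OF Nil_in_vertices y(1), of n] by linarith
  then have n: "pn q a n [] y * (1 / rho) ^ n > 0"
    using rho_pos by (intro mult_pos_pos zero_less_power) simp_all
  have s: "(\<lambda>n. pn q a n [] y * (1 / rho) ^ n) sums green_radial k"
    using green_sums[OF Nil_in_vertices y(1)] y(2) by simp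
  have "sum (\<lambda>n. pn q a n [] y * (1 / rho) ^ n) {n} \<le> (\<Sum>n. pn q a n [] y * (1 / rho) ^ n)"
    using pn_nonneg[OF Nil_in_vertices y(1)] rho_pos
    by (intro sum_le_suminf sums_summable[OF s]) auto
  then show ?thesis using n sums_unique[OF s] by simp
qed

text \<open>Near \<open>t = 0\<close> the density is a multiple of \<open>cot (t / 2)\<close> up to a bounded error; the
  former contributes a constant to every sine coefficient, the latter nothing in the limit.\<close>

lemma green_density_remainder:
  "\<exists>B. \<forall>t. 0 < t \<longrightarrow> t < pi \<longrightarrow>
    \<bar>green_density t - sin t / (1 - cos t) / (planch_den q 0 * kappa)\<bar> \<le> B"
proof -
  obtain c where c: "c > 0" "\<And>t. c * (1 - cos t) \<le> rho - \<bar>ahat t\<bar>" using spectral_gap by blast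
  obtain C where C: "C \<ge> 0" "\<And>t. kappa * (1 - cos t) - (rho - ahat t) \<le> C * (1 - cos t)\<^sup>2"
    using rho_minus_ahat_ge by blast
  define E0 where "E0 = planch_den q 0"
  have E0: "E0 > 0" unfolding E0_def by (rule planch_den_bounds(1)[OF q])
  have "\<bar>green_density t - sin t / (1 - cos t) / (E0 * kappa)\<bar> \<le> (E0 * C + 8 * kappa) / (E0 * c * (E0 * kappa))"
    if t: "0 < t" "t < pi" for t
  proof -
    define v where "v = 1 - cos t"
    define D where "D = rho - ahat t"
    define E where "E = planch_den q t"
    have v: "v > 0" unfolding v_def by (rule one_minus_cos_pos[OF t])
    have D: "c * v \<le> D" "D \<le> kappa * v" "kappa * v - D \<le> C * v\<^sup>2"
      using c(2)[of t] rho_minus_ahat_le[of t] C(2)[of t] by (auto simp: v_def D_def)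
    have D0: "D > 0" using D(1) mult_pos_pos[OF c(1) v] by linarith
    have E: "E0 \<le> E" "E \<le> E0 + 8 * v" "E > 0"
      using planch_den_bounds(2,3,4)[OF q, of t] by (auto simp: E_def E0_def v_def)
    have "green_density t - sin t / (1 - cos t) / (E0 * kappa) =
        sin t * ((E0 * (kappa * v - D) - (E - E0) * D) / (E * D * (E0 * kappa * v)))"
    proof -
      have "1 / (E * D) - 1 / (v * (E0 * kappa)) = (E0 * (kappa * v - D) - (E - E0) * D) / (E * D * (E0 * kappa * v))"
        using E E0 D0 v kappa_pos by (simp add: divide_simps) (simp add: algebra_simps)
      moreover have "green_density t - sin t / (1 - cos t) / (E0 * kappa) = sin t * (1 / (E * D) - 1 / (v * (E0 * kappa)))"
        by (simp add: green_density_def v_def D_def E_def right_diff_distrib)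
      ultimately show ?thesis by simp
    qed
    \<comment> \<open>Both parts of the numerator are of order \<open>v^2\<close>:
      \<open>kappa * v - D\<close> by the second-order estimate, and \<open>(E - E0) * D\<close>
      because each factor is of order \<open>v\<close>. This cancels the \<open>v^2\<close> in the
      denominator.\<close>
    also have "\<bar>\<dots>\<bar> \<le> 1 * ((E0 * C + 8 * kappa) * v\<^sup>2 / (E0 * (c * v) * (E0 * kappa * v)))"
      unfolding abs_mult
    proof (rule mult_mono)
      have "\<bar>E0 * (kappa * v - D) - (E - E0) * D\<bar> \<le> \<bar>E0 * (kappa * v - D)\<bar> + \<bar>(E - E0) * D\<bar>"
        by (rule abs_triangle_ineq4)
      also have "\<dots> = E0 * (kappa * v - D) + (E - E0) * D" using E0 D E D0 by simp
      also have "\<dots> \<le> E0 * (C * v\<^sup>2) + 8 * v * (kappa * v)"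
        using E0 D E D0 v by (intro add_mono mult_mono) auto
      also have "\<dots> = (E0 * C + 8 * kappa) * v\<^sup>2" by (simp add: power2_eq_square algebra_simps)
      finally have num: "\<bar>E0 * (kappa * v - D) - (E - E0) * D\<bar> \<le> (E0 * C + 8 * kappa) * v\<^sup>2" .
      have den: "E0 * (c * v) * (E0 * kappa * v) \<le> E * D * (E0 * kappa * v)"
        using E0 E D D0 v c kappa_pos by (intro mult_right_mono mult_mono) auto
      have "0 < E0 * (c * v) * (E0 * kappa * v)" using E0 v c kappa_pos by simp
      moreover have "0 \<le> (E0 * C + 8 * kappa) * v\<^sup>2" using E0 C kappa_pos by simp
      ultimately have "\<bar>E0 * (kappa * v - D) - (E - E0) * D\<bar> / (E * D * (E0 * kappa * v)) \<le>
          (E0 * C + 8 * kappa) * v\<^sup>2 / (E0 * (c * v) * (E0 * kappa * v))"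
        using num den by (intro frac_le) auto
      moreover have "\<bar>E * D * (E0 * kappa * v)\<bar> = E * D * (E0 * kappa * v)"
        using E D0 E0 v kappa_pos by simp
      ultimately show "\<bar>(E0 * (kappa * v - D) - (E - E0) * D) / (E * D * (E0 * kappa * v))\<bar> \<le>
          (E0 * C + 8 * kappa) * v\<^sup>2 / (E0 * (c * v) * (E0 * kappa * v))"
        unfolding abs_divide by simp
    qed auto
    also have "\<dots> = (E0 * C + 8 * kappa) / (E0 * c * (E0 * kappa))"
      using v by (simp add: power2_eq_square)
    finally show ?thesis .
  qed
  then show ?thesis unfolding E0_def by blast
qed

text \<open>The limit is the contribution of the \<open>cot (t / 2)\<close> part: the two sines of
  \<open>sin_comb\<close> integrate to \<open>pi\<close> and \<open>pi\<close>, the second with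
  weight \<open>-1 / q\<close>. The bounded remainder vanishes by Riemann-Lebesgue.\<close>

lemma green_coefficient_tendsto:
  "(\<lambda>k. \<integral>t. sin_comb q k t * green_density t \<partial>arc_measure) \<longlonglongrightarrow>
     (pi - pi / real q) / (planch_den q 0 * kappa)"
\<comment> \<open>Starting at \<open>k + 2\<close> makes both frequencies \<open>k + 3\<close> and
  \<open>k + 1\<close> of the form \<open>Suc\<close>, as the integral lemmas require.\<close>
proof (rule LIMSEQ_offset[of _ 2])
  define K where "K = 1 / (planch_den q 0 * kappa)"
  define R where "R t = green_density t - sin t / (1 - cos t) / (planch_den q 0 * kappa)" for t
  obtain B where B: "\<And>t. 0 < t \<Longrightarrow> t < pi \<Longrightarrow> \<bar>R t\<bar> \<le> B"
    using green_density_remainder unfolding R_def by blast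
  have [measurable]: "R \<in> borel_measurable arc_measure" unfolding R_def[abs_def] by measurable
  have [measurable]: "(\<lambda>t. sin (c * t)) \<in> borel_measurable arc_measure" for c :: real
    by (intro continuous_imp_measurable_arc continuous_intros)
  have iR: "integrable arc_measure (\<lambda>t. R t * sin (real (Suc k) * t))" for k
  proof (rule integrable_arc_bounded[of _ "B * 1"])
    fix t :: real assume t: "0 < t" "t < pi"
    have "0 \<le> B" using B[OF t] by linarith
    then show "\<bar>R t * sin (real (Suc k) * t)\<bar> \<le> B * 1"
      unfolding abs_mult by (intro mult_mono B[OF t]) auto
  qed measurable
  have split: "(\<integral>t. sin_comb q (k + 2) t * green_density t \<partial>arc_measure) =
      K * (pi - 1 / real q * pi) + ((\<integral>t. R t * sin (real (Suc (k + 2)) * t) \<partial>arc_measure) -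
        1 / real q * (\<integral>t. R t * sin (real (Suc k) * t) \<partial>arc_measure))" for k
  proof -
    have n: "real (k + 2) - 1 = real (Suc k)" by simp
    have "green_density t = K * (sin t / (1 - cos t)) + R t" for t
      by (simp add: R_def K_def)
    then have "sin_comb q (k + 2) t * green_density t =
        K * (sin (real (Suc (k + 2)) * t) * (sin t / (1 - cos t)) -
          1 / real q * (sin (real (Suc k) * t) * (sin t / (1 - cos t)))) +
        (R t * sin (real (Suc (k + 2)) * t) - 1 / real q * (R t * sin (real (Suc k) * t)))" for t
      unfolding sin_comb_def n by (simp add: algebra_simps del: of_nat_Suc)
    then have "(\<integral>t. sin_comb q (k + 2) t * green_density t \<partial>arc_measure) = (\<integral>t.
        K * (sin (real (Suc (k + 2)) * t) * (sin t / (1 - cos t)) -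
          1 / real q * (sin (real (Suc k) * t) * (sin t / (1 - cos t)))) +
        (R t * sin (real (Suc (k + 2)) * t) - 1 / real q * (R t * sin (real (Suc k) * t))) \<partial>arc_measure)"
      by (simp only:)
    also have "\<dots> = K * (pi - 1 / real q * pi) + ((\<integral>t. R t * sin (real (Suc (k + 2)) * t) \<partial>arc_measure) -
        1 / real q * (\<integral>t. R t * sin (real (Suc k) * t) \<partial>arc_measure))"
      by (simp only: Bochner_Integration.integral_add Bochner_Integration.integral_diff
          Bochner_Integration.integrable_add Bochner_Integration.integrable_diff integrable_mult_right
          integral_mult_right_zero integrable_sin_cot_half integral_sin_cot_half(2) iR)
    finally show ?thesis .
  qed
  have RL: "(\<lambda>k. \<integral>t. R t * sin (real (Suc k) * t) \<partial>arc_measure) \<longlonglongrightarrow> 0"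
    by (rule Riemann_Lebesgue_arc[OF _ B]) measurable
  have "(\<lambda>k. K * (pi - 1 / real q * pi) + ((\<integral>t. R t * sin (real (Suc (k + 2)) * t) \<partial>arc_measure) -
        1 / real q * (\<integral>t. R t * sin (real (Suc k) * t) \<partial>arc_measure))) \<longlonglongrightarrow>
      K * (pi - 1 / real q * pi) + (0 - 1 / real q * 0)"
    by (intro tendsto_intros RL LIMSEQ_ignore_initial_segment[OF RL])
  then show "(\<lambda>k. \<integral>t. sin_comb q (k + 2) t * green_density t \<partial>arc_measure) \<longlonglongrightarrow>
     (pi - pi / real q) / (planch_den q 0 * kappa)"
    unfolding split by (simp add: K_def)
qed

text \<open>The integrals converge to a nonzero limit, so their quotient tends to 1 and only the
  quotient of the explicit powers of \<open>q\<close> survives.\<close>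

lemma green_radial_ratio: "(\<lambda>m. green_radial (Suc m) / green_radial m) \<longlonglongrightarrow> real q powr (- 1 / 2)"
proof -
  define I where "I k = (\<integral>t. sin_comb q k t * green_density t \<partial>arc_measure)" for k
  define L where "L = (pi - pi / real q) / (planch_den q 0 * kappa)"
  have "pi / real q < pi / 1" using q by (intro divide_strict_left_mono) auto
  then have L: "L > 0" using planch_den_bounds(1)[OF q] kappa_pos by (simp add: L_def)
  have I: "I \<longlonglongrightarrow> L" unfolding I_def L_def by (rule green_coefficient_tendsto)
  have "(\<lambda>m. real q powr (- 1 / 2) * (I (Suc m) / I m)) \<longlonglongrightarrow> real q powr (- 1 / 2) * (L / L)"
    using L by (intro tendsto_intros I LIMSEQ_Suc[OF I]) auto
  moreover have "green_radial (Suc m) / green_radial m = real q powr (- 1 / 2) * (I (Suc m) / I m)" for m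
  proof -
    have "real q powr (- real (Suc m) / 2) = real q powr (- 1 / 2) * real q powr (- real m / 2)"
      by (simp add: powr_add[symmetric] field_simps)
    moreover have "2 * rho / pi \<noteq> 0" "real q powr (- real m / 2) \<noteq> 0" using rho_pos q by auto
    ultimately show ?thesis unfolding green_radial_def I_def[symmetric] by (simp add: mult_ac)
  qed
  ultimately show ?thesis using L by simp
qed

text \<open>The factor \<open>G(y,y)\<close> cancels between F(x,y) and F(e,y), being
  positive.\<close>

lemma martinK_eq:
  assumes "x \<in> tree_vertices q" "y \<in> tree_vertices q"
  shows "martinK q a x y = green_radial (tdist q x y) / green_radial (tdist q [] y)"
  using green_radial_pos[of "tdist q y y"]
  by (simp add: martinK_def Ffun_def green_eq assms)

lemma hlim_eq:
  assumes "x \<in> tree_vertices q" "y \<in> tree_vertices q"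
  shows "hlim q a x y = phi q (tdist q x y)"
  unfolding hlim_def using pn_ratio_tendsto[OF assms] by (rule limI)

lemma Hker_eq:
  assumes "x \<in> tree_vertices q" "y \<in> tree_vertices q"
  shows "Hker q a x y = phi q (tdist q x y) / phi q (tdist q [] y)"
  by (simp add: Hker_def hlim_eq assms)

end

lemma phi_ratio:
  assumes "q \<ge> 2"
  shows "(\<lambda>m. phi q (Suc m) / phi q m) \<longlonglongrightarrow> real q powr (- 1 / 2)"
proof -
  define b where "b = (real q - 1) / (real q + 1)"
  have b: "b > 0" using assms by (simp add: b_def)
  have "(\<lambda>m. real q powr (- 1 / 2) * (1 + b / (1 + b * real m))) \<longlonglongrightarrow> real q powr (- 1 / 2) * (1 + 0)"
  proof (intro tendsto_intros)
    show "(\<lambda>m. b / (1 + b * real m)) \<longlonglongrightarrow> 0" using b by real_asymp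
  qed
  moreover have "phi q (Suc m) / phi q m = real q powr (- 1 / 2) * (1 + b / (1 + b * real m))" for m
  proof -
    have gen: "(A + b) * (s * P) / (A * P) = s * (1 + b / A)" if "A > 0" "P > 0" for A P s :: real
      using that by (simp add: field_simps)
    have "real q powr (- real (Suc m) / 2) = real q powr (- 1 / 2) * real q powr (- real m / 2)"
      by (simp add: powr_add[symmetric] field_simps)
    then have "phi q (Suc m) = (1 + b * real m + b) * (real q powr (- 1 / 2) * real q powr (- real m / 2))"
      unfolding phi_def b_def[symmetric] by (simp add: distrib_left add_ac)
    moreover have "phi q m = (1 + b * real m) * real q powr (- real m / 2)"
      unfolding phi_def b_def[symmetric] ..
    ultimately show ?thesis
      using gen[of "1 + b * real m" "real q powr (- real m / 2)"] b assms by (simp only:) (simp add: add_pos_nonneg)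
  qed
  ultimately show ?thesis by simp
qed

text \<open>Analytic coincidence is expressed by realising both compactifications on the same space
  \<open>end_top q\<close> with the same boundary values: the identity is then the required
  homeomorphism, and the \<open>Inr\<close> branches give the common value of K and H.\<close>

theorem theorem3p1:
  fixes q :: nat and a :: "nat \<Rightarrow> real"
  assumes "q \<ge> 2"
    and "\<And>d. a d \<ge> 0"
    and "a sums 1"
    and "\<exists>d. odd d \<and> a d > 0"
    and "\<exists>d. even d \<and> a d > 0"
    and "limsup (\<lambda>d. ereal (root d (a d))) = 0"
  shows "ratio_limit_holds q a
    \<and> (\<forall>x\<in>tree_vertices q. \<forall>y\<in>tree_vertices q.
          Hker q a x y = phi q (tdist q x y) / phi q (tdist q [] y))
    \<and> kernel_compactification (tree_vertices q) (Hker q a) (end_top q)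
        (\<lambda>x w. case w of Inl y \<Rightarrow> Hker q a x y | Inr \<xi> \<Rightarrow> real q powr (- hor q x \<xi> / 2))
    \<and> kernel_compactification (tree_vertices q) (martinK q a) (end_top q)
        (\<lambda>x w. case w of Inl y \<Rightarrow> martinK q a x y | Inr \<xi> \<Rightarrow> real q powr (- hor q x \<xi> / 2))"
proof -
  interpret radial_walk q a
    using assms(1-5) by unfold_locales
  have "ratio_limit_holds q a"
    unfolding ratio_limit_holds_def using pn_ratio_tendsto phi_pos[OF q] by blast
  moreover have "kernel_compactification (tree_vertices q) (Hker q a) (end_top q)
        (\<lambda>x w. case w of Inl y \<Rightarrow> Hker q a x y | Inr \<xi> \<Rightarrow> real q powr (- hor q x \<xi> / 2))"
    by (rule kernel_compactification_end_top[OF q phi_pos[OF q] phi_ratio[OF q] Hker_eq])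
  moreover have "kernel_compactification (tree_vertices q) (martinK q a) (end_top q)
        (\<lambda>x w. case w of Inl y \<Rightarrow> martinK q a x y | Inr \<xi> \<Rightarrow> real q powr (- hor q x \<xi> / 2))"
    by (rule kernel_compactification_end_top[OF q green_radial_pos green_radial_ratio martinK_eq])
  ultimately show ?thesis using Hker_eq by blast
qed

end
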